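(* If $P$ is a contractible symmetric operad in $\mathbf{Cat}$, then the operad $P$ has a unique pseudo-commutative structure. The 2-monad $\underline P$ on $\mathbf{Cat}$ induced by $P$ then obtains a symmetric pseudo-commutativity.
   Context: Permutations compose as functions; $0\in\mathbb N$, $\mathbb N_+=\mathbb N\setminus\{0\}$; $e_n\in\Sigma_n$ is the identity. $\beta(\tau_1,\dots,\tau_n)$ is the block sum of $\tau_i\in\Sigma_{k_i}$, and for $\sigma\in\Sigma_n$, $\delta_{k_1,\dots,k_n}(\sigma)$ sends $k_1+\cdots+k_{i-1}+a$ ($1\le a\le k_i$) to $(\sum_{\sigma(i')<\sigma(i)}k_{i'})+a$; $\mu^\Sigma(\sigma;\tau_1,\dots,\tau_n)=\delta_{k_1,\dots,k_n}(\sigma)\beta(\tau_1,\dots,\tau_n)$. An underlined symbol such as $\underline q$ denotes a list $q,\dots,q$ of the appropriate length. Symmetric operad $P$ in $\mathbf{Cat}$: small categories $P(n)$ ($n\in\mathbb N$) with strict right $\Sigma_n$-actions by functors, an object $\mathrm{id}\in P(1)$, and functors $\mu:P(n)\times P(k_1)\times\cdots\times P(k_n)\to P(\sum k_i)$, strictly unital and associative, with $\mu(p;q_1\tau_1,\dots,q_n\tau_n)=\mu(p;q_1,\dots,q_n)\beta(\tau_1,\dots,\tau_n)$ and $\mu(p\sigma;q_1,\dots,q_n)=\mu(p;q_{\sigma^{-1}(1)},\dots,q_{\sigma^{-1}(n)})\delta_{k_1,\dots,k_n}(\sigma)$. It is contractible if each category $P(n)$ is equivalent to the terminal category. $\tau_{m,n}\in\Sigma_{mn}$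 is the permutation $(i-1)n+j\mapsto(j-1)m+i$ ($1\le i\le m$, $1\le j\le n$). Pseudo-commutative structure on the symmetric operad $P$: elements $t_{m,n}\in\Sigma_{mn}$ for $m,n\in\mathbb N_+$ with underlying permutation $\tau_{m,n}$ (so, here, $t_{m,n}=\tau_{m,n}$), and isomorphisms $\lambda_{p,q}:\mu(p;\underline q)\cdot t_{m,n}\cong\mu(q;\underline p)$ natural in $p\in P(n)$, $q\in P(m)$, such that: (1) $t_{1,n}=e_n$, $t_{m,1}=e_m$, and $\lambda_{p,\mathrm{id}}$, $\lambda_{\mathrm{id},q}$ are identities; (2) $\mu^\Sigma(g;\underline h)\,t_{m,n}=t_{m,n}\,\mu^\Sigma(h;\underline g)$ for $g\in\Sigma_n$, $h\in\Sigma_m$; (3) $\lambda_{p,q}\cdot\mu^\Sigma(h;\underline g)=\lambda_{p\cdot g,q\cdot h}$ for $p\in P(n)$, $g\in\Sigma_n$, $q\in P(m)$, $h\in\Sigma_m$; (4) for $l,m_1,\dots,m_l,n\in\mathbb N_+$, $M=\sum m_i$: $\beta(t_{n,m_1},\dots,t_{n,m_l})\cdot\delta(t_{n,l})=t_{n,M}$, where $\delta$ has as subscript the list $m_1,\dots,m_l$ repeated $n$ times; (5) for $l,m,n_1,\dots,n_m\in\mathbb N_+$, $N=\sum n_i$: $\delta_{\underline{n_1},\dots,\underline{n_m}}(t_{m,l})\cdot\beta(t_{n_1,l},\dots,t_{n_m,l})=t_{N,l}$, each $n_i$ repeated $l$ times; (6) for $l,m_i,n\in\mathbb N_+$, $p\in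 P(l)$, $q_i\in P(m_i)$ ($1\le i\le l$), $r\in P(n)$, with $M=\sum m_i$, the morphism $\lambda_{\mu(p;q_1,\dots,q_l),r}:\mu(\mu(p;q_1,\dots,q_l);\underline r)\cdot t_{n,M}\to\mu(r;\underline{\mu(p;q_1,\dots,q_l)})$ equals $\mu(\lambda_{p,r};1,\dots,1)\circ\big(\mu(1_p;\lambda_{q_1,r},\dots,\lambda_{q_l,r})\cdot\delta(t_{n,l})\big)$ with $\delta$ as in (4), using the operad axioms to identify sources and targets; (7) for $l,m,n_i\in\mathbb N_+$, $p\in P(l)$, $q\in P(m)$, $r_i\in P(n_i)$ ($1\le i\le m$), with $N=\sum n_i$, the morphism $\lambda_{p,\mu(q;r_1,\dots,r_m)}:\mu(p;\underline{\mu(q;r_1,\dots,r_m)})\cdot t_{N,l}\to\mu(\mu(q;r_1,\dots,r_m);\underline p)$ equals $\mu(1_q;\lambda_{p,r_1},\dots,\lambda_{p,r_m})\circ\big(\mu(\lambda_{p,q};1,\dots,1)\cdot\beta(t_{n_1,l},\dots,t_{n_m,l})\big)$, again identifying sources and targets by the operad axioms. Induced 2-monad: $T=\underline P$, $\underline P(X)=\coprod_nP(n)\otimes_{\Sigma_n}X^n$, the coequalizer in $\mathbf{Cat}$ identifying $(p\sigma,\underline x)$ with $(p,\sigma\cdot\underline x)$, $\sigma\cdot(x_1,\dots,x_n)=(x_{\sigma^{-1}(1)},\dots,x_{\sigma^{-1}(n)})$; unit $\eta(x)=[\mathrm{id};x]$, multiplication $\mu$ induced by that of $P$. It has left strength $d_{A,B}:A\times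 TB\to T(A\times B)$, $(a,[p;b_1,\dots,b_n])\mapsto[p;(a,b_1),\dots,(a,b_n)]$, and right strength $d^*_{A,B}:TA\times B\to T(A\times B)$, $([p;a_1,\dots,a_n],b)\mapsto[p;(a_1,b),\dots,(a_n,b)]$. Pseudo-commutative structure (pseudo-commutativity) on the 2-monad $T$: an invertible modification with components $\gamma_{A,B}:\mu_{A\times B}\circ Td_{A,B}\circ d^*_{A,TB}\Rightarrow\mu_{A\times B}\circ Td^*_{A,B}\circ d_{TA,B}:TA\times TB\to T(A\times B)$ such that ($*$ is whiskering): $\gamma_{A\times B,C}*(d_{A,B}\times1)=d_{A,B\times C}*(1_A\times\gamma_{B,C})$; $\gamma_{A,B\times C}*(1\times d_{B,C})=\gamma_{A\times B,C}*(d^*_{A,B}\times1)$; $\gamma_{A,B\times C}*(1\times d^*_{B,C})=d^*_{A\times B,C}*(\gamma_{A,B}\times1_C)$; $\gamma_{A,B}*(\eta_A\times1)$ is the identity on $d$; $\gamma_{A,B}*(1\times\eta_B)$ is the identity on $d^*$; $\gamma_{A,B}*(\mu_A\times1)=\big((\mu_{A\times B}\circ Td^*_{A,B})*\gamma_{TA,B}\big)\cdot\big(\mu_{A\times B}*T\gamma_{A,B}*d^*_{TA,TB}\big)$; $\gamma_{A,B}*(1\times\mu_B)=\big(\mu_{A\times B}*T\gamma_{A,B}*d_{TA,TB}\big)\cdot\big((\mu_{A\times B}\circ Td_{A,B})*\gamma_{A,TB}\big)$; in the last two, each whiskered 2-cell is taken in the evident position in the pasting, using naturality of $\mu$ and the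 strengths and associativity of $\mu$. It is symmetric if, with $c$ the symmetry of the cartesian product, $Tc_{A,B}*\gamma_{A,B}*c_{TB,TA}=\gamma_{B,A}^{-1}$ for all $A,B$. *)

theory Defs
  imports Main "HOL-Combinatorics.Permutations"
begin

section \<open>Categories, functors, natural transformations\<close>

record ('o, 'a) cat =
  Obj :: "'o set"
  Arr :: "'a set"
  src :: "'a \<Rightarrow> 'o"
  trg :: "'a \<Rightarrow> 'o"
  idt :: "'o \<Rightarrow> 'a"
  cmp :: "'a \<Rightarrow> 'a \<Rightarrow> 'a"  \<comment> \<open>\<open>cmp C g f\<close> is \<open>g\<close> after \<open>f\<close>\<close>

definition category :: "('o, 'a) cat \<Rightarrow> bool" where
  "category C \<longleftrightarrow>
     (\<forall>f\<in>Arr C. src C f \<in> Obj C \<and> trg C f \<in> Obj C) \<and>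
     (\<forall>x\<in>Obj C. idt C x \<in> Arr C \<and> src C (idt C x) = x \<and> trg C (idt C x) = x) \<and>
     (\<forall>f\<in>Arr C. \<forall>g\<in>Arr C. trg C f = src C g \<longrightarrow>
        cmp C g f \<in> Arr C \<and> src C (cmp C g f) = src C f \<and> trg C (cmp C g f) = trg C g) \<and>
     (\<forall>f\<in>Arr C. cmp C f (idt C (src C f)) = f \<and> cmp C (idt C (trg C f)) f = f) \<and>
     (\<forall>f\<in>Arr C. \<forall>g\<in>Arr C. \<forall>h\<in>Arr C. trg C f = src C g \<longrightarrow> trg C g = src C h \<longrightarrow>
        cmp C h (cmp C g f) = cmp C (cmp C h g) f)"

definition inverse_arrows :: "('o, 'a) cat \<Rightarrow> 'a \<Rightarrow> 'a \<Rightarrow> bool" where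
  "inverse_arrows C f g \<longleftrightarrow> f \<in> Arr C \<and> g \<in> Arr C \<and> src C g = trg C f \<and> trg C g = src C f \<and>
     cmp C g f = idt C (src C f) \<and> cmp C f g = idt C (trg C f)"

definition iso_arrow :: "('o, 'a) cat \<Rightarrow> 'a \<Rightarrow> bool" where
  "iso_arrow C f \<longleftrightarrow> (\<exists>g. inverse_arrows C f g)"

record ('o, 'a, 'p, 'b) fnct =
  FO :: "'o \<Rightarrow> 'p"
  FA :: "'a \<Rightarrow> 'b"

definition is_functor :: "('o, 'a) cat \<Rightarrow> ('p, 'b) cat \<Rightarrow> ('o, 'a, 'p, 'b) fnct \<Rightarrow> bool" where
  "is_functor C D F \<longleftrightarrow>
     (\<forall>x\<in>Obj C. FO F x \<in> Obj D \<and> FA F (idt C x) = idt D (FO F x)) \<and>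
     (\<forall>f\<in>Arr C. FA F f \<in> Arr D \<and> src D (FA F f) = FO F (src C f) \<and> trg D (FA F f) = FO F (trg C f)) \<and>
     (\<forall>f\<in>Arr C. \<forall>g\<in>Arr C. trg C f = src C g \<longrightarrow> FA F (cmp C g f) = cmp D (FA F g) (FA F f))"

definition id_fnct :: "('o, 'a, 'o, 'a) fnct" where
  "id_fnct = \<lparr>FO = \<lambda>x. x, FA = \<lambda>f. f\<rparr>"

definition fcomp :: "('p, 'b, 'q, 'c) fnct \<Rightarrow> ('o, 'a, 'p, 'b) fnct \<Rightarrow> ('o, 'a, 'q, 'c) fnct"
    (infixl "\<odot>" 70) where
  "G \<odot> F = \<lparr>FO = \<lambda>x. FO G (FO F x), FA = \<lambda>f. FA G (FA F f)\<rparr>"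

definition nat_trans :: "('o, 'a) cat \<Rightarrow> ('p, 'b) cat \<Rightarrow> ('o, 'a, 'p, 'b) fnct \<Rightarrow>
    ('o, 'a, 'p, 'b) fnct \<Rightarrow> ('o \<Rightarrow> 'b) \<Rightarrow> bool" where
  "nat_trans C D F G \<alpha> \<longleftrightarrow>
     (\<forall>x\<in>Obj C. \<alpha> x \<in> Arr D \<and> src D (\<alpha> x) = FO F x \<and> trg D (\<alpha> x) = FO G x) \<and>
     (\<forall>f\<in>Arr C. cmp D (\<alpha> (trg C f)) (FA F f) = cmp D (FA G f) (\<alpha> (src C f)))"

definition nat_iso :: "('o, 'a) cat \<Rightarrow> ('p, 'b) cat \<Rightarrow> ('o, 'a, 'p, 'b) fnct \<Rightarrow>
    ('o, 'a, 'p, 'b) fnct \<Rightarrow> ('o \<Rightarrow> 'b) \<Rightarrow> bool" where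
  "nat_iso C D F G \<alpha> \<longleftrightarrow> nat_trans C D F G \<alpha> \<and> (\<forall>x\<in>Obj C. iso_arrow D (\<alpha> x))"

definition vcomp :: "('p, 'b) cat \<Rightarrow> ('o \<Rightarrow> 'b) \<Rightarrow> ('o \<Rightarrow> 'b) \<Rightarrow> 'o \<Rightarrow> 'b" where
  "vcomp D \<beta> \<alpha> x = cmp D (\<beta> x) (\<alpha> x)"

definition equivalent_cats :: "('o, 'a) cat \<Rightarrow> ('p, 'b) cat \<Rightarrow> bool" where
  "equivalent_cats C D \<longleftrightarrow> (\<exists>F G \<eta> \<epsilon>. is_functor C D F \<and> is_functor D C G \<and>
     nat_iso C C id_fnct (G \<odot> F) \<eta> \<and> nat_iso D D (F \<odot> G) id_fnct \<epsilon>)"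

definition terminal_cat :: "(unit, unit) cat" where
  "terminal_cat = \<lparr>Obj = UNIV, Arr = UNIV, src = \<lambda>_. (), trg = \<lambda>_. (), idt = \<lambda>_. (), cmp = \<lambda>_ _. ()\<rparr>"

definition prod_cat :: "('o, 'a) cat \<Rightarrow> ('p, 'b) cat \<Rightarrow> ('o \<times> 'p, 'a \<times> 'b) cat" where
  "prod_cat C D =
     \<lparr>Obj = Obj C \<times> Obj D, Arr = Arr C \<times> Arr D,
      src = map_prod (src C) (src D), trg = map_prod (trg C) (trg D),
      idt = map_prod (idt C) (idt D),
      cmp = \<lambda>g f. (cmp C (fst g) (fst f), cmp D (snd g) (snd f))\<rparr>"

definition list_prod_cat :: "('o, 'a) cat list \<Rightarrow> ('o list, 'a list) cat" where
  "list_prod_cat Cs =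
     \<lparr>Obj = {xs. list_all2 (\<lambda>C x. x \<in> Obj C) Cs xs}, Arr = {fs. list_all2 (\<lambda>C f. f \<in> Arr C) Cs fs},
      src = map2 src Cs, trg = map2 trg Cs, idt = map2 idt Cs,
      cmp = \<lambda>gs fs. map2 (\<lambda>C (g, f). cmp C g f) Cs (zip gs fs)\<rparr>"


section \<open>Permutations\<close>

text \<open>Elements of \<open>\<Sigma>\<^sub>n\<close> are functions with \<open>\<sigma> permutes {1..n}\<close>. Lists of inputs
  \<open>x\<^sub>1, \<dots>, x\<^sub>n\<close> are 1-based in the formulas, hence the shifts by one in list indices.\<close>

definition act_list :: "(nat \<Rightarrow> nat) \<Rightarrow> 'x list \<Rightarrow> 'x list" where
  "act_list \<sigma> xs = map (\<lambda>i. xs ! (inv \<sigma> i - 1)) [1..<Suc (length xs)]"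

definition offset :: "nat list \<Rightarrow> nat \<Rightarrow> nat" where
  "offset ks i = sum_list (take (i - 1) ks)"

definition block :: "nat list \<Rightarrow> nat \<Rightarrow> nat" where
  "block ks j = (THE i. 1 \<le> i \<and> i \<le> length ks \<and> offset ks i < j \<and> j \<le> offset ks i + ks ! (i - 1))"

definition block_sum :: "nat list \<Rightarrow> (nat \<Rightarrow> nat) list \<Rightarrow> nat \<Rightarrow> nat" where
  "block_sum ks \<tau>s j =
     (if j \<in> {1..sum_list ks}
      then (let i = block ks j in offset ks i + (\<tau>s ! (i - 1)) (j - offset ks i)) else j)"

definition block_perm :: "nat list \<Rightarrow> (nat \<Rightarrow> nat) \<Rightarrow> nat \<Rightarrow> nat" where
  "block_perm ks \<sigma> j =
     (if j \<in> {1..sum_list ks}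
      then (let i = block ks j in
              (\<Sum>i' \<in> {i' \<in> {1..length ks}. \<sigma> i' < \<sigma> i}. ks ! (i' - 1)) + (j - offset ks i)) else j)"

definition mu_sym :: "nat list \<Rightarrow> (nat \<Rightarrow> nat) \<Rightarrow> (nat \<Rightarrow> nat) list \<Rightarrow> nat \<Rightarrow> nat" where
  "mu_sym ks \<sigma> \<tau>s = block_perm ks \<sigma> \<circ> block_sum ks \<tau>s"

text \<open>\<open>(i - 1) n + j \<mapsto> (j - 1) m + i\<close>; here \<open>i - 1 = (x - 1) div n\<close> and \<open>j - 1 = (x - 1) mod n\<close>.\<close>

definition transpose_perm :: "nat \<Rightarrow> nat \<Rightarrow> nat \<Rightarrow> nat" where
  "transpose_perm m n x =
     (if x \<in> {1..m * n} then ((x - 1) mod n) * m + ((x - 1) div n + 1) else x)"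


section \<open>Symmetric operads in Cat\<close>

record ('o, 'a) operad =
  Op :: "nat \<Rightarrow> ('o, 'a) cat"
  act :: "nat \<Rightarrow> (nat \<Rightarrow> nat) \<Rightarrow> ('o, 'a, 'o, 'a) fnct"
  unit :: 'o
  mu :: "nat list \<Rightarrow> ('o \<times> 'o list, 'a \<times> 'a list, 'o, 'a) fnct"

text \<open>\<open>mu P [k\<^sub>1, \<dots>, k\<^sub>n]\<close> is \<open>P(n) \<times> P(k\<^sub>1) \<times> \<dots> \<times> P(k\<^sub>n) \<rightarrow> P(\<Sum>k\<^sub>i)\<close>.
  Equations between functors hold iff they hold on objects and on arrows, so the operad
  equations are stated once, for a family of sets, and imposed on both.\<close>

definition operad_equations ::
  "(nat \<Rightarrow> 'x set) \<Rightarrow> (nat \<Rightarrow> (nat \<Rightarrow> nat) \<Rightarrow> 'x \<Rightarrow> 'x) \<Rightarrow> 'x \<Rightarrow> (nat list \<Rightarrow> 'x \<times> 'x list \<Rightarrow> 'x) \<Rightarrow> bool"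
  where
  "operad_equations X a u m \<longleftrightarrow>
     (\<forall>n. \<forall>p\<in>X n. a n id p = p) \<and>
     (\<forall>n \<sigma> \<tau>. \<forall>p\<in>X n. \<sigma> permutes {1..n} \<longrightarrow> \<tau> permutes {1..n} \<longrightarrow>
        a n (\<sigma> \<circ> \<tau>) p = a n \<tau> (a n \<sigma> p)) \<and>
     (\<forall>k. \<forall>q\<in>X k. m [k] (u, [q]) = q) \<and>
     (\<forall>n. \<forall>p\<in>X n. m (replicate n 1) (p, replicate n u) = p) \<and>
     (\<forall>kss p qs rss. p \<in> X (length kss) \<longrightarrow>
        list_all2 (\<lambda>ks q. q \<in> X (length ks)) kss qs \<longrightarrow>
        list_all2 (list_all2 (\<lambda>k r. r \<in> X k)) kss rss \<longrightarrow>
        m (concat kss) (m (map length kss) (p, qs), concat rss) =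
        m (map sum_list kss) (p, map2 (\<lambda>ks (q, rs). m ks (q, rs)) kss (zip qs rss))) \<and>
     (\<forall>ks p qs \<tau>s. p \<in> X (length ks) \<longrightarrow> list_all2 (\<lambda>k q. q \<in> X k) ks qs \<longrightarrow>
        list_all2 (\<lambda>k \<tau>. \<tau> permutes {1..k}) ks \<tau>s \<longrightarrow>
        m ks (p, map2 (\<lambda>k (\<tau>, q). a k \<tau> q) ks (zip \<tau>s qs)) =
        a (sum_list ks) (block_sum ks \<tau>s) (m ks (p, qs))) \<and>
     (\<forall>ks p qs \<sigma>. p \<in> X (length ks) \<longrightarrow> list_all2 (\<lambda>k q. q \<in> X k) ks qs \<longrightarrow>
        \<sigma> permutes {1..length ks} \<longrightarrow>
        m ks (a (length ks) \<sigma> p, qs) =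
        a (sum_list ks) (block_perm ks \<sigma>) (m (act_list \<sigma> ks) (p, act_list \<sigma> qs)))"

definition symmetric_operad :: "('o, 'a) operad \<Rightarrow> bool" where
  "symmetric_operad P \<longleftrightarrow>
     (\<forall>n. category (Op P n)) \<and>
     (\<forall>n \<sigma>. \<sigma> permutes {1..n} \<longrightarrow> is_functor (Op P n) (Op P n) (act P n \<sigma>)) \<and>
     unit P \<in> Obj (Op P 1) \<and>
     (\<forall>ks. is_functor (prod_cat (Op P (length ks)) (list_prod_cat (map (Op P) ks)))
                   (Op P (sum_list ks)) (mu P ks)) \<and>
     operad_equations (\<lambda>n. Obj (Op P n)) (\<lambda>n \<sigma>. FO (act P n \<sigma>)) (unit P) (\<lambda>ks. FO (mu P ks)) \<and>
     operad_equations (\<lambda>n. Arr (Op P n)) (\<lambda>n \<sigma>. FA (act P n \<sigma>)) (idt (Op P 1) (unit P))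
       (\<lambda>ks. FA (mu P ks))"

definition contractible_operad :: "('o, 'a) operad \<Rightarrow> bool" where
  "contractible_operad P \<longleftrightarrow> (\<forall>n. equivalent_cats (Op P n) terminal_cat)"


section \<open>Pseudo-commutative structures on a symmetric operad\<close>

text \<open>A structure is a pair \<open>(t, lam)\<close>, where \<open>lam n m p q\<close> is \<open>\<lambda>\<^bsub>p,q\<^esub>\<close> for
  \<open>p \<in> P(n)\<close> and \<open>q \<in> P(m)\<close>. All arities are positive.\<close>

definition lam_dom :: "('o, 'a) operad \<Rightarrow> (nat \<Rightarrow> nat \<Rightarrow> nat \<Rightarrow> nat) \<Rightarrow> nat \<Rightarrow> nat \<Rightarrow>
    ('o \<times> 'o, 'a \<times> 'a, 'o, 'a) fnct" where
  "lam_dom P t n m = act P (m * n) (t m n) \<odot> mu P (replicate n m) \<odot>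
     \<lparr>FO = \<lambda>(p, q). (p, replicate n q), FA = \<lambda>(p, q). (p, replicate n q)\<rparr>"

definition lam_cod :: "('o, 'a) operad \<Rightarrow> nat \<Rightarrow> nat \<Rightarrow> ('o \<times> 'o, 'a \<times> 'a, 'o, 'a) fnct" where
  "lam_cod P n m = mu P (replicate m n) \<odot>
     \<lparr>FO = \<lambda>(p, q). (q, replicate m p), FA = \<lambda>(p, q). (q, replicate m p)\<rparr>"

definition operad_pseudo_comm ::
  "('o, 'a) operad \<Rightarrow> (nat \<Rightarrow> nat \<Rightarrow> nat \<Rightarrow> nat) \<Rightarrow> (nat \<Rightarrow> nat \<Rightarrow> 'o \<Rightarrow> 'o \<Rightarrow> 'a) \<Rightarrow> bool" where
  "operad_pseudo_comm P t lam \<longleftrightarrow>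
     (\<forall>m>0. \<forall>n>0. t m n = transpose_perm m n) \<and>
     (\<forall>n>0. \<forall>m>0. nat_iso (prod_cat (Op P n) (Op P m)) (Op P (m * n))
        (lam_dom P t n m) (lam_cod P n m) (\<lambda>(p, q). lam n m p q)) \<and>
     (\<forall>n>0. t 1 n = id \<and> t n 1 = id) \<and>
     (\<forall>n>0. \<forall>p\<in>Obj (Op P n). lam n 1 p (unit P) = idt (Op P n) p) \<and>
     (\<forall>m>0. \<forall>q\<in>Obj (Op P m). lam 1 m (unit P) q = idt (Op P m) q) \<and>
     (\<forall>n>0. \<forall>m>0. \<forall>g h. g permutes {1..n} \<longrightarrow> h permutes {1..m} \<longrightarrow>
        mu_sym (replicate n m) g (replicate n h) \<circ> t m n =
        t m n \<circ> mu_sym (replicate m n) h (replicate m g)) \<and>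
     (\<forall>n>0. \<forall>m>0. \<forall>g h. \<forall>p\<in>Obj (Op P n). \<forall>q\<in>Obj (Op P m).
        g permutes {1..n} \<longrightarrow> h permutes {1..m} \<longrightarrow>
        FA (act P (m * n) (mu_sym (replicate m n) h (replicate m g))) (lam n m p q) =
        lam n m (FO (act P n g) p) (FO (act P m h) q)) \<and>
     (\<forall>l>0. \<forall>n>0. \<forall>ms. length ms = l \<longrightarrow> (\<forall>k\<in>set ms. 0 < k) \<longrightarrow>
        block_sum (map (\<lambda>k. n * k) ms) (map (\<lambda>k. t n k) ms) \<circ>
          block_perm (concat (replicate n ms)) (t n l) = t n (sum_list ms)) \<and>
     (\<forall>l>0. \<forall>m>0. \<forall>ns. length ns = m \<longrightarrow> (\<forall>k\<in>set ns. 0 < k) \<longrightarrow>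
        block_perm (concat (map (\<lambda>k. replicate l k) ns)) (t m l) \<circ>
          block_sum (map (\<lambda>k. k * l) ns) (map (\<lambda>k. t k l) ns) = t (sum_list ns) l) \<and>
     (\<forall>l>0. \<forall>n>0. \<forall>ms p qs r. length ms = l \<longrightarrow> (\<forall>k\<in>set ms. 0 < k) \<longrightarrow> p \<in> Obj (Op P l) \<longrightarrow>
        list_all2 (\<lambda>k q. q \<in> Obj (Op P k)) ms qs \<longrightarrow> r \<in> Obj (Op P n) \<longrightarrow>
        lam (sum_list ms) n (FO (mu P ms) (p, qs)) r =
        cmp (Op P (n * sum_list ms))
          (FA (mu P (concat (replicate n ms)))
             (lam l n p r, concat (replicate n (map2 (\<lambda>k q. idt (Op P k) q) ms qs))))
          (FA (act P (n * sum_list ms) (block_perm (concat (replicate n ms)) (t n l)))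
             (FA (mu P (map (\<lambda>k. n * k) ms))
                (idt (Op P l) p, map2 (\<lambda>k q. lam k n q r) ms qs)))) \<and>
     (\<forall>l>0. \<forall>m>0. \<forall>ns p q rs. length ns = m \<longrightarrow> (\<forall>k\<in>set ns. 0 < k) \<longrightarrow> p \<in> Obj (Op P l) \<longrightarrow>
        q \<in> Obj (Op P m) \<longrightarrow> list_all2 (\<lambda>k r. r \<in> Obj (Op P k)) ns rs \<longrightarrow>
        lam l (sum_list ns) p (FO (mu P ns) (q, rs)) =
        cmp (Op P (sum_list ns * l))
          (FA (mu P (map (\<lambda>k. k * l) ns))
             (idt (Op P m) q, map2 (\<lambda>k r. lam l k p r) ns rs))
          (FA (act P (sum_list ns * l) (block_sum (map (\<lambda>k. k * l) ns) (map (\<lambda>k. t k l) ns)))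
             (FA (mu P (concat (map (\<lambda>k. replicate l k) ns)))
                (lam l m p q, concat (map2 (\<lambda>k r. replicate l (idt (Op P k) r)) ns rs)))))"


section \<open>The 2-category Cat\<close>

text \<open>The components of a modification are indexed by all small categories, so all small categories
  must live in one type. \<open>('p, 'x) univ\<close> is a universe containing an arbitrary type \<open>'x\<close> of atoms
  and closed under pairing and under the formal terms \<open>[p; x\<^sub>1, \<dots>, x\<^sub>n]\<close> with \<open>p :: 'p\<close>.
  For a fixed operad \<open>P :: ('o, 'a) operad\<close>, a small category is one whose objects form a set
  of elements of \<open>('o, 'x) univ\<close> and whose arrows form a set of elements of \<open>('a, 'y) univ\<close>;
  these are closed under binary products and under the 2-monad of \<open>P\<close>, and contain an isomorphic
  copy of every category with objects in \<open>'x\<close> and arrows in \<open>'y\<close>.\<close>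

datatype ('p, 'x) univ =
    UAtom 'x
  | UPair (ufst: "('p, 'x) univ") (usnd: "('p, 'x) univ")
  | UTerm (uop: 'p) (uargs: "('p, 'x) univ list")

type_synonym ('o, 'a, 'x, 'y) ucat = "(('o, 'x) univ, ('a, 'y) univ) cat"
type_synonym ('o, 'a, 'x, 'y) ufnct =
  "(('o, 'x) univ, ('a, 'y) univ, ('o, 'x) univ, ('a, 'y) univ) fnct"
type_synonym ('o, 'a, 'x, 'y) utrans = "('o, 'x) univ \<Rightarrow> ('a, 'y) univ"

definition whisker_left :: "('o, 'a, 'x, 'y) ufnct \<Rightarrow> ('o, 'a, 'x, 'y) utrans \<Rightarrow> ('o, 'a, 'x, 'y) utrans"
    (infixr "\<rhd>" 65) where
  "(G \<rhd> \<alpha>) x = FA G (\<alpha> x)"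

definition whisker_right :: "('o, 'a, 'x, 'y) utrans \<Rightarrow> ('o, 'a, 'x, 'y) ufnct \<Rightarrow> ('o, 'a, 'x, 'y) utrans"
    (infixl "\<lhd>" 66) where
  "(\<alpha> \<lhd> F) x = \<alpha> (FO F x)"

fun umap_pair :: "(('p, 'x) univ \<Rightarrow> ('q, 'y) univ) \<Rightarrow> (('p, 'x) univ \<Rightarrow> ('q, 'y) univ) \<Rightarrow>
    ('p, 'x) univ \<Rightarrow> ('q, 'y) univ" where
  "umap_pair f g (UPair x y) = UPair (f x) (g y)"
| "umap_pair f g _ = undefined"

definition uprod :: "('o, 'a, 'x, 'y) ucat \<Rightarrow> ('o, 'a, 'x, 'y) ucat \<Rightarrow> ('o, 'a, 'x, 'y) ucat"
    (infixr "\<otimes>" 72) where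
  "A \<otimes> B =
     \<lparr>Obj = {UPair x y |x y. x \<in> Obj A \<and> y \<in> Obj B}, Arr = {UPair f g |f g. f \<in> Arr A \<and> g \<in> Arr B},
      src = umap_pair (src A) (src B), trg = umap_pair (trg A) (trg B),
      idt = umap_pair (idt A) (idt B),
      cmp = \<lambda>g f. UPair (cmp A (ufst g) (ufst f)) (cmp B (usnd g) (usnd f))\<rparr>"

definition fprod :: "('o, 'a, 'x, 'y) ufnct \<Rightarrow> ('o, 'a, 'x, 'y) ufnct \<Rightarrow> ('o, 'a, 'x, 'y) ufnct"
    (infixr "\<otimes>\<^sub>f" 72) where
  "F \<otimes>\<^sub>f G = \<lparr>FO = umap_pair (FO F) (FO G), FA = umap_pair (FA F) (FA G)\<rparr>"

definition ntprod :: "('o, 'a, 'x, 'y) utrans \<Rightarrow> ('o, 'a, 'x, 'y) utrans \<Rightarrow> ('o, 'a, 'x, 'y) utrans"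
    (infixr "\<otimes>\<^sub>n" 72) where
  "\<alpha> \<otimes>\<^sub>n \<beta> = umap_pair \<alpha> \<beta>"

definition uswap :: "('o, 'a, 'x, 'y) ufnct" where
  "uswap = \<lparr>FO = \<lambda>z. UPair (usnd z) (ufst z), FA = \<lambda>z. UPair (usnd z) (ufst z)\<rparr>"

definition uassoc :: "('o, 'a, 'x, 'y) ufnct" where
  "uassoc = \<lparr>FO = \<lambda>z. UPair (ufst (ufst z)) (UPair (usnd (ufst z)) (usnd z)),
            FA = \<lambda>z. UPair (ufst (ufst z)) (UPair (usnd (ufst z)) (usnd z))\<rparr>"


section \<open>The 2-monad induced by a symmetric operad\<close>

text \<open>\<open>\<Coprod>\<^sub>n P(n) \<times> X\<^sup>n\<close>; the summand of \<open>(p, xs)\<close> is \<open>n = length xs\<close>.\<close>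

definition terms_cat :: "('o, 'a) operad \<Rightarrow> ('u, 'v) cat \<Rightarrow> ('o \<times> 'u list, 'a \<times> 'v list) cat" where
  "terms_cat P X =
     \<lparr>Obj = {(p, xs). p \<in> Obj (Op P (length xs)) \<and> set xs \<subseteq> Obj X},
      Arr = {(f, ys). f \<in> Arr (Op P (length ys)) \<and> set ys \<subseteq> Arr X},
      src = \<lambda>(f, ys). (src (Op P (length ys)) f, map (src X) ys),
      trg = \<lambda>(f, ys). (trg (Op P (length ys)) f, map (trg X) ys),
      idt = \<lambda>(p, xs). (idt (Op P (length xs)) p, map (idt X) xs),
      cmp = \<lambda>(g, zs) (f, ys). (cmp (Op P (length ys)) g f, map2 (cmp X) zs ys)\<rparr>"

text \<open>The coequalizer of \<open>\<Coprod>\<^sub>n P(n) \<times> \<Sigma>\<^sub>n \<times> X\<^sup>n \<rightrightarrows> \<Coprod>\<^sub>n P(n) \<times> X\<^sup>n\<close> in Cat. On objects it is the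
  set of orbits. On arrows orbits alone do not suffice, because \<open>\<Sigma>\<^sub>n\<close> need not act freely on
  objects: one has to pass to the least equivalence relation that contains the orbit relation
  and is compatible with composition. Any two arrows whose classes are composable have
  composable representatives, so no formal composites are needed. The universal property is
  \<open>Q_coequalizer\<close> below.\<close>

inductive obj_equiv :: "('o, 'a) operad \<Rightarrow> ('u, 'v) cat \<Rightarrow> 'o \<times> 'u list \<Rightarrow> 'o \<times> 'u list \<Rightarrow> bool"
  for P X where
  orbit: "\<lbrakk>(p, xs) \<in> Obj (terms_cat P X); \<sigma> permutes {1..length xs}\<rbrakk> \<Longrightarrow>
     obj_equiv P X (FO (act P (length xs) \<sigma>) p, xs) (p, act_list \<sigma> xs)"
| refl: "obj_equiv P X z z"
| sym: "obj_equiv P X z w \<Longrightarrow> obj_equiv P X w z"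
| trans: "obj_equiv P X z w \<Longrightarrow> obj_equiv P X w v \<Longrightarrow> obj_equiv P X z v"

inductive arr_equiv :: "('o, 'a) operad \<Rightarrow> ('u, 'v) cat \<Rightarrow> 'a \<times> 'v list \<Rightarrow> 'a \<times> 'v list \<Rightarrow> bool"
  for P X where
  orbit: "\<lbrakk>(f, ys) \<in> Arr (terms_cat P X); \<sigma> permutes {1..length ys}\<rbrakk> \<Longrightarrow>
     arr_equiv P X (FA (act P (length ys) \<sigma>) f, ys) (f, act_list \<sigma> ys)"
| refl: "arr_equiv P X z z"
| sym: "arr_equiv P X z w \<Longrightarrow> arr_equiv P X w z"
| trans: "arr_equiv P X z w \<Longrightarrow> arr_equiv P X w v \<Longrightarrow> arr_equiv P X z v"
| comp: "\<lbrakk>arr_equiv P X g g'; arr_equiv P X f f';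
     f \<in> Arr (terms_cat P X); g \<in> Arr (terms_cat P X);
     f' \<in> Arr (terms_cat P X); g' \<in> Arr (terms_cat P X);
     trg (terms_cat P X) f = src (terms_cat P X) g;
     trg (terms_cat P X) f' = src (terms_cat P X) g'\<rbrakk> \<Longrightarrow>
     arr_equiv P X (cmp (terms_cat P X) g f) (cmp (terms_cat P X) g' f')"

text \<open>To stay inside the universe, a class is represented by a chosen element:
  \<open>ocls P X (p, xs)\<close> and \<open>acls P X (f, ys)\<close> are the classes \<open>[p; xs]\<close> and \<open>[f; ys]\<close>.
  Two terms have the same value iff they are equivalent, see \<open>ocls_eq_iff\<close> and \<open>acls_eq_iff\<close>.\<close>

definition ocls :: "('o, 'a) operad \<Rightarrow> ('o, 'a, 'x, 'y) ucat \<Rightarrow>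
    'o \<times> ('o, 'x) univ list \<Rightarrow> ('o, 'x) univ" where
  "ocls P X z = case_prod UTerm (SOME w. obj_equiv P X z w)"

definition acls :: "('o, 'a) operad \<Rightarrow> ('o, 'a, 'x, 'y) ucat \<Rightarrow>
    'a \<times> ('a, 'y) univ list \<Rightarrow> ('a, 'y) univ" where
  "acls P X z = case_prod UTerm (SOME w. arr_equiv P X z w)"

definition uterm :: "('p, 'x) univ \<Rightarrow> 'p \<times> ('p, 'x) univ list" where
  "uterm t = (uop t, uargs t)"

lemma uterm_UTerm [simp]: "uterm (UTerm p xs) = (p, xs)"
  by (simp add: uterm_def)

lemma equiv_uterm_ocls: "obj_equiv P X z (uterm (ocls P X z))"
  using someI[of "obj_equiv P X z", OF obj_equiv.refl] by (simp add: ocls_def case_prod_beta)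

lemma equiv_uterm_acls: "arr_equiv P X z (uterm (acls P X z))"
  using someI[of "arr_equiv P X z", OF arr_equiv.refl] by (simp add: acls_def case_prod_beta)

lemma ocls_eq_iff: "ocls P X z = ocls P X w \<longleftrightarrow> obj_equiv P X z w"
proof
  assume "ocls P X z = ocls P X w"
  then show "obj_equiv P X z w"
    by (metis equiv_uterm_ocls obj_equiv.sym obj_equiv.trans)
next
  assume "obj_equiv P X z w"
  then have "obj_equiv P X z = obj_equiv P X w"
    by (blast intro: obj_equiv.sym obj_equiv.trans)
  then show "ocls P X z = ocls P X w" by (simp add: ocls_def)
qed

lemma acls_eq_iff: "acls P X z = acls P X w \<longleftrightarrow> arr_equiv P X z w"
proof
  assume "acls P X z = acls P X w"
  then show "arr_equiv P X z w"
    by (metis equiv_uterm_acls arr_equiv.sym arr_equiv.trans)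
next
  assume "arr_equiv P X z w"
  then have "arr_equiv P X z = arr_equiv P X w"
    by (blast intro: arr_equiv.sym arr_equiv.trans)
  then show "acls P X z = acls P X w" by (simp add: acls_def)
qed

definition Tcat :: "('o, 'a) operad \<Rightarrow> ('o, 'a, 'x, 'y) ucat \<Rightarrow> ('o, 'a, 'x, 'y) ucat" where
  "Tcat P X =
     \<lparr>Obj = ocls P X ` Obj (terms_cat P X), Arr = acls P X ` Arr (terms_cat P X),
      src = \<lambda>f. ocls P X (src (terms_cat P X) (uterm f)),
      trg = \<lambda>f. ocls P X (trg (terms_cat P X) (uterm f)),
      idt = \<lambda>x. acls P X (idt (terms_cat P X) (uterm x)),
      cmp = \<lambda>g f. acls P X (SOME h. \<exists>g' f'. arr_equiv P X (uterm g) g' \<and> arr_equiv P X (uterm f) f' \<and>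
        g' \<in> Arr (terms_cat P X) \<and> f' \<in> Arr (terms_cat P X) \<and>
        trg (terms_cat P X) f' = src (terms_cat P X) g' \<and> h = cmp (terms_cat P X) g' f')\<rparr>"

text \<open>\<open>T\<close> on functors and on natural transformations. The category passed as an argument is the
  one in which the resulting terms have their entries.\<close>

definition T_fun :: "('o, 'a) operad \<Rightarrow> ('o, 'a, 'x, 'y) ucat \<Rightarrow> ('o, 'a, 'x, 'y) ufnct \<Rightarrow>
    ('o, 'a, 'x, 'y) ufnct" where
  "T_fun P Y F = \<lparr>FO = \<lambda>t. ocls P Y (uop t, map (FO F) (uargs t)),
                  FA = \<lambda>t. acls P Y (uop t, map (FA F) (uargs t))\<rparr>"

definition T_nt :: "('o, 'a) operad \<Rightarrow> ('o, 'a, 'x, 'y) ucat \<Rightarrow> ('o, 'a, 'x, 'y) utrans \<Rightarrow>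
    ('o, 'a, 'x, 'y) utrans" where
  "T_nt P Y \<alpha> t = acls P Y (idt (Op P (length (uargs t))) (uop t), map \<alpha> (uargs t))"

definition T_eta :: "('o, 'a) operad \<Rightarrow> ('o, 'a, 'x, 'y) ucat \<Rightarrow> ('o, 'a, 'x, 'y) ufnct" where
  "T_eta P X = \<lparr>FO = \<lambda>x. ocls P X (unit P, [x]), FA = \<lambda>f. acls P X (idt (Op P 1) (unit P), [f])\<rparr>"

definition T_mu :: "('o, 'a) operad \<Rightarrow> ('o, 'a, 'x, 'y) ucat \<Rightarrow> ('o, 'a, 'x, 'y) ufnct" where
  "T_mu P X =
     \<lparr>FO = \<lambda>t. ocls P X (FO (mu P (map (length \<circ> uargs) (uargs t))) (uop t, map uop (uargs t)),
                         concat (map uargs (uargs t))),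
      FA = \<lambda>t. acls P X (FA (mu P (map (length \<circ> uargs) (uargs t))) (uop t, map uop (uargs t)),
                         concat (map uargs (uargs t)))\<rparr>"

definition lstr :: "('o, 'a) operad \<Rightarrow> ('o, 'a, 'x, 'y) ucat \<Rightarrow> ('o, 'a, 'x, 'y) ucat \<Rightarrow>
    ('o, 'a, 'x, 'y) ufnct" where
  "lstr P A B =
     \<lparr>FO = \<lambda>z. ocls P (A \<otimes> B) (uop (usnd z), map (\<lambda>b. UPair (ufst z) b) (uargs (usnd z))),
      FA = \<lambda>z. acls P (A \<otimes> B) (uop (usnd z), map (\<lambda>b. UPair (ufst z) b) (uargs (usnd z)))\<rparr>"

definition rstr :: "('o, 'a) operad \<Rightarrow> ('o, 'a, 'x, 'y) ucat \<Rightarrow> ('o, 'a, 'x, 'y) ucat \<Rightarrow>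
    ('o, 'a, 'x, 'y) ufnct" where
  "rstr P A B =
     \<lparr>FO = \<lambda>z. ocls P (A \<otimes> B) (uop (ufst z), map (\<lambda>a. UPair a (usnd z)) (uargs (ufst z))),
      FA = \<lambda>z. acls P (A \<otimes> B) (uop (ufst z), map (\<lambda>a. UPair a (usnd z)) (uargs (ufst z)))\<rparr>"


section \<open>Pseudo-commutativities of the induced 2-monad\<close>

definition gamma_dom :: "('o, 'a) operad \<Rightarrow> ('o, 'a, 'x, 'y) ucat \<Rightarrow> ('o, 'a, 'x, 'y) ucat \<Rightarrow>
    ('o, 'a, 'x, 'y) ufnct" where
  "gamma_dom P A B = T_mu P (A \<otimes> B) \<odot> T_fun P (Tcat P (A \<otimes> B)) (lstr P A B) \<odot> rstr P A (Tcat P B)"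

definition gamma_cod :: "('o, 'a) operad \<Rightarrow> ('o, 'a, 'x, 'y) ucat \<Rightarrow> ('o, 'a, 'x, 'y) ucat \<Rightarrow>
    ('o, 'a, 'x, 'y) ufnct" where
  "gamma_cod P A B = T_mu P (A \<otimes> B) \<odot> T_fun P (Tcat P (A \<otimes> B)) (rstr P A B) \<odot> lstr P (Tcat P A) B"

text \<open>A modification between 2-natural transformations \<open>TA \<times> TB \<rightarrow> T(A \<times> B)\<close>: the only axiom
  is compatibility with functors \<open>A \<rightarrow> A'\<close> and \<open>B \<rightarrow> B'\<close>.\<close>

definition invertible_modification :: "('o, 'a) operad \<Rightarrow>
    (('o, 'a, 'x, 'y) ucat \<Rightarrow> ('o, 'a, 'x, 'y) ucat \<Rightarrow> ('o, 'a, 'x, 'y) utrans) \<Rightarrow> bool" where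
  "invertible_modification P \<gamma> \<longleftrightarrow>
     (\<forall>A B. category A \<longrightarrow> category B \<longrightarrow>
        nat_iso (Tcat P A \<otimes> Tcat P B) (Tcat P (A \<otimes> B)) (gamma_dom P A B) (gamma_cod P A B) (\<gamma> A B)) \<and>
     (\<forall>A A' B B' F G. category A \<longrightarrow> category A' \<longrightarrow> category B \<longrightarrow> category B' \<longrightarrow>
        is_functor A A' F \<longrightarrow> is_functor B B' G \<longrightarrow>
        (\<forall>z \<in> Obj (Tcat P A \<otimes> Tcat P B).
           (T_fun P (A' \<otimes> B') (F \<otimes>\<^sub>f G) \<rhd> \<gamma> A B) z =
           (\<gamma> A' B' \<lhd> (T_fun P A' F \<otimes>\<^sub>f T_fun P B' G)) z))"

text \<open>In the first three axioms the associativity isomorphism \<open>uassoc\<close> of the product, implicit in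
  informal notation, is written out.\<close>

definition monad_pseudo_comm :: "('o, 'a) operad \<Rightarrow>
    (('o, 'a, 'x, 'y) ucat \<Rightarrow> ('o, 'a, 'x, 'y) ucat \<Rightarrow> ('o, 'a, 'x, 'y) utrans) \<Rightarrow> bool" where
  "monad_pseudo_comm P \<gamma> \<longleftrightarrow>
     invertible_modification P \<gamma> \<and>
     (\<forall>A B C. category A \<longrightarrow> category B \<longrightarrow> category C \<longrightarrow>
        (\<forall>z \<in> Obj ((A \<otimes> Tcat P B) \<otimes> Tcat P C).
           (T_fun P (A \<otimes> (B \<otimes> C)) uassoc \<rhd> (\<gamma> (A \<otimes> B) C \<lhd> (lstr P A B \<otimes>\<^sub>f id_fnct))) z =
           ((lstr P A (B \<otimes> C) \<rhd> (idt A \<otimes>\<^sub>n \<gamma> B C)) \<lhd> uassoc) z) \<and>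
        (\<forall>z \<in> Obj ((Tcat P A \<otimes> B) \<otimes> Tcat P C).
           ((\<gamma> A (B \<otimes> C) \<lhd> (id_fnct \<otimes>\<^sub>f lstr P B C)) \<lhd> uassoc) z =
           (T_fun P (A \<otimes> (B \<otimes> C)) uassoc \<rhd> (\<gamma> (A \<otimes> B) C \<lhd> (rstr P A B \<otimes>\<^sub>f id_fnct))) z) \<and>
        (\<forall>z \<in> Obj ((Tcat P A \<otimes> Tcat P B) \<otimes> C).
           ((\<gamma> A (B \<otimes> C) \<lhd> (id_fnct \<otimes>\<^sub>f rstr P B C)) \<lhd> uassoc) z =
           (T_fun P (A \<otimes> (B \<otimes> C)) uassoc \<rhd> (rstr P (A \<otimes> B) C \<rhd> (\<gamma> A B \<otimes>\<^sub>n idt C))) z)) \<and>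
     (\<forall>A B. category A \<longrightarrow> category B \<longrightarrow>
        (\<forall>z \<in> Obj (A \<otimes> Tcat P B).
           (\<gamma> A B \<lhd> (T_eta P A \<otimes>\<^sub>f id_fnct)) z = idt (Tcat P (A \<otimes> B)) (FO (lstr P A B) z)) \<and>
        (\<forall>z \<in> Obj (Tcat P A \<otimes> B).
           (\<gamma> A B \<lhd> (id_fnct \<otimes>\<^sub>f T_eta P B)) z = idt (Tcat P (A \<otimes> B)) (FO (rstr P A B) z)) \<and>
        (\<forall>z \<in> Obj (Tcat P (Tcat P A) \<otimes> Tcat P B).
           (\<gamma> A B \<lhd> (T_mu P A \<otimes>\<^sub>f id_fnct)) z =
           vcomp (Tcat P (A \<otimes> B))
             ((T_mu P (A \<otimes> B) \<odot> T_fun P (Tcat P (A \<otimes> B)) (rstr P A B)) \<rhd> \<gamma> (Tcat P A) B)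
             (T_mu P (A \<otimes> B) \<rhd> (T_nt P (Tcat P (A \<otimes> B)) (\<gamma> A B) \<lhd> rstr P (Tcat P A) (Tcat P B))) z) \<and>
        (\<forall>z \<in> Obj (Tcat P A \<otimes> Tcat P (Tcat P B)).
           (\<gamma> A B \<lhd> (id_fnct \<otimes>\<^sub>f T_mu P B)) z =
           vcomp (Tcat P (A \<otimes> B))
             (T_mu P (A \<otimes> B) \<rhd> (T_nt P (Tcat P (A \<otimes> B)) (\<gamma> A B) \<lhd> lstr P (Tcat P A) (Tcat P B)))
             ((T_mu P (A \<otimes> B) \<odot> T_fun P (Tcat P (A \<otimes> B)) (lstr P A B)) \<rhd> \<gamma> A (Tcat P B)) z))"

definition symmetric_monad_pseudo_comm :: "('o, 'a) operad \<Rightarrow>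
    (('o, 'a, 'x, 'y) ucat \<Rightarrow> ('o, 'a, 'x, 'y) ucat \<Rightarrow> ('o, 'a, 'x, 'y) utrans) \<Rightarrow> bool" where
  "symmetric_monad_pseudo_comm P \<gamma> \<longleftrightarrow>
     monad_pseudo_comm P \<gamma> \<and>
     (\<forall>A B. category A \<longrightarrow> category B \<longrightarrow>
        (\<forall>z \<in> Obj (Tcat P B \<otimes> Tcat P A).
           inverse_arrows (Tcat P (B \<otimes> A)) (\<gamma> B A z) ((T_fun P (B \<otimes> A) uswap \<rhd> (\<gamma> A B \<lhd> uswap)) z)))"


section \<open>\<open>Tcat P X\<close> is a category and the coequalizer in Cat\<close>

lemma length_act_list [simp]: "length (act_list \<sigma> xs) = length xs"
  by (simp add: act_list_def del: upt_Suc)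

lemma inv_shift:
  assumes "\<sigma> permutes {1..n}" "i < n"
  shows "inv \<sigma> (Suc i) - 1 < n" "1 \<le> inv \<sigma> (Suc i)" "inv \<sigma> (Suc i) \<le> n"
proof -
  have "inv \<sigma> (Suc i) \<in> {1..n}"
    using permutes_in_image[OF permutes_inv[OF assms(1)], of "Suc i"] assms(2) by auto
  then show "inv \<sigma> (Suc i) - 1 < n" "1 \<le> inv \<sigma> (Suc i)" "inv \<sigma> (Suc i) \<le> n" by auto
qed

lemma nth_act_list: "i < length xs \<Longrightarrow> act_list \<sigma> xs ! i = xs ! (inv \<sigma> (Suc i) - 1)"
  by (simp add: act_list_def del: upt_Suc)

lemma map_act_list:
  "\<sigma> permutes {1..length xs} \<Longrightarrow> map f (act_list \<sigma> xs) = act_list \<sigma> (map f xs)"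
  by (rule nth_equalityI) (auto simp: nth_act_list inv_shift[simplified])

lemma map2_act_list:
  "\<sigma> permutes {1..length xs} \<Longrightarrow> length ys = length xs \<Longrightarrow>
   map2 f (act_list \<sigma> xs) (act_list \<sigma> ys) = act_list \<sigma> (map2 f xs ys)"
  by (rule nth_equalityI) (auto simp: nth_act_list inv_shift[simplified])

lemma act_list_inv:
  assumes "\<sigma> permutes {1..length xs}"
  shows "act_list \<sigma> (act_list (inv \<sigma>) xs) = xs" "act_list (inv \<sigma>) (act_list \<sigma> xs) = xs"
proof -
  have i: "inv \<sigma> permutes {1..length xs}" using assms by (rule permutes_inv)
  have b: "bij \<sigma>" using assms by (rule permutes_bij)
  show "act_list \<sigma> (act_list (inv \<sigma>) xs) = xs"
  proof (rule nth_equalityI)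
    fix j assume j: "j < length (act_list \<sigma> (act_list (inv \<sigma>) xs))"
    then have j': "j < length xs" by simp
    have "Suc (inv \<sigma> (Suc j) - 1) = inv \<sigma> (Suc j)" using inv_shift(2)[OF assms j'] by simp
    then show "act_list \<sigma> (act_list (inv \<sigma>) xs) ! j = xs ! j"
      using j' inv_shift(1)[OF assms j'] b
      by (simp add: nth_act_list inv_inv_eq bij_is_surj surj_f_inv_f del: Suc_pred)
  qed simp
  show "act_list (inv \<sigma>) (act_list \<sigma> xs) = xs"
  proof (rule nth_equalityI)
    fix j assume j: "j < length (act_list (inv \<sigma>) (act_list \<sigma> xs))"
    then have j': "j < length xs" by simp
    have "Suc (inv (inv \<sigma>) (Suc j) - 1) = inv (inv \<sigma>) (Suc j)" using inv_shift(2)[OF i j'] by simp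
    then show "act_list (inv \<sigma>) (act_list \<sigma> xs) ! j = xs ! j"
      using j' inv_shift(1)[OF i j'] b
      by (simp add: nth_act_list inv_inv_eq bij_is_inj inv_f_f del: Suc_pred)
  qed simp
qed

lemma set_act_list: "\<sigma> permutes {1..length xs} \<Longrightarrow> set (act_list \<sigma> xs) = set xs"
proof -
  have *: "set (act_list \<sigma> xs) \<subseteq> set xs" if "\<sigma> permutes {1..length xs}" for \<sigma> and xs :: "'b list"
    using that inv_shift(1)[OF that] by (fastforce simp: in_set_conv_nth nth_act_list)
  assume a: "\<sigma> permutes {1..length xs}"
  show ?thesis
    using *[OF a] *[of "inv \<sigma>" "act_list \<sigma> xs"] act_list_inv[OF a] permutes_inv[OF a] by auto
qed

lemma map2_idt_l: "category X \<Longrightarrow> set ys \<subseteq> Arr X \<Longrightarrow> map2 (cmp X) ys (map (idt X) (map (src X) ys)) = ys"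
  by (induction ys) (auto simp: category_def)
lemma map2_idt_r: "category X \<Longrightarrow> set ys \<subseteq> Arr X \<Longrightarrow> map2 (cmp X) (map (idt X) (map (trg X) ys)) ys = ys"
  by (induction ys) (auto simp: category_def)
lemma map2_cmp: "category X \<Longrightarrow> set ys \<subseteq> Arr X \<Longrightarrow> set zs \<subseteq> Arr X \<Longrightarrow> map (trg X) ys = map (src X) zs \<Longrightarrow>
   set (map2 (cmp X) zs ys) \<subseteq> Arr X \<and> map (src X) (map2 (cmp X) zs ys) = map (src X) ys
   \<and> map (trg X) (map2 (cmp X) zs ys) = map (trg X) zs"
proof (induction ys arbitrary: zs)
  case (Cons y ys)
  then obtain z zs' where [simp]: "zs = z # zs'" by (cases zs) auto
  show ?case using Cons.prems Cons.IH[of zs'] by (auto simp: category_def)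
qed simp
lemma map2_assoc: "category X \<Longrightarrow> set ys \<subseteq> Arr X \<Longrightarrow> set zs \<subseteq> Arr X \<Longrightarrow> set ws \<subseteq> Arr X \<Longrightarrow>
   map (trg X) ys = map (src X) zs \<Longrightarrow> map (trg X) zs = map (src X) ws \<Longrightarrow>
   map2 (cmp X) ws (map2 (cmp X) zs ys) = map2 (cmp X) (map2 (cmp X) ws zs) ys"
proof (induction ys arbitrary: zs ws)
  case (Cons y ys)
  then obtain z zs' where [simp]: "zs = z # zs'" by (cases zs) auto
  with Cons.prems obtain w ws' where [simp]: "ws = w # ws'" by (cases ws) auto
  show ?case using Cons.prems Cons.IH[of zs' ws'] by (auto simp: category_def)
qed simp

lemma len_eq: "map f xs = map g ys \<Longrightarrow> length xs = length ys"
  by (metis length_map)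

lemma terms_category:
  assumes P: "\<And>n. category (Op P n)" and X: "category X"
  shows "category (terms_cat P X)"
proof -
  have P': "f \<in> Arr (Op P n) \<Longrightarrow> src (Op P n) f \<in> Obj (Op P n) \<and> trg (Op P n) f \<in> Obj (Op P n) \<and>
     cmp (Op P n) f (idt (Op P n) (src (Op P n) f)) = f \<and> cmp (Op P n) (idt (Op P n) (trg (Op P n) f)) f = f"
   "x \<in> Obj (Op P n) \<Longrightarrow> idt (Op P n) x \<in> Arr (Op P n) \<and> src (Op P n) (idt (Op P n) x) = x \<and> trg (Op P n) (idt (Op P n) x) = x"
   "f \<in> Arr (Op P n) \<Longrightarrow> g \<in> Arr (Op P n) \<Longrightarrow> trg (Op P n) f = src (Op P n) g \<Longrightarrow>
     cmp (Op P n) g f \<in> Arr (Op P n) \<and> src (Op P n) (cmp (Op P n) g f) = src (Op P n) f \<and> trg (Op P n) (cmp (Op P n) g f) = trg (Op P n) g"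
   "f \<in> Arr (Op P n) \<Longrightarrow> g \<in> Arr (Op P n) \<Longrightarrow> h \<in> Arr (Op P n) \<Longrightarrow> trg (Op P n) f = src (Op P n) g \<Longrightarrow> trg (Op P n) g = src (Op P n) h \<Longrightarrow>
     cmp (Op P n) h (cmp (Op P n) g f) = cmp (Op P n) (cmp (Op P n) h g) f" for n f g h x
    using P[of n] unfolding category_def by auto
  have X': "set fs \<subseteq> Arr X \<Longrightarrow> f \<in> set fs \<Longrightarrow> src X f \<in> Obj X \<and> trg X f \<in> Obj X"
    "set xs \<subseteq> Obj X \<Longrightarrow> x \<in> set xs \<Longrightarrow> idt X x \<in> Arr X \<and> src X (idt X x) = x \<and> trg X (idt X x) = x" for f fs x xs
    using X unfolding category_def by auto
  show ?thesis
    unfolding category_def[of "terms_cat P X"]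
  proof (intro conjI ballI impI)
    fix f assume "f \<in> Arr (terms_cat P X)"
    then show "src (terms_cat P X) f \<in> Obj (terms_cat P X)" "trg (terms_cat P X) f \<in> Obj (terms_cat P X)"
      using P' X' by (auto simp: terms_cat_def)
  next
    fix x assume "x \<in> Obj (terms_cat P X)"
    then show "idt (terms_cat P X) x \<in> Arr (terms_cat P X)" "src (terms_cat P X) (idt (terms_cat P X) x) = x"
       "trg (terms_cat P X) (idt (terms_cat P X) x) = x"
      using P' X' by (auto simp: terms_cat_def o_def intro!: map_idI)
  next
    fix f assume "f \<in> Arr (terms_cat P X)"
    then show "cmp (terms_cat P X) f (idt (terms_cat P X) (src (terms_cat P X) f)) = f"
       "cmp (terms_cat P X) (idt (terms_cat P X) (trg (terms_cat P X) f)) f = f"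
      using P' map2_idt_l[OF X] map2_idt_r[OF X] by (auto simp: terms_cat_def)
  next
    fix f g assume a: "f \<in> Arr (terms_cat P X)" "g \<in> Arr (terms_cat P X)" "trg (terms_cat P X) f = src (terms_cat P X) g"
    obtain f1 ys where f: "f = (f1, ys)" by force
    obtain g1 zs where g: "g = (g1, zs)" by force
    have l: "length ys = length zs" using a f g by (auto simp: terms_cat_def dest: len_eq)
    show "cmp (terms_cat P X) g f \<in> Arr (terms_cat P X)" "src (terms_cat P X) (cmp (terms_cat P X) g f) = src (terms_cat P X) f"
      "trg (terms_cat P X) (cmp (terms_cat P X) g f) = trg (terms_cat P X) g"
      using a l P'(3)[of f1 "length zs" g1] map2_cmp[OF X, of ys zs] unfolding f g by (auto simp: terms_cat_def)
    fix h assume b: "h \<in> Arr (terms_cat P X)" "trg (terms_cat P X) g = src (terms_cat P X) h"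
    obtain h1 ws where h: "h = (h1, ws)" by force
    have l2: "length zs = length ws" using b h g by (auto simp: terms_cat_def dest: len_eq)
    show "cmp (terms_cat P X) h (cmp (terms_cat P X) g f) = cmp (terms_cat P X) (cmp (terms_cat P X) h g) f"
      using a b l l2 P'(4)[of f1 "length zs" g1 h1] map2_assoc[OF X, of ys zs ws] unfolding f g h by (auto simp: terms_cat_def)
  qed
qed

locale operad_on_category =
  fixes P :: "('o,'a) operad" and X :: "('o, 'a, 'x, 'y) ucat"
  assumes P: "symmetric_operad P" and X: "category X"
begin
abbreviation "C \<equiv> terms_cat P X"
abbreviation "Q \<equiv> Tcat P X"

lemma C: "category C" by (rule terms_category) (use P X in \<open>auto simp: symmetric_operad_def\<close>)

lemma act_fun: "\<sigma> permutes {1..n} \<Longrightarrow> is_functor (Op P n) (Op P n) (act P n \<sigma>)"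
  using P by (auto simp: symmetric_operad_def)

lemma act_comp:
  assumes "\<sigma> permutes {1..n}" "\<tau> permutes {1..n}"
  shows "p \<in> Obj (Op P n) \<Longrightarrow> FO (act P n (\<sigma> \<circ> \<tau>)) p = FO (act P n \<tau>) (FO (act P n \<sigma>) p)"
   "f \<in> Arr (Op P n) \<Longrightarrow> FA (act P n (\<sigma> \<circ> \<tau>)) f = FA (act P n \<tau>) (FA (act P n \<sigma>) f)"
   "p \<in> Obj (Op P n) \<Longrightarrow> FO (act P n id) p = p"
   "f \<in> Arr (Op P n) \<Longrightarrow> FA (act P n id) f = f"
proof -
  have "operad_equations (\<lambda>n. Obj (Op P n)) (\<lambda>n \<sigma>. FO (act P n \<sigma>)) (unit P) (\<lambda>ks. FO (mu P ks))"
     "operad_equations (\<lambda>n. Arr (Op P n)) (\<lambda>n \<sigma>. FA (act P n \<sigma>)) (idt (Op P 1) (unit P)) (\<lambda>ks. FA (mu P ks))"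
    using P by (auto simp: symmetric_operad_def)
  note e = this[unfolded operad_equations_def]
  note e1 = e(1)[THEN conjunct1] e(1)[THEN conjunct2, THEN conjunct1]
  note e2 = e(2)[THEN conjunct1] e(2)[THEN conjunct2, THEN conjunct1]
  show "p \<in> Obj (Op P n) \<Longrightarrow> FO (act P n (\<sigma> \<circ> \<tau>)) p = FO (act P n \<tau>) (FO (act P n \<sigma>) p)"
   "p \<in> Obj (Op P n) \<Longrightarrow> FO (act P n id) p = p" using e1 assms by blast+
  show "f \<in> Arr (Op P n) \<Longrightarrow> FA (act P n (\<sigma> \<circ> \<tau>)) f = FA (act P n \<tau>) (FA (act P n \<sigma>) f)"
   "f \<in> Arr (Op P n) \<Longrightarrow> FA (act P n id) f = f" using e2 assms by blast+
qed

lemma act_inv: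
  assumes "\<sigma> permutes {1..n}"
  shows "p \<in> Obj (Op P n) \<Longrightarrow> FO (act P n (inv \<sigma>)) (FO (act P n \<sigma>) p) = p"
   "f \<in> Arr (Op P n) \<Longrightarrow> FA (act P n (inv \<sigma>)) (FA (act P n \<sigma>) f) = f"
   "p \<in> Obj (Op P n) \<Longrightarrow> FO (act P n \<sigma>) (FO (act P n (inv \<sigma>)) p) = p"
   "f \<in> Arr (Op P n) \<Longrightarrow> FA (act P n \<sigma>) (FA (act P n (inv \<sigma>)) f) = f"
  using act_comp[OF assms permutes_inv[OF assms]] act_comp[OF permutes_inv[OF assms] assms]
  by (simp_all add: permutes_inv_o[OF assms])

lemma oeq_carrier: "obj_equiv P X z w \<Longrightarrow> z \<in> Obj C \<longleftrightarrow> w \<in> Obj C"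
proof (induction rule: obj_equiv.induct)
  case (orbit p xs \<sigma>)
  then show ?case using act_fun[OF orbit(2)] by (auto simp: terms_cat_def is_functor_def set_act_list)
qed auto

lemma aeq_carrier: "arr_equiv P X z w \<Longrightarrow> z \<in> Arr C \<longleftrightarrow> w \<in> Arr C"
proof (induction rule: arr_equiv.induct)
  case (orbit p xs \<sigma>)
  then show ?case using act_fun[OF orbit(2)] by (auto simp: terms_cat_def is_functor_def set_act_list)
next
  case (comp g g' f f')
  then show ?case using C unfolding category_def by blast
qed auto

lemma aeq_src: "arr_equiv P X z w \<Longrightarrow> z \<in> Arr C \<Longrightarrow>
  obj_equiv P X (src C z) (src C w) \<and> obj_equiv P X (trg C z) (trg C w)"
proof (induction rule: arr_equiv.induct)
  case (orbit f ys \<sigma>)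
  have F: "f \<in> Arr (Op P (length ys))" "set ys \<subseteq> Arr X" using orbit by (auto simp: terms_cat_def)
  have S: "(src (Op P (length ys)) f, map (src X) ys) \<in> Obj C" "(trg (Op P (length ys)) f, map (trg X) ys) \<in> Obj C"
  proof -
    have "src C (f, ys) \<in> Obj C" "trg C (f, ys) \<in> Obj C" using orbit(1) C unfolding category_def by blast+
    then show "(src (Op P (length ys)) f, map (src X) ys) \<in> Obj C" "(trg (Op P (length ys)) f, map (trg X) ys) \<in> Obj C"
      by (simp_all add: terms_cat_def)
  qed
  show ?case using act_fun[OF orbit(2)] F
     obj_equiv.orbit[OF S(1), of \<sigma>] obj_equiv.orbit[OF S(2), of \<sigma>] orbit(2)
    by (simp add: terms_cat_def is_functor_def map_act_list)
next
  case (sym z w)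
  then show ?case using aeq_carrier[OF sym(1)] by (auto intro: obj_equiv.sym)
next
  case (trans z w v)
  then show ?case using aeq_carrier[OF trans(1)] by (auto intro: obj_equiv.trans)
next
  case (comp g g' f f')
  then show ?case using C unfolding category_def by force
qed (auto intro: obj_equiv.refl)

lemma lift:
  "obj_equiv P X x y \<Longrightarrow>
   (\<forall>g\<in>Arr C. src C g = y \<longrightarrow> (\<exists>g'. arr_equiv P X g g' \<and> src C g' = x)) \<and>
   (\<forall>g\<in>Arr C. src C g = x \<longrightarrow> (\<exists>g'. arr_equiv P X g g' \<and> src C g' = y))"
proof (induction rule: obj_equiv.induct)
  case (orbit p xs \<sigma>)
  let ?n = "length xs"
  have i: "inv \<sigma> permutes {1..?n}" using orbit(2) by (rule permutes_inv)
  show ?case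
  proof (intro conjI ballI impI)
    fix g assume g: "g \<in> Arr C" "src C g = (p, act_list \<sigma> xs)"
    obtain f ys where [simp]: "g = (f, ys)" by force
    have m: "map (src X) ys = act_list \<sigma> xs" using g by (simp add: terms_cat_def)
    have l: "length ys = ?n" using arg_cong[OF m, of length] by simp
    have f: "f \<in> Arr (Op P ?n)" "set ys \<subseteq> Arr X" "src (Op P ?n) f = p" using g l by (auto simp: terms_cat_def)
    have a: "(f, act_list (inv \<sigma>) ys) \<in> Arr C" using f l i by (auto simp: terms_cat_def set_act_list)
    have "arr_equiv P X (FA (act P ?n \<sigma>) f, act_list (inv \<sigma>) ys) (f, act_list \<sigma> (act_list (inv \<sigma>) ys))"
      using arr_equiv.orbit[OF a, of \<sigma>] orbit(2) l by simp
    then have "arr_equiv P X (FA (act P ?n \<sigma>) f, act_list (inv \<sigma>) ys) g" using act_list_inv(1)[of \<sigma> ys] orbit(2) l by simp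
    moreover have "src C (FA (act P ?n \<sigma>) f, act_list (inv \<sigma>) ys) = (FO (act P ?n \<sigma>) p, xs)"
      using act_fun[OF orbit(2)] f l i m act_list_inv(2)[OF orbit(2)]
      by (simp add: terms_cat_def is_functor_def map_act_list)
    ultimately show "\<exists>g'. arr_equiv P X g g' \<and> src C g' = (FO (act P ?n \<sigma>) p, xs)" by (blast intro: arr_equiv.sym)
  next
    fix g assume g: "g \<in> Arr C" "src C g = (FO (act P ?n \<sigma>) p, xs)"
    obtain f ys where [simp]: "g = (f, ys)" by force
    have m: "map (src X) ys = xs" using g by (simp add: terms_cat_def)
    have l: "length ys = ?n" using arg_cong[OF m, of length] by simp
    have p: "p \<in> Obj (Op P ?n)" using orbit by (auto simp: terms_cat_def)
    have f: "f \<in> Arr (Op P ?n)" "set ys \<subseteq> Arr X" "src (Op P ?n) f = FO (act P ?n \<sigma>) p" using g l by (auto simp: terms_cat_def)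
    let ?f = "FA (act P ?n (inv \<sigma>)) f"
    have F: "?f \<in> Arr (Op P ?n)" "src (Op P ?n) ?f = p" using act_fun[OF i] f act_inv(1)[OF orbit(2) p]
      by (auto simp: is_functor_def)
    have a: "(?f, ys) \<in> Arr C" using F f l by (auto simp: terms_cat_def)
    have "arr_equiv P X g (?f, act_list \<sigma> ys)"
      using arr_equiv.orbit[OF a, of \<sigma>] orbit(2) l act_inv(4)[OF orbit(2) f(1)] by simp
    moreover have "src C (?f, act_list \<sigma> ys) = (p, act_list \<sigma> xs)"
      using F l m orbit(2) by (simp add: terms_cat_def map_act_list)
    ultimately show "\<exists>g'. arr_equiv P X g g' \<and> src C g' = (p, act_list \<sigma> xs)" by blast
  qed
next
  case (refl z) then show ?case by (auto intro: arr_equiv.refl)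
next
  case (sym z w) then show ?case by blast
next
  case (trans z w v)
  then show ?case by (meson aeq_carrier arr_equiv.trans)
qed

lemma oeq_idt: "obj_equiv P X z w \<Longrightarrow> z \<in> Obj C \<Longrightarrow> arr_equiv P X (idt C z) (idt C w)"
proof (induction rule: obj_equiv.induct)
  case (orbit p xs \<sigma>)
  have p: "p \<in> Obj (Op P (length xs))" using orbit by (auto simp: terms_cat_def)
  have a: "idt C (p, xs) \<in> Arr C" using orbit C by (auto simp: category_def)
  show ?case using act_fun[OF orbit(2)] p arr_equiv.orbit[of "idt (Op P (length xs)) p" "map (idt X) xs" P X \<sigma>] a orbit(2)
    by (simp add: terms_cat_def is_functor_def map_act_list)
next
  case (refl z) then show ?case by (auto intro: arr_equiv.refl)
next
  case (sym z w) then show ?case by (meson oeq_carrier arr_equiv.sym)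
next
  case (trans z w v)
  then show ?case by (meson oeq_carrier arr_equiv.trans)
qed

lemma Q_simps:
  "z \<in> Arr C \<Longrightarrow> src Q (acls P X z) = ocls P X (src C z)"
  "z \<in> Arr C \<Longrightarrow> trg Q (acls P X z) = ocls P X (trg C z)"
  "x \<in> Obj C \<Longrightarrow> idt Q (ocls P X x) = acls P X (idt C x)"
  using aeq_src[OF equiv_uterm_acls[of P X z]] oeq_idt[OF equiv_uterm_ocls[of P X x]]
  by (auto simp: Tcat_def ocls_eq_iff acls_eq_iff intro: obj_equiv.sym arr_equiv.sym)

lemma Q_cmp0:
  assumes "f \<in> Arr C" "g \<in> Arr C" "trg C f = src C g"
  shows "cmp Q (acls P X g) (acls P X f) = acls P X (cmp C g f)"
proof -
  let ?R = "\<lambda>h. \<exists>g' f'. arr_equiv P X (uterm (acls P X g)) g' \<and> arr_equiv P X (uterm (acls P X f)) f' \<and>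
        g' \<in> Arr C \<and> f' \<in> Arr C \<and> trg C f' = src C g' \<and> h = cmp C g' f'"
  have "?R (cmp C g f)" using assms equiv_uterm_acls arr_equiv.sym by blast
  then have "?R (SOME h. ?R h)" by (rule someI)
  then obtain g' f' where h: "arr_equiv P X (uterm (acls P X g)) g'" "arr_equiv P X (uterm (acls P X f)) f'"
        "g' \<in> Arr C" "f' \<in> Arr C" "trg C f' = src C g'" "(SOME h. ?R h) = cmp C g' f'" by blast
  have "arr_equiv P X g g'" "arr_equiv P X f f'" using h(1,2) equiv_uterm_acls arr_equiv.trans by blast+
  then have "arr_equiv P X (cmp C g f) (SOME h. ?R h)" unfolding h(6)
    by (rule arr_equiv.comp) (use assms h in auto)
  then have "acls P X (SOME h. ?R h) = acls P X (cmp C g f)" using acls_eq_iff arr_equiv.sym by blast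
  then show ?thesis by (simp add: Tcat_def)
qed

lemma Q_lift:
  assumes "F \<in> Arr Q" "G \<in> Arr Q" "trg Q F = src Q G" "F = acls P X f" "f \<in> Arr C"
  obtains g where "G = acls P X g" "g \<in> Arr C" "trg C f = src C g"
proof -
  obtain g where g: "G = acls P X g" "g \<in> Arr C" using assms by (auto simp: Tcat_def)
  have "obj_equiv P X (trg C f) (src C g)" using assms g Q_simps ocls_eq_iff by metis
  then obtain g' where "arr_equiv P X g g'" "src C g' = trg C f" using lift g by blast
  then show thesis using that[of g'] g acls_eq_iff aeq_carrier by metis
qed

theorem Q_category: "category Q"
proof -
  have ArrE: "\<exists>f. F = acls P X f \<and> f \<in> Arr C" if "F \<in> Arr Q" for F using that by (auto simp: Tcat_def)
  have ObjE: "\<exists>f. F = ocls P X f \<and> f \<in> Obj C" if "F \<in> Obj Q" for F using that by (auto simp: Tcat_def)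
  have I: "f \<in> Arr C \<Longrightarrow> acls P X f \<in> Arr Q" "x \<in> Obj C \<Longrightarrow> ocls P X x \<in> Obj Q" for f x by (auto simp: Tcat_def)
  note c = C[unfolded category_def]
  show ?thesis unfolding category_def[of Q]
  proof (intro conjI ballI impI)
    fix F assume F: "F \<in> Arr Q"
    then obtain f where f: "F = acls P X f" "f \<in> Arr C" using ArrE by blast
    show "src Q F \<in> Obj Q" "trg Q F \<in> Obj Q" using c f I by (auto simp: Q_simps)
    show "cmp Q F (idt Q (src Q F)) = F" "cmp Q (idt Q (trg Q F)) F = F"
      using c f I by (auto simp: Q_simps Q_cmp0)
    fix G assume G: "G \<in> Arr Q" "trg Q F = src Q G"
    obtain g where g: "G = acls P X g" "g \<in> Arr C" "trg C f = src C g" using Q_lift[OF F G f] by blast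
    show "cmp Q G F \<in> Arr Q" "src Q (cmp Q G F) = src Q F" "trg Q (cmp Q G F) = trg Q G"
      using c f g I by (auto simp: Q_simps Q_cmp0)
    fix H assume H: "H \<in> Arr Q" "trg Q G = src Q H"
    obtain h where h: "H = acls P X h" "h \<in> Arr C" "trg C g = src C h" using Q_lift[OF G(1) H g(1,2)] by blast
    show "cmp Q H (cmp Q G F) = cmp Q (cmp Q H G) F"
      using c f g h by (simp add: Q_cmp0)
  next
    fix x assume "x \<in> Obj Q"
    then obtain z where "x = ocls P X z" "z \<in> Obj C" using ObjE by blast
    then show "idt Q x \<in> Arr Q" "src Q (idt Q x) = x" "trg Q (idt Q x) = x" using c I by (auto simp: Q_simps)
  qed
qed

text \<open>Surjectivity of the two quotient maps, by definition of \<open>Tcat\<close>, makes \<open>K\<close> unique.\<close>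

theorem Q_coequalizer:
  assumes D: "category D" and H: "is_functor C D H"
    and O: "\<And>p xs \<sigma>. (p, xs) \<in> Obj C \<Longrightarrow> \<sigma> permutes {1..length xs} \<Longrightarrow>
              FO H (FO (act P (length xs) \<sigma>) p, xs) = FO H (p, act_list \<sigma> xs)"
    and A: "\<And>f ys \<sigma>. (f, ys) \<in> Arr C \<Longrightarrow> \<sigma> permutes {1..length ys} \<Longrightarrow>
              FA H (FA (act P (length ys) \<sigma>) f, ys) = FA H (f, act_list \<sigma> ys)"
  shows "\<exists>K. is_functor Q D K \<and> (\<forall>x\<in>Obj C. FO K (ocls P X x) = FO H x) \<and>
             (\<forall>f\<in>Arr C. FA K (acls P X f) = FA H f)"
proof -
  have oe: "obj_equiv P X z w \<Longrightarrow> FO H z = FO H w" for z w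
    by (induction rule: obj_equiv.induct) (auto simp: O)
  have ae: "arr_equiv P X z w \<Longrightarrow> FA H z = FA H w" for z w
  proof (induction rule: arr_equiv.induct)
    case (comp g g' f f')
    then show ?case using H unfolding is_functor_def by metis
  qed (auto simp: A)
  define K where "K = \<lparr>FO = \<lambda>t. FO H (uterm t), FA = \<lambda>t. FA H (uterm t)\<rparr>"
  have k: "FO K (ocls P X x) = FO H x" "FA K (acls P X f) = FA H f" for x f
    using oe[OF equiv_uterm_ocls] ae[OF equiv_uterm_acls] by (auto simp: K_def)
  note c = C[unfolded category_def] and h = H[unfolded is_functor_def]
  have "is_functor Q D K" unfolding is_functor_def
  proof (intro conjI ballI impI)
    fix x assume "x \<in> Obj Q"
    then obtain z where "x = ocls P X z" "z \<in> Obj C" by (auto simp: Tcat_def)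
    then show "FO K x \<in> Obj D" "FA K (idt Q x) = idt D (FO K x)" using h c by (auto simp: k Q_simps)
  next
    fix F assume F: "F \<in> Arr Q"
    then obtain f where f: "F = acls P X f" "f \<in> Arr C" by (auto simp: Tcat_def)
    then show "FA K F \<in> Arr D" "src D (FA K F) = FO K (src Q F)" "trg D (FA K F) = FO K (trg Q F)"
      using h c by (auto simp: k Q_simps)
    fix G assume G: "G \<in> Arr Q" "trg Q F = src Q G"
    obtain g where "G = acls P X g" "g \<in> Arr C" "trg C f = src C g" using Q_lift[OF F G f] by blast
    then show "FA K (cmp Q G F) = cmp D (FA K G) (FA K F)" using f h by (auto simp: k Q_cmp0)
  qed
  then show ?thesis using k by blast
qed

end

end

theory Submission
  imports Defs
begin

text \<open>
  In a contractible operad an arrow is determined by its source and target, so each \<open>\<lambda>\<^bsub>p,q\<^esub>\<close>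
  is forced and every axiom on it reduces to an identity between sources and targets. A permutation of
  \<open>n\<close> letters is determined by its action on a list of \<open>n\<close> distinct entries; the
  permutations \<open>\<delta>\<close>, \<open>\<beta>\<close> and \<open>t\<close> act on concatenated lists by rearranging blocks,
  and each identity between them says that a grid of entries is read off in the same order.

  On the monad, \<open>\<gamma>([p; a\<^sub>1, \<dots>, a\<^sub>n], [q; b\<^sub>1, \<dots>, b\<^sub>m])\<close> is \<open>[\<lambda>\<^bsub>p,q\<^esub>; 1, \<dots>, 1]\<close>
  with identities of the pairs \<open>(a\<^sub>i, b\<^sub>j)\<close> listed in the order of the codomain. Its axioms are the
  operad-level ones, which hold for arity \<open>0\<close> as well.
\<close>

subsection \<open>Permutations acting on lists\<close>

text \<open>The obstacle is the coequalizer. Its arrows are classes under a relation generated by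
  orbits and closed under composition, so a function defined on representatives must be determined
  on a composite by its values on the factors. The strengths and the multiplication depend on other
  arguments too, and with such an argument \<open>a\<close> held fixed they do not preserve
  composition in general. The remedy is to take functions of the other arguments as values and to
  split \<open>a\<close> as \<open>a\<close> after the identity of its source: the later factor
  keeps \<open>a\<close>, the earlier one receives the identity. The components of \<gamma> are
  indexed by objects, where orbits suffice; that they do not depend on representatives is axiom (3).
  With the entries in the order of the codomain, the permutation in the source of \<lambda> can be
  carried over to the entries, where it turns this order into that of the domain.\<close>

text \<open>The definition of \<open>act_list\<close> goes through \<open>inv \<sigma>\<close>; here
  the same list is described by where \<sigma> sends each entry, which is what the formulas for
  \<open>block_sum\<close>, \<open>block_perm\<close> and \<open>transpose_perm\<close> give
  directly. Places are counted from 0 in lists and from 1 in permutations, hence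
  \<open>Suc i\<close> and the subtraction.\<close>

lemma act_list_eqI:
  assumes "\<sigma> permutes {1..length xs}" "length ys = length xs"
    and "\<And>i. i < length xs \<Longrightarrow> ys ! (\<sigma> (Suc i) - 1) = xs ! i"
  shows "act_list \<sigma> xs = ys"
proof (rule nth_equalityI)
  fix i assume "i < length (act_list \<sigma> xs)"
  then have i: "i < length xs" by simp
  define j where "j = inv \<sigma> (Suc i) - 1"
  have "Suc j = inv \<sigma> (Suc i)" "j < length xs" using inv_shift[OF assms(1) i] by (auto simp: j_def)
  moreover then have "\<sigma> (Suc j) = Suc i" using permutes_inverses(1)[OF assms(1)] by simp
  ultimately show "act_list \<sigma> xs ! i = ys ! i" using assms(3)[of j] i by (simp add: nth_act_list j_def)
qed (simp add: assms(2))

lemma nth_act_list_image: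
  assumes "\<sigma> permutes {1..length xs}" "i < length xs"
  shows "act_list \<sigma> xs ! (\<sigma> (Suc i) - 1) = xs ! i" "\<sigma> (Suc i) - 1 < length xs" "0 < \<sigma> (Suc i)"
proof -
  have "\<sigma> (Suc i) \<in> {1..length xs}" using permutes_in_image[OF assms(1)] assms(2) by auto
  then show *: "\<sigma> (Suc i) - 1 < length xs" "0 < \<sigma> (Suc i)" by auto
  then show "act_list \<sigma> xs ! (\<sigma> (Suc i) - 1) = xs ! i"
    using permutes_inverses(2)[OF assms(1)] by (simp add: nth_act_list)
qed

lemma act_list_comp:
  assumes "\<sigma> permutes {1..length xs}" "\<tau> permutes {1..length xs}"
  shows "act_list (\<sigma> \<circ> \<tau>) xs = act_list \<sigma> (act_list \<tau> xs)"
proof (rule act_list_eqI)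
  fix i assume "i < length xs"
  note * = nth_act_list_image[OF assms(2) this]
  show "act_list \<sigma> (act_list \<tau> xs) ! ((\<sigma> \<circ> \<tau>) (Suc i) - 1) = xs ! i"
    using nth_act_list_image(1)[of \<sigma> "act_list \<tau> xs" "\<tau> (Suc i) - 1"] assms * by simp
qed (use assms in \<open>auto intro: permutes_compose\<close>)

lemma act_list_id [simp]: "act_list id xs = xs"
  by (rule act_list_eqI) (auto simp: permutes_id)

lemma act_list_replicate [simp]: "\<sigma> permutes {1..n} \<Longrightarrow> act_list \<sigma> (replicate n x) = replicate n x"
  using nth_act_list_image(2)[of \<sigma> "replicate n x"]
  by (intro act_list_eqI) auto

lemma sum_list_act_list:
  fixes ks :: "nat list"
  assumes "\<sigma> permutes {1..length ks}"
  shows "sum_list (act_list \<sigma> ks) = sum_list ks"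
proof -
  have nth: "sum_list xs = (\<Sum>i\<in>{1..length xs}. xs ! (i - 1))" for xs :: "nat list"
    unfolding sum_list_sum_nth
    by (rule sum.reindex_bij_witness[where i = "\<lambda>i. i - 1" and j = Suc]) auto
  have "sum_list (act_list \<sigma> ks) = (\<Sum>i\<in>{1..length ks}. ks ! (inv \<sigma> i - 1))"
    unfolding nth by (rule sum.cong) (auto simp: nth_act_list)
  also have "\<dots> = sum_list ks"
    using sum.permute[OF permutes_inv[OF assms], of "\<lambda>i. ks ! (i - 1)"] by (simp add: nth o_def)
  finally show ?thesis .
qed

lemma act_list_faithful:
  assumes "\<sigma> permutes {1..length xs}" "\<tau> permutes {1..length xs}" "distinct xs"
    and "act_list \<sigma> xs = act_list \<tau> xs"
  shows "\<sigma> = \<tau>"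
proof
  fix j show "\<sigma> j = \<tau> j"
  proof (cases "j \<in> {1..length xs}")
    case True
    define i where "i = j - 1"
    have i: "i < length xs" "j = Suc i" using True by (auto simp: i_def)
    note s = nth_act_list_image[OF assms(1) i(1)] and t = nth_act_list_image[OF assms(2) i(1)]
    \<comment> \<open>Entry \<open>i\<close> of \<open>xs\<close> stands in \<open>zs\<close> at the
      places given by \<sigma> and by \<tau>; since \<open>zs\<close> has no repetitions, the two
      places agree.\<close>
    define zs where "zs = act_list \<tau> xs"
    have "distinct zs"
      unfolding zs_def by (rule card_distinct) (simp add: set_act_list[OF assms(2)] distinct_card[OF assms(3)])
    moreover have "length zs = length xs" by (simp add: zs_def)
    moreover have "zs ! (\<sigma> (Suc i) - 1) = zs ! (\<tau> (Suc i) - 1)" using s(1) t(1) assms(4) by (simp add: zs_def)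
    ultimately have "\<sigma> (Suc i) - 1 = \<tau> (Suc i) - 1" using s(2) t(2) nth_eq_iff_index_eq by metis
    then show ?thesis using s(3) t(3) i by simp
  next
    case False
    then show ?thesis by (simp add: permutes_not_in[OF assms(1)] permutes_not_in[OF assms(2)])
  qed
qed

text \<open>Bijectivity without a formula for the inverse: \<open>ys\<close> displays at place
  \<open>f j\<close> the entry of \<open>xs\<close> at place \<open>j\<close>, and as
  \<open>xs\<close> has distinct entries, \<open>f j\<close> determines \<open>j\<close>. An
  injective self-map of a finite set is onto.\<close>

lemma permutes_of_lists:
  assumes "distinct xs" "\<And>j. j \<notin> {1..length xs} \<Longrightarrow> f j = j"
    and "\<And>i. i < length xs \<Longrightarrow> f (Suc i) \<in> {1..length xs} \<and> ys ! (f (Suc i) - 1) = xs ! i"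
  shows "f permutes {1..length xs}"
proof (rule bij_imp_permutes)
  have *: "f j \<in> {1..length xs}" "ys ! (f j - 1) = xs ! (j - 1)" if "j \<in> {1..length xs}" for j
    using assms(3)[of "j - 1"] that by auto
  have "inj_on f {1..length xs}"
  proof (rule inj_onI)
    fix j j' assume j: "j \<in> {1..length xs}" "j' \<in> {1..length xs}" "f j = f j'"
    then have "xs ! (j - 1) = xs ! (j' - 1)" using * by metis
    then have "j - 1 = j' - 1" using assms(1) j nth_eq_iff_index_eq[of xs "j - 1" "j' - 1"] by auto
    then show "j = j'" using j by auto
  qed
  moreover have "f ` {1..length xs} \<subseteq> {1..length xs}" using * by blast
  ultimately show "bij_betw f {1..length xs} {1..length xs}"
    by (simp add: bij_betw_def endo_inj_surj)
qed (use assms in auto)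

section \<open>Block sums and block permutations acting on concatenated lists\<close>

text \<open>Realizes a list of block lengths by actual blocks, so that permutations depending only
  on the lengths can be studied through their action on entries.\<close>

lemma ex_concat: "length xs = sum_list ks \<Longrightarrow> \<exists>xss. map length xss = ks \<and> concat xss = xs"
proof (induction ks arbitrary: xs)
  case (Cons k ks)
  obtain xss where "map length xss = ks" "concat xss = drop k xs"
    using Cons.IH[of "drop k xs"] Cons.prems by auto
  then show ?case using Cons.prems by (intro exI[of _ "take k xs # xss"]) auto
qed simp

lemma nth_concat:
  assumes "i < length xss" "r < length (xss ! i)"
  shows "concat xss ! (sum_list (take i (map length xss)) + r) = xss ! i ! r"
    "sum_list (take i (map length xss)) + r < length (concat xss)"
  using assms
proof (induction xss arbitrary: i)
  case (Cons xs xss)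
  { case 1 then show ?case using Cons(1) by (cases i) (auto simp: nth_append add.assoc) }
  { case 2 then show ?case using Cons(2) by (cases i) (auto simp: add.assoc) }
qed auto

lemma sum_list_take_less:
  fixes ks :: "nat list"
  assumes "i < i'" "i' \<le> length ks"
  shows "sum_list (take i ks) + ks ! i \<le> sum_list (take i' ks)"
proof -
  have "sum_list (take (Suc i) ks) \<le> sum_list (take i' ks)"
  proof -
    have "take i' ks = take (Suc i) ks @ take (i' - Suc i) (drop (Suc i) ks)"
      using assms take_add[of "Suc i" "i' - Suc i" ks] by simp
    then show ?thesis by simp
  qed
  then show ?thesis using assms by (simp add: take_Suc_conv_app_nth)
qed

lemma block_eq:
  assumes "i < length ks" "r < ks ! i"
  shows "block ks (Suc (sum_list (take i ks) + r)) = Suc i"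
  unfolding block_def
proof (rule the_equality)
  fix i' assume a: "1 \<le> i' \<and> i' \<le> length ks \<and> offset ks i' < Suc (sum_list (take i ks) + r) \<and>
      Suc (sum_list (take i ks) + r) \<le> offset ks i' + ks ! (i' - 1)"
  then have "i' - 1 < length ks" by linarith
  then show "i' = Suc i"
    using a assms sum_list_take_less[of i "i' - 1" ks] sum_list_take_less[of "i' - 1" i ks]
    by (cases "i' - 1" i rule: linorder_cases) (auto simp: offset_def)
qed (use assms in \<open>auto simp: offset_def\<close>)

text \<open>Coordinates of a position: the number of its block and the place inside it, both counted
  from 0. In these coordinates block sums and block permutations have closed formulas,
  \<open>block_sum_eq\<close> and \<open>block_perm_eq\<close>.\<close>

lemma ex_block:
  fixes ks :: "nat list"
  assumes "j < sum_list ks"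
  obtains i r where "i < length ks" "r < ks ! i" "j = sum_list (take i ks) + r"
  using assms
proof (induction ks arbitrary: j thesis)
  case (Cons k ks)
  show ?case
  proof (cases "j < k")
    case True then show ?thesis using Cons.prems(1)[of 0 j] by simp
  next
    case False
    then have "j - k < sum_list ks" using Cons.prems by auto
    then obtain i r where "i < length ks" "r < ks ! i" "j - k = sum_list (take i ks) + r"
      using Cons.IH by blast
    then show ?thesis using Cons.prems(1)[of "Suc i" r] False by simp
  qed
qed simp

lemma sum_list_take_le:
  fixes ks :: "nat list"
  assumes "i < length ks" "r < ks ! i"
  shows "sum_list (take i ks) + r < sum_list ks"
  using sum_list_take_less[of i "length ks" ks] assms by simp

lemma block_sum_eq:
  assumes "i < length ks" "r < ks ! i"
  shows "block_sum ks \<tau>s (Suc (sum_list (take i ks) + r)) = sum_list (take i ks) + (\<tau>s ! i) (Suc r)"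
  using sum_list_take_le[OF assms] block_eq[OF assms] by (simp add: block_sum_def offset_def Suc_diff_le)

text \<open>One computation in block coordinates serves twice: through
  \<open>permutes_of_lists\<close> it certifies that the block sum is a permutation, and through
  \<open>act_list_eqI\<close> it identifies the action.\<close>

lemma block_sum_image:
  assumes "list_all2 (\<lambda>xs \<tau>. \<tau> permutes {1..length xs}) xss \<tau>s" "j < length (concat xss)"
  shows "block_sum (map length xss) \<tau>s (Suc j) \<in> {1..length (concat xss)}"
    "concat (map2 act_list \<tau>s xss) ! (block_sum (map length xss) \<tau>s (Suc j) - 1) = concat xss ! j"
proof -
  obtain i r where ir: "i < length xss" "r < length (xss ! i)" "j = sum_list (take i (map length xss)) + r"
    using ex_block[of j "map length xss"] assms(2) by (auto simp: length_concat)
  have l: "length \<tau>s = length xss" and p: "(\<tau>s ! i) permutes {1..length (xss ! i)}"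
    using assms(1) ir by (auto simp: list_all2_conv_all_nth)
  note q = nth_act_list_image[OF p ir(2)]
  have m: "map length (map2 act_list \<tau>s xss) = map length xss" using l by (intro nth_equalityI) auto
  have *: "block_sum (map length xss) \<tau>s (Suc j) = Suc (sum_list (take i (map length xss)) + ((\<tau>s ! i) (Suc r) - 1))"
    using block_sum_eq[of i "map length xss" r \<tau>s] ir q(3) by simp
  show "block_sum (map length xss) \<tau>s (Suc j) \<in> {1..length (concat xss)}"
    unfolding * using nth_concat(2)[of i xss "(\<tau>s ! i) (Suc r) - 1"] ir q by auto
  show "concat (map2 act_list \<tau>s xss) ! (block_sum (map length xss) \<tau>s (Suc j) - 1) = concat xss ! j"
    unfolding * using nth_concat(1)[of i "map2 act_list \<tau>s xss" "(\<tau>s ! i) (Suc r) - 1", unfolded m]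
      nth_concat(1)[of i xss r] ir q l by simp
qed

lemma permutes_block_sum:
  assumes "list_all2 (\<lambda>k \<tau>. \<tau> permutes {1..k}) ks \<tau>s"
  shows "block_sum ks \<tau>s permutes {1..sum_list ks}"
proof -
  \<comment> \<open>The blocks are cut out of \<open>[0..<sum_list ks]\<close>, whose entries are
    distinct as \<open>permutes_of_lists\<close> demands.\<close>
  obtain xss where x: "map length xss = ks" "concat xss = [0..<sum_list ks]"
    using ex_concat[of "[0..<sum_list ks]" ks] by auto
  have "list_all2 (\<lambda>xs \<tau>. \<tau> permutes {1..length xs}) xss \<tau>s"
    using assms unfolding x(1)[symmetric] by (simp add: list_all2_map1)
  note * = block_sum_image[OF this]
  have "block_sum ks \<tau>s permutes {1..length (concat xss)}"
  proof (rule permutes_of_lists)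
    fix j assume "j \<notin> {1..length (concat xss)}"
    then show "block_sum ks \<tau>s j = j" by (simp only: block_sum_def x(2) length_upt minus_nat.diff_0 if_False)
  qed (use * in \<open>auto simp only: x(1) distinct_upt x(2)\<close>)
  then show ?thesis by (simp add: x)
qed

lemma act_list_block_sum:
  assumes "list_all2 (\<lambda>xs \<tau>. \<tau> permutes {1..length xs}) xss \<tau>s" "ks = map length xss"
  shows "act_list (block_sum ks \<tau>s) (concat xss) = concat (map2 act_list \<tau>s xss)"
proof (rule act_list_eqI)
  show "block_sum ks \<tau>s permutes {1..length (concat xss)}"
    using permutes_block_sum[of ks \<tau>s] assms by (simp add: list_all2_map1 length_concat)
  have "length \<tau>s = length xss" using assms(1) list_all2_lengthD by force
  then have "map length (map2 act_list \<tau>s xss) = map length xss" by (intro nth_equalityI) auto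
  then show "length (concat (map2 act_list \<tau>s xss)) = length (concat xss)" by (simp add: length_concat)
qed (use block_sum_image[OF assms(1)] assms(2) in auto)

text \<open>The sum in \<open>block_perm\<close> runs over the blocks that are sent in front of
  block \<open>i\<close>. Reindexed along \<sigma>, it is the length of an initial segment of the
  permuted list of lengths, that is, the place where the moved block begins.\<close>

lemma block_perm_eq:
  assumes "i < length ks" "r < ks ! i" "\<sigma> permutes {1..length ks}"
  shows "block_perm ks \<sigma> (Suc (sum_list (take i ks) + r)) =
    Suc (sum_list (take (\<sigma> (Suc i) - 1) (act_list \<sigma> ks)) + r)"
proof -
  let ?I = "{i' \<in> {1..length ks}. \<sigma> i' < \<sigma> (Suc i)}"
  have b: "\<sigma> (Suc i) \<in> {1..length ks}" using permutes_in_image[OF assms(3)] assms(1) by auto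
  have "sum_list (take (\<sigma> (Suc i) - 1) (act_list \<sigma> ks)) = (\<Sum>k\<in>{0..<\<sigma> (Suc i) - 1}. act_list \<sigma> ks ! k)"
    using b by (auto simp: sum_list_sum_nth intro!: sum.cong)
  also have "\<dots> = (\<Sum>i'\<in>?I. ks ! (i' - 1))"
  proof (rule sum.reindex_bij_witness[where i = "\<lambda>i'. \<sigma> i' - 1" and j = "\<lambda>k. inv \<sigma> (Suc k)"])
    fix k assume k: "k \<in> {0..<\<sigma> (Suc i) - 1}"
    then have "inv \<sigma> (Suc k) \<in> {1..length ks}" using k b permutes_in_image[OF permutes_inv[OF assms(3)], of "Suc k"] by auto
    moreover have "\<sigma> (inv \<sigma> (Suc k)) = Suc k" using permutes_inverses(1)[OF assms(3)] by simp
    ultimately show "inv \<sigma> (Suc k) \<in> ?I" "\<sigma> (inv \<sigma> (Suc k)) - 1 = k" using k by auto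
    show "ks ! (inv \<sigma> (Suc k) - 1) = act_list \<sigma> ks ! k" using k b nth_act_list[of k ks \<sigma>] by force
  next
    fix i' assume i: "i' \<in> ?I"
    then have "\<sigma> i' \<in> {1..length ks}" using permutes_in_image[OF assms(3)] by blast
    then show "\<sigma> i' - 1 \<in> {0..<\<sigma> (Suc i) - 1}" "inv \<sigma> (Suc (\<sigma> i' - 1)) = i'"
      using permutes_inverses(2)[OF assms(3)] i by auto
  qed
  finally show ?thesis
    using sum_list_take_le[OF assms(1,2)] block_eq[OF assms(1,2)]
    by (simp add: block_perm_def offset_def Suc_diff_le)
qed

lemma block_perm_image:
  assumes "\<sigma> permutes {1..length xss}" "j < length (concat xss)"
  shows "block_perm (map length xss) \<sigma> (Suc j) \<in> {1..length (concat xss)}"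
    "concat (act_list \<sigma> xss) ! (block_perm (map length xss) \<sigma> (Suc j) - 1) = concat xss ! j"
proof -
  obtain i r where ir: "i < length xss" "r < length (xss ! i)" "j = sum_list (take i (map length xss)) + r"
    using ex_block[of j "map length xss"] assms(2) by (auto simp: length_concat)
  note q = nth_act_list_image[OF assms(1) ir(1)]
  have m: "act_list \<sigma> (map length xss) = map length (act_list \<sigma> xss)" using assms(1) by (simp add: map_act_list)
  have l: "length (concat (act_list \<sigma> xss)) = length (concat xss)"
    using sum_list_act_list[of \<sigma> "map length xss"] assms(1) by (simp add: length_concat m)
  have *: "block_perm (map length xss) \<sigma> (Suc j) =
     Suc (sum_list (take (\<sigma> (Suc i) - 1) (map length (act_list \<sigma> xss))) + r)"
    using block_perm_eq[of i "map length xss" r \<sigma>] assms(1) ir by (simp add: m)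
  have ne: "\<sigma> (Suc i) - 1 < length (act_list \<sigma> xss)" "r < length (act_list \<sigma> xss ! (\<sigma> (Suc i) - 1))"
    using q ir by auto
  show "block_perm (map length xss) \<sigma> (Suc j) \<in> {1..length (concat xss)}"
    unfolding * using nth_concat(2)[OF ne] l by auto
  show "concat (act_list \<sigma> xss) ! (block_perm (map length xss) \<sigma> (Suc j) - 1) = concat xss ! j"
    unfolding * using nth_concat(1)[OF ne] nth_concat(1)[of i xss r] ir q by simp
qed

lemma permutes_block_perm:
  assumes "\<sigma> permutes {1..length ks}"
  shows "block_perm ks \<sigma> permutes {1..sum_list ks}"
proof -
  obtain xss where x: "map length xss = ks" "concat xss = [0..<sum_list ks]"
    using ex_concat[of "[0..<sum_list ks]" ks] by auto
  have "\<sigma> permutes {1..length xss}" using assms unfolding x(1)[symmetric] by simp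
  note * = block_perm_image[OF this]
  have "block_perm ks \<sigma> permutes {1..length (concat xss)}"
  proof (rule permutes_of_lists)
    fix j assume "j \<notin> {1..length (concat xss)}"
    then show "block_perm ks \<sigma> j = j" by (simp only: block_perm_def x(2) length_upt minus_nat.diff_0 if_False)
  qed (use * in \<open>auto simp only: x(1) distinct_upt x(2)\<close>)
  then show ?thesis by (simp add: x)
qed

lemma act_list_block_perm:
  assumes "\<sigma> permutes {1..length xss}" "ks = map length xss"
  shows "act_list (block_perm ks \<sigma>) (concat xss) = concat (act_list \<sigma> xss)"
proof (rule act_list_eqI)
  show "block_perm ks \<sigma> permutes {1..length (concat xss)}"
    using permutes_block_perm[of \<sigma> ks] assms by (simp add: length_concat)
  show "length (concat (act_list \<sigma> xss)) = length (concat xss)"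
    using sum_list_act_list[of \<sigma> ks] assms by (simp add: length_concat map_act_list)
qed (use block_perm_image[OF assms(1)] assms(2) in auto)

section \<open>Grids of entries and the transpose permutation\<close>

text \<open>The array with rows indexed by \<open>xs\<close> and columns by \<open>ys\<close>, read
  row by row. Exchanging the two lists and the arguments of \<open>f\<close> reads the same array
  column by column.\<close>

abbreviation grid :: "('b \<Rightarrow> 'c \<Rightarrow> 'd) \<Rightarrow> 'b list \<Rightarrow> 'c list \<Rightarrow> 'd list" where
  "grid f xs ys \<equiv> concat (map (\<lambda>x. map (f x) ys) xs)"

lemma length_grid [simp]: "length (grid f xs ys) = length xs * length ys"
  by (simp add: length_concat o_def sum_list_triv)

lemma nth_grid:
  assumes "i < length xs" "j < length ys"
  shows "grid f xs ys ! (i * length ys + j) = f (xs ! i) (ys ! j)" "i * length ys + j < length xs * length ys"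
proof -
  have *: "take i (map (\<lambda>_. length ys) xs) = replicate i (length ys)"
    using assms(1) by (simp add: map_replicate_const)
  show "grid f xs ys ! (i * length ys + j) = f (xs ! i) (ys ! j)" "i * length ys + j < length xs * length ys"
    using nth_concat[of i "map (\<lambda>x. map (f x) ys) xs" j] assms
    by (simp_all add: o_def * sum_list_replicate length_concat sum_list_triv)
qed

lemma transpose_perm_image:
  assumes "k < length xs * length ys"
  shows "transpose_perm (length xs) (length ys) (Suc k) \<in> {1..length xs * length ys}"
    "grid (\<lambda>y x. f x y) ys xs ! (transpose_perm (length xs) (length ys) (Suc k) - 1) = grid f xs ys ! k"
proof -
  \<comment> \<open>Row and column of position \<open>k\<close>, counted from 0; in the transposed
    grid the same entry has position \<open>j * length xs + i\<close>.\<close>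
  define i j where ij: "i = k div length ys" "j = k mod length ys"
  have "0 < length ys" using assms by (cases ys) auto
  then have l: "i < length xs" "j < length ys"
    using assms by (simp_all add: ij less_mult_imp_div_less)
  have k: "k = i * length ys + j" by (simp add: ij)
  have t: "transpose_perm (length xs) (length ys) (Suc k) = Suc (j * length xs + i)"
    using assms by (simp add: transpose_perm_def ij)
  show "transpose_perm (length xs) (length ys) (Suc k) \<in> {1..length xs * length ys}"
    unfolding t using nth_grid(2)[OF l(2,1)] by (auto simp: mult.commute)
  show "grid (\<lambda>y x. f x y) ys xs ! (transpose_perm (length xs) (length ys) (Suc k) - 1) = grid f xs ys ! k"
    unfolding t using nth_grid(1)[OF l(2,1), of "\<lambda>y x. f x y"] nth_grid(1)[OF l, of f] k by simp
qed

lemma distinct_grid: "distinct xs \<Longrightarrow> distinct ys \<Longrightarrow> distinct (grid Pair xs ys)"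
  using distinct_product[of xs ys] by (simp add: product_concat_map)

lemma permutes_transpose: "transpose_perm m n permutes {1..m * n}"
proof -
  have "transpose_perm m n permutes {1..length (grid Pair [0..<m] [0..<n])}"
  proof (rule permutes_of_lists[where ys = "grid (\<lambda>y x. (x, y)) [0..<n] [0..<m]"])
    fix i assume "i < length (grid Pair [0..<m] [0..<n])"
    then have "i < length [0..<m] * length [0..<n]" by (simp only: length_grid)
    note * = transpose_perm_image(1)[OF this] transpose_perm_image(2)[OF this, of Pair]
    show "transpose_perm m n (Suc i) \<in> {1..length (grid Pair [0..<m] [0..<n])} \<and>
        grid (\<lambda>y x. (x, y)) [0..<n] [0..<m] ! (transpose_perm m n (Suc i) - 1) = grid Pair [0..<m] [0..<n] ! i"
      using * unfolding length_grid length_upt minus_nat.diff_0 by (rule conjI)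
  next
    fix j assume "j \<notin> {1..length (grid Pair [0..<m] [0..<n])}"
    then have "j \<notin> {1..m * n}" unfolding length_grid by simp
    then show "transpose_perm m n j = j" by (simp only: transpose_perm_def if_False)
  qed (rule distinct_grid; simp)
  then show ?thesis unfolding length_grid by simp
qed

lemma act_list_transpose:
  assumes "m = length xs" "n = length ys"
  shows "act_list (transpose_perm m n) (grid f xs ys) = grid (\<lambda>y x. f x y) ys xs"
proof (rule act_list_eqI)
  show "transpose_perm m n permutes {1..length (grid f xs ys)}"
    unfolding length_grid assms by (rule permutes_transpose)
  fix i assume "i < length (grid f xs ys)"
  then show "grid (\<lambda>y x. f x y) ys xs ! (transpose_perm m n (Suc i) - 1) = grid f xs ys ! i"
    unfolding length_grid assms by (rule transpose_perm_image(2))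
qed (simp only: length_grid mult.commute)

lemma map_grid: "map h (grid f xs ys) = grid (\<lambda>x y. h (f x y)) xs ys"
  by (simp add: map_concat o_def)

lemma concat_map_concat: "concat (map (\<lambda>xs. concat (map g xs)) xss) = concat (map g (concat xss))"
  by (induction xss) auto

lemma concat_grid: "concat (grid f xs ys) = concat (map (\<lambda>x. concat (map (f x) ys)) xs)"
  by (induction xs) auto

lemma map_length_grid:
  "map length (grid f xs ys) = grid (\<lambda>x y. length (f x y)) xs ys"
  by (rule map_grid)

lemma concat_replicate_grid: "length xs = n \<Longrightarrow> concat (replicate n ys) = grid (\<lambda>_ y. y) xs ys"
  by (simp add: map_replicate_const)

lemma map2_replicate1: "length xs = n \<Longrightarrow> map2 f (replicate n c) xs = map (f c) xs"
  by (induction xs arbitrary: n) auto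

lemma permutes_mu_sym:
  assumes "g permutes {1..n}" "h permutes {1..m}"
  shows "mu_sym (replicate n m) g (replicate n h) permutes {1..m * n}"
proof -
  have "block_perm (replicate n m) g permutes {1..sum_list (replicate n m)}"
    using assms by (intro permutes_block_perm) simp
  moreover have "block_sum (replicate n m) (replicate n h) permutes {1..sum_list (replicate n m)}"
    using assms by (intro permutes_block_sum) (simp add: list_all2_conv_all_nth)
  ultimately show ?thesis
    unfolding mu_sym_def by (intro permutes_compose) (simp_all add: sum_list_replicate mult.commute)
qed

text \<open>The block sum permutes the columns within every row by \<open>h\<close>, and the block
  permutation then moves whole rows by \<open>g\<close>.\<close>

lemma act_list_mu_sym:
  assumes "g permutes {1..length xs}" "h permutes {1..length ys}"
  shows "act_list (mu_sym (replicate (length xs) (length ys)) g (replicate (length xs) h)) (grid f xs ys) =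
    grid f (act_list g xs) (act_list h ys)"
proof -
  let ?r = "replicate (length xs) (length ys)"
  have r: "?r = map length (map (\<lambda>x. map (f x) ys) xs)" by (simp add: o_def map_replicate_const)
  have r': "?r = map length (map (\<lambda>x. map (f x) (act_list h ys)) xs)" by (simp add: o_def map_replicate_const)
  have b: "block_perm ?r g permutes {1..length (grid f xs ys)}"
    "block_sum ?r (replicate (length xs) h) permutes {1..length (grid f xs ys)}"
    using permutes_block_perm[of g ?r] permutes_block_sum[of ?r "replicate (length xs) h"] assms
    unfolding length_grid by (simp_all add: sum_list_replicate list_all2_conv_all_nth)
  have "act_list (block_sum ?r (replicate (length xs) h)) (grid f xs ys) = grid f xs (act_list h ys)"
    using assms by (subst act_list_block_sum[OF _ r])
      (simp_all add: list_all2_conv_all_nth map2_replicate1 o_def map_act_list)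
  moreover have "act_list (block_perm ?r g) (grid f xs (act_list h ys)) = grid f (act_list g xs) (act_list h ys)"
    using assms by (subst act_list_block_perm[OF _ r']) (simp_all add: map_act_list)
  ultimately show ?thesis unfolding mu_sym_def by (simp only: act_list_comp[OF b])
qed

text \<open>Transposing a grid twice restores its reading order. This is the source of the symmetry
  of the pseudo-commutativity, see \<open>gam_swap\<close>.\<close>

lemma transpose_perm_comp: "transpose_perm n m \<circ> transpose_perm m n = id"
proof (rule act_list_faithful[where xs = "grid Pair [0..<m] [0..<n]"])
  have p: "transpose_perm n m permutes {1..length (grid Pair [0..<m] [0..<n])}"
     "transpose_perm m n permutes {1..length (grid Pair [0..<m] [0..<n])}"
    using permutes_transpose[of n m] permutes_transpose[of m n] unfolding length_grid by (simp_all add: mult.commute)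
  then show "transpose_perm n m \<circ> transpose_perm m n permutes {1..length (grid Pair [0..<m] [0..<n])}"
    by (intro permutes_compose)
  show "act_list (transpose_perm n m \<circ> transpose_perm m n) (grid Pair [0..<m] [0..<n]) =
    act_list id (grid Pair [0..<m] [0..<n])"
    unfolding act_list_comp[OF p] by (subst act_list_transpose; simp)+
qed (simp_all only: permutes_id distinct_grid distinct_upt)

lemma transpose_perm_one: "transpose_perm 1 n = id" "transpose_perm n 1 = id"
  by (auto simp: transpose_perm_def fun_eq_iff)

text \<open>Axiom (2): on a grid both sides permute rows by \<open>h\<close>, columns by
  \<open>g\<close>, and change the reading direction; it does not matter whether the direction is
  changed first or last.\<close>

lemma mu_sym_transpose:
  assumes g: "g permutes {1..n}" and h: "h permutes {1..m}"
  shows "mu_sym (replicate n m) g (replicate n h) \<circ> transpose_perm m n =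
    transpose_perm m n \<circ> mu_sym (replicate m n) h (replicate m g)"
proof (rule act_list_faithful)
  let ?g = "grid Pair [0..<m] [0..<n]"
  have p: "mu_sym (replicate n m) g (replicate n h) permutes {1..length ?g}"
    "transpose_perm m n permutes {1..length ?g}"
    "mu_sym (replicate m n) h (replicate m g) permutes {1..length ?g}"
    using permutes_transpose[of m n] permutes_mu_sym[OF g h] permutes_mu_sym[OF h g] unfolding length_grid
    by (simp_all add: mult.commute)
  then show "mu_sym (replicate n m) g (replicate n h) \<circ> transpose_perm m n permutes {1..length ?g}"
    "transpose_perm m n \<circ> mu_sym (replicate m n) h (replicate m g) permutes {1..length ?g}"
    by (auto intro: permutes_compose)
  show "act_list (mu_sym (replicate n m) g (replicate n h) \<circ> transpose_perm m n) ?g =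
    act_list (transpose_perm m n \<circ> mu_sym (replicate m n) h (replicate m g)) ?g"
    unfolding act_list_comp[OF p(1,2)] act_list_comp[OF p(2,3)]
    using act_list_mu_sym[of h "[0..<m]" g "[0..<n]" Pair] act_list_mu_sym[of g "[0..<n]" h "[0..<m]" "\<lambda>y x. (x, y)"] g h
    by (simp add: act_list_transpose )
qed (simp only: distinct_grid distinct_upt)

lemma permutes_block_perm_transpose:
  "block_perm (concat (replicate n ms)) (transpose_perm n (length ms)) permutes {1..n * sum_list ms}"
  "block_perm (concat (map (\<lambda>k. replicate l k) ms)) (transpose_perm (length ms) l) permutes {1..sum_list ms * l}"
proof -
  have "length (concat (replicate n ms)) = n * length ms" "sum_list (concat (replicate n ms)) = n * sum_list ms"
    by (induction n) simp_all
  moreover have "length (concat (map (\<lambda>k. replicate l k) ms)) = length ms * l"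
    "sum_list (concat (map (\<lambda>k. replicate l k) ms)) = sum_list ms * l"
    by (induction ms) (simp_all add: sum_list_replicate algebra_simps)
  ultimately show "block_perm (concat (replicate n ms)) (transpose_perm n (length ms)) permutes {1..n * sum_list ms}"
    "block_perm (concat (map (\<lambda>k. replicate l k) ms)) (transpose_perm (length ms) l) permutes {1..sum_list ms * l}"
    using permutes_block_perm[of "transpose_perm n (length ms)" "concat (replicate n ms)"]
    permutes_block_perm[of "transpose_perm (length ms) l" "concat (map (\<lambda>k. replicate l k) ms)"] permutes_transpose
    by simp_all
qed

lemma permutes_block_sum_transpose:
  "block_sum (map (\<lambda>k. n * k) ms) (map (\<lambda>k. transpose_perm n k) ms) permutes {1..n * sum_list ms}"
  "block_sum (map (\<lambda>k. k * l) ms) (map (\<lambda>k. transpose_perm k l) ms) permutes {1..sum_list ms * l}"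
  using permutes_block_sum[of "map (\<lambda>k. n * k) ms" "map (\<lambda>k. transpose_perm n k) ms"]
    permutes_block_sum[of "map (\<lambda>k. k * l) ms" "map (\<lambda>k. transpose_perm k l) ms"] permutes_transpose
  by (simp_all add: list_all2_conv_all_nth sum_list_const_mult sum_list_mult_const)

text \<open>The columns come in groups \<open>yss\<close>, so each row is cut into segments
  \<open>map (f x) ys\<close>. These segments form a smaller grid, and \<delta> transposes that grid
  while moving every segment as a unit. Afterwards the groups follow each other, each still read row
  by row.\<close>

lemma act_list_block_perm_transpose:
  assumes "n = length xs" "ms = map length yss"
  shows "act_list (block_perm (concat (replicate n ms)) (transpose_perm n (length ms))) (grid f xs (concat yss)) =
      concat (map (\<lambda>ys. grid f xs ys) yss)"
proof -
  have l: "concat (replicate n ms) = map length (grid (\<lambda>x ys. map (f x) ys) xs yss)"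
    unfolding map_length_grid using assms by (simp add: concat_replicate_grid[of xs] o_def)
  have "grid f xs (concat yss) = concat (grid (\<lambda>x ys. map (f x) ys) xs yss)"
    unfolding concat_grid by (simp add: map_concat)
  also have "act_list (block_perm (concat (replicate n ms)) (transpose_perm n (length ms))) \<dots> =
      concat (act_list (transpose_perm n (length ms)) (grid (\<lambda>x ys. map (f x) ys) xs yss))"
    using permutes_transpose[of n "length ms"] assms
    by (intro act_list_block_perm[OF _ l]) (simp only: length_grid length_map)
  also have "\<dots> = concat (grid (\<lambda>ys x. map (f x) ys) yss xs)"
    by (subst act_list_transpose) (simp_all add: assms)
  finally show ?thesis unfolding concat_grid .
qed

text \<open>The block sum transposes every group on its own. A grid whose rows are indexed by
  \<open>concat yss\<close> is the concatenation of the grids of the groups; the first claim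
  assembles such a grid after the transpositions, the second takes one apart before them.\<close>

lemma act_list_block_sum_transpose:
  assumes "n = length xs" "ms = map length yss"
  shows "act_list (block_sum (map (\<lambda>k. n * k) ms) (map (\<lambda>k. transpose_perm n k) ms))
      (concat (map (\<lambda>ys. grid f xs ys) yss)) = grid (\<lambda>y x. f x y) (concat yss) xs"
    "act_list (block_sum (map (\<lambda>k. k * n) ms) (map (\<lambda>k. transpose_perm k n) ms))
      (grid g (concat yss) xs) = concat (map (\<lambda>ys. grid (\<lambda>x y. g y x) xs ys) yss)"
proof -
  have z: "map2 act_list (map \<tau> yss) (map h yss) = map (\<lambda>ys. act_list (\<tau> ys) (h ys)) yss"
    for \<tau> and h :: "'b list \<Rightarrow> 'z list" by (induction yss) auto
  have "act_list (block_sum (map (\<lambda>k. n * k) ms) (map (\<lambda>k. transpose_perm n k) ms))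
      (concat (map (\<lambda>ys. grid f xs ys) yss)) =
    concat (map2 act_list (map (\<lambda>ys. transpose_perm n (length ys)) yss) (map (\<lambda>ys. grid f xs ys) yss))"
    using permutes_transpose[of n]
    by (subst act_list_block_sum) (simp_all add: assms list_all2_conv_all_nth length_concat o_def sum_list_triv)
  also have "\<dots> = concat (map (\<lambda>ys. grid (\<lambda>y x. f x y) ys xs) yss)"
    unfolding z by (simp add: act_list_transpose assms)
  finally show "act_list (block_sum (map (\<lambda>k. n * k) ms) (map (\<lambda>k. transpose_perm n k) ms))
      (concat (map (\<lambda>ys. grid f xs ys) yss)) = grid (\<lambda>y x. f x y) (concat yss) xs"
    unfolding concat_map_concat .
  have "act_list (block_sum (map (\<lambda>k. k * n) ms) (map (\<lambda>k. transpose_perm k n) ms))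
      (concat (map (\<lambda>ys. grid g ys xs) yss)) =
    concat (map2 act_list (map (\<lambda>ys. transpose_perm (length ys) n) yss) (map (\<lambda>ys. grid g ys xs) yss))"
    using permutes_transpose[of _ n]
    by (subst act_list_block_sum) (simp_all add: assms list_all2_conv_all_nth length_concat o_def sum_list_triv)
  also have "\<dots> = concat (map (\<lambda>ys. grid (\<lambda>x y. g y x) xs ys) yss)"
    unfolding z by (simp add: act_list_transpose assms)
  finally show "act_list (block_sum (map (\<lambda>k. k * n) ms) (map (\<lambda>k. transpose_perm k n) ms))
      (grid g (concat yss) xs) = concat (map (\<lambda>ys. grid (\<lambda>x y. g y x) xs ys) yss)"
    unfolding concat_map_concat .
qed

text \<open>The move opposite to \<open>act_list_block_perm_transpose\<close>: segments stored group
  by group are collected row by row. The subscript lists the lengths of the segments in the order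
  before the move, hence each length is repeated \<open>l\<close> times in succession.\<close>

lemma act_list_block_perm_transpose':
  assumes "l = length xs" "ms = map length yss"
  shows "act_list (block_perm (concat (map (\<lambda>k. replicate l k) ms)) (transpose_perm (length ms) l))
      (concat (map (\<lambda>ys. grid f xs ys) yss)) = grid f xs (concat yss)"
proof -
  have l: "concat (map (\<lambda>k. replicate l k) ms) = map length (grid (\<lambda>ys x. map (f x) ys) yss xs)"
    unfolding map_length_grid using assms by (simp add: map_replicate_const o_def)
  have "act_list (block_perm (concat (map (\<lambda>k. replicate l k) ms)) (transpose_perm (length ms) l))
     (concat (grid (\<lambda>ys x. map (f x) ys) yss xs)) =
      concat (act_list (transpose_perm (length ms) l) (grid (\<lambda>ys x. map (f x) ys) yss xs))"
    using permutes_transpose[of "length ms" l] assms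
    by (intro act_list_block_perm[OF _ l]) (simp only: length_grid length_map)
  also have "\<dots> = concat (grid (\<lambda>x ys. map (f x) ys) xs yss)"
    by (subst act_list_transpose) (simp_all add: assms)
  finally show ?thesis unfolding concat_grid by (simp add: map_concat o_def)
qed

text \<open>Axiom (4): \<delta> acts first and gathers the groups of columns, then each group is
  transposed; altogether the grid is read column by column.\<close>

lemma transpose_perm_sum:
  "block_sum (map (\<lambda>k. n * k) ms) (map (\<lambda>k. transpose_perm n k) ms) \<circ>
     block_perm (concat (replicate n ms)) (transpose_perm n (length ms)) = transpose_perm n (sum_list ms)"
    (is "?b \<circ> ?p = ?t")
proof -
  obtain yss where y: "map length yss = ms" "concat yss = [0..<sum_list ms]"
    using ex_concat[of "[0..<sum_list ms]" ms] by auto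
  let ?g = "grid Pair [0..<n] (concat yss)"
  have l: "length ?g = n * sum_list ms" unfolding length_grid y by simp
  have p: "?b permutes {1..length ?g}" "?p permutes {1..length ?g}" "?t permutes {1..length ?g}"
    unfolding l by (rule permutes_block_sum_transpose permutes_block_perm_transpose permutes_transpose)+
  show ?thesis
  proof (rule act_list_faithful[OF permutes_compose[OF p(2,1)] p(3)])
    show "distinct ?g" by (simp only: distinct_grid y distinct_upt)
    have "act_list ?t ?g = grid (\<lambda>y x. (x, y)) (concat yss) [0..<n]"
      by (rule act_list_transpose) (simp_all add: y)
    moreover have "act_list ?b (act_list ?p ?g) = grid (\<lambda>y x. (x, y)) (concat yss) [0..<n]"
      by (subst act_list_block_perm_transpose act_list_block_sum_transpose; simp add: y)+
    ultimately show "act_list (?b \<circ> ?p) ?g = act_list ?t ?g"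
      unfolding act_list_comp[OF p(1,2)] by (simp only:)
  qed
qed

text \<open>Axiom (5): here the rows are grouped. Each group is transposed first, and \<delta> then
  joins the pieces of every column.\<close>

lemma transpose_perm_sum':
  "block_perm (concat (map (\<lambda>k. replicate l k) ns)) (transpose_perm (length ns) l) \<circ>
     block_sum (map (\<lambda>k. k * l) ns) (map (\<lambda>k. transpose_perm k l) ns) = transpose_perm (sum_list ns) l"
    (is "?p \<circ> ?b = ?t")
proof -
  obtain yss where y: "map length yss = ns" "concat yss = [0..<sum_list ns]"
    using ex_concat[of "[0..<sum_list ns]" ns] by auto
  let ?g = "grid Pair (concat yss) [0..<l]"
  have l: "length ?g = sum_list ns * l" unfolding length_grid y by simp
  have p: "?p permutes {1..length ?g}" "?b permutes {1..length ?g}" "?t permutes {1..length ?g}"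
    unfolding l by (rule permutes_block_sum_transpose permutes_block_perm_transpose permutes_transpose)+
  show ?thesis
  proof (rule act_list_faithful[OF permutes_compose[OF p(2,1)] p(3)])
    show "distinct ?g" by (simp only: distinct_grid y distinct_upt)
    have "act_list ?t ?g = grid (\<lambda>y x. (x, y)) [0..<l] (concat yss)"
      by (rule act_list_transpose) (simp_all add: y)
    moreover have "act_list ?p (act_list ?b ?g) = grid (\<lambda>y x. (x, y)) [0..<l] (concat yss)"
      by (subst act_list_block_perm_transpose' act_list_block_sum_transpose; simp add: y)+
    ultimately show "act_list (?p \<circ> ?b) ?g = act_list ?t ?g"
      unfolding act_list_comp[OF p(1,2)] by (simp only:)
  qed
qed

text \<open>The case of a grid whose entries ignore one coordinate. Outer equivariance of the operad
  also permutes the lists of arities and of inner operations, and in axioms (6) and (7) these lists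
  have this shape.\<close>

lemma act_list_transpose_replicate:
  assumes "l = length xs"
  shows "act_list (transpose_perm n l) (concat (replicate n xs)) = concat (map (\<lambda>x. replicate n x) xs)"
    "act_list (transpose_perm l n) (concat (map (\<lambda>x. replicate n x) xs)) = concat (replicate n xs)"
  using act_list_transpose[of n "[0..<n]" l xs "\<lambda>_ x. x"] act_list_transpose[of l xs n "[0..<n]" "\<lambda>x _. x"] assms
  by (simp_all add: map_replicate_const)

lemma concat_map_replicate_const: "concat (map (\<lambda>k. replicate k x) ks) = replicate (sum_list ks) x"
  by (induction ks) (simp_all add: replicate_add)

subsection \<open>The pseudo-commutative structure of a contractible operad\<close>

text \<open>Keeps \<open>{1..n}\<close> in the shape in which \<open>permutes\<close> facts are stated.\<close>

declare One_nat_def [simp del]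

section \<open>The operad axioms on objects and arrows\<close>

locale operad_in_Cat =
  fixes P :: "('o, 'a) operad"
  assumes P: "symmetric_operad P"
begin

abbreviation "obj n \<equiv> Obj (Op P n)"
abbreviation "arr n \<equiv> Arr (Op P n)"
abbreviation "ao n \<sigma> \<equiv> FO (act P n \<sigma>)"
abbreviation "aa n \<sigma> \<equiv> FA (act P n \<sigma>)"
abbreviation "mo ks p qs \<equiv> FO (mu P ks) (p, qs)"
abbreviation "ma ks f gs \<equiv> FA (mu P ks) (f, gs)"
abbreviation "objs \<equiv> list_all2 (\<lambda>k q. q \<in> obj k)"
abbreviation "arrs \<equiv> list_all2 (\<lambda>k q. q \<in> arr k)"

text \<open>Arity, source and target are recorded together, so that an equation between arrows can
  be settled by typing both of its sides.\<close>

definition hom :: "nat \<Rightarrow> 'o \<Rightarrow> 'o \<Rightarrow> 'a set" where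
  "hom n p q = {f \<in> arr n. src (Op P n) f = p \<and> trg (Op P n) f = q}"

lemma cat: "category (Op P n)"
  using P by (simp add: symmetric_operad_def)

lemma act_functor: "\<sigma> permutes {1..n} \<Longrightarrow> is_functor (Op P n) (Op P n) (act P n \<sigma>)"
  using P by (simp add: symmetric_operad_def)

lemma mu_functor: "is_functor (prod_cat (Op P (length ks)) (list_prod_cat (map (Op P) ks)))
                   (Op P (sum_list ks)) (mu P ks)"
  using P by (simp add: symmetric_operad_def)

lemma unit_obj [simp]: "unit P \<in> obj 1" "unit P \<in> obj (Suc 0)"
  using P by (simp_all add: symmetric_operad_def One_nat_def)

lemma act_obj [simp]: "\<sigma> permutes {1..n} \<Longrightarrow> p \<in> obj n \<Longrightarrow> ao n \<sigma> p \<in> obj n"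
  using act_functor by (auto simp: is_functor_def)

lemma mu_obj:
  assumes "p \<in> obj (length ks)" "objs ks qs"
  shows "mo ks p qs \<in> obj (sum_list ks)"
  using mu_functor[of ks] assms
  by (simp add: is_functor_def prod_cat_def list_prod_cat_def list_all2_map1)

lemma mu_arr:
  assumes "f \<in> arr (length ks)" "arrs ks gs"
  shows "ma ks f gs \<in> arr (sum_list ks)"
    "src (Op P (sum_list ks)) (ma ks f gs) = mo ks (src (Op P (length ks)) f) (map2 (\<lambda>k. src (Op P k)) ks gs)"
    "trg (Op P (sum_list ks)) (ma ks f gs) = mo ks (trg (Op P (length ks)) f) (map2 (\<lambda>k. trg (Op P k)) ks gs)"
  using mu_functor[of ks] assms
  by (auto simp: is_functor_def prod_cat_def list_prod_cat_def list_all2_map1 zip_map1 o_def case_prod_unfold)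

lemma mu_idt:
  assumes "p \<in> obj (length ks)" "objs ks qs"
  shows "ma ks (idt (Op P (length ks)) p) (map2 (\<lambda>k. idt (Op P k)) ks qs) = idt (Op P (sum_list ks)) (mo ks p qs)"
  using mu_functor[of ks] assms
  by (auto simp: is_functor_def prod_cat_def list_prod_cat_def list_all2_map1 zip_map1 o_def case_prod_unfold)

lemma mu_cmp:
  assumes "f \<in> arr (length ks)" "arrs ks gs" "f' \<in> arr (length ks)" "arrs ks gs'"
    and "trg (Op P (length ks)) f = src (Op P (length ks)) f'"
    and "map2 (\<lambda>k. trg (Op P k)) ks gs = map2 (\<lambda>k. src (Op P k)) ks gs'"
  shows "ma ks (cmp (Op P (length ks)) f' f) (map2 (\<lambda>k (g', g). cmp (Op P k) g' g) ks (zip gs' gs)) =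
    cmp (Op P (sum_list ks)) (ma ks f' gs') (ma ks f gs)"
proof -
  let ?D = "prod_cat (Op P (length ks)) (list_prod_cat (map (Op P) ks))"
  have "(f, gs) \<in> Arr ?D" "(f', gs') \<in> Arr ?D" "trg ?D (f, gs) = src ?D (f', gs')"
    using assms by (auto simp: prod_cat_def list_prod_cat_def list_all2_map1 zip_map1 o_def case_prod_unfold)
  then have "FA (mu P ks) (cmp ?D (f', gs') (f, gs)) = cmp (Op P (sum_list ks)) (ma ks f' gs') (ma ks f gs)"
    using mu_functor[of ks] by (simp add: is_functor_def)
  then show ?thesis
    by (simp add: prod_cat_def list_prod_cat_def zip_map1 o_def case_prod_unfold)
qed

lemma equations:
  "operad_equations obj ao (unit P) (\<lambda>ks. FO (mu P ks))"
  "operad_equations arr aa (idt (Op P 1) (unit P)) (\<lambda>ks. FA (mu P ks))"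
  using P by (simp_all add: symmetric_operad_def)

lemmas obj_equations = equations(1)[unfolded operad_equations_def]
lemmas arr_equations = equations(2)[unfolded operad_equations_def]

lemma act_id: "p \<in> obj n \<Longrightarrow> ao n id p = p" "f \<in> arr n \<Longrightarrow> aa n id f = f"
  using obj_equations[THEN conjunct1] arr_equations[THEN conjunct1] by simp_all

lemma act_act:
  assumes "\<sigma> permutes {1..n}" "\<tau> permutes {1..n}"
  shows "p \<in> obj n \<Longrightarrow> ao n \<tau> (ao n \<sigma> p) = ao n (\<sigma> \<circ> \<tau>) p"
    "f \<in> arr n \<Longrightarrow> aa n \<tau> (aa n \<sigma> f) = aa n (\<sigma> \<circ> \<tau>) f"
  using obj_equations[THEN conjunct2, THEN conjunct1, rule_format, OF _ assms]
    arr_equations[THEN conjunct2, THEN conjunct1, rule_format, OF _ assms] by simp_all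

lemma mu_unit:
  "q \<in> obj k \<Longrightarrow> mo [k] (unit P) [q] = q"
  "p \<in> obj n \<Longrightarrow> mo (replicate n 1) p (replicate n (unit P)) = p"
  using obj_equations[THEN conjunct2, THEN conjunct2, THEN conjunct1]
    obj_equations[THEN conjunct2, THEN conjunct2, THEN conjunct2, THEN conjunct1] by simp_all

lemma mu_assoc:
  assumes "p \<in> obj (length kss)" "list_all2 (\<lambda>ks q. q \<in> obj (length ks)) kss qs" "list_all2 objs kss rss"
  shows "mo (concat kss) (mo (map length kss) p qs) (concat rss) =
        mo (map sum_list kss) p (map2 (\<lambda>ks (q, rs). mo ks q rs) kss (zip qs rss))"
  using obj_equations[THEN conjunct2, THEN conjunct2, THEN conjunct2, THEN conjunct2, THEN conjunct1, rule_format, OF assms] .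

lemma mu_act_inner:
  assumes "list_all2 (\<lambda>k \<tau>. \<tau> permutes {1..k}) ks \<tau>s"
  shows "p \<in> obj (length ks) \<Longrightarrow> objs ks qs \<Longrightarrow>
     mo ks p (map2 (\<lambda>k (\<tau>, q). ao k \<tau> q) ks (zip \<tau>s qs)) = ao (sum_list ks) (block_sum ks \<tau>s) (mo ks p qs)"
   "f \<in> arr (length ks) \<Longrightarrow> arrs ks gs \<Longrightarrow>
     ma ks f (map2 (\<lambda>k (\<tau>, q). aa k \<tau> q) ks (zip \<tau>s gs)) = aa (sum_list ks) (block_sum ks \<tau>s) (ma ks f gs)"
  using obj_equations[THEN conjunct2, THEN conjunct2, THEN conjunct2, THEN conjunct2, THEN conjunct2, THEN conjunct1, rule_format, OF _ _ assms]
    arr_equations[THEN conjunct2, THEN conjunct2, THEN conjunct2, THEN conjunct2, THEN conjunct2, THEN conjunct1, rule_format, OF _ _ assms] by simp_all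

lemma mu_act_outer:
  assumes "\<sigma> permutes {1..length ks}"
  shows "p \<in> obj (length ks) \<Longrightarrow> objs ks qs \<Longrightarrow>
     mo ks (ao (length ks) \<sigma> p) qs =
     ao (sum_list ks) (block_perm ks \<sigma>) (mo (act_list \<sigma> ks) p (act_list \<sigma> qs))"
   "f \<in> arr (length ks) \<Longrightarrow> arrs ks gs \<Longrightarrow>
     ma ks (aa (length ks) \<sigma> f) gs =
     aa (sum_list ks) (block_perm ks \<sigma>) (ma (act_list \<sigma> ks) f (act_list \<sigma> gs))"
  using obj_equations[THEN conjunct2, THEN conjunct2, THEN conjunct2, THEN conjunct2, THEN conjunct2, THEN conjunct2, rule_format, OF _ _ assms]
    arr_equations[THEN conjunct2, THEN conjunct2, THEN conjunct2, THEN conjunct2, THEN conjunct2, THEN conjunct2, rule_format, OF _ _ assms] by simp_all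

lemma hom_obj: "f \<in> hom n p q \<Longrightarrow> p \<in> obj n \<and> q \<in> obj n"
  using cat[of n] by (auto simp: category_def hom_def)

lemma hom_arr: "f \<in> hom n p q \<Longrightarrow> f \<in> arr n"
  by (simp add: hom_def)

lemma hom_idt: "p \<in> obj n \<Longrightarrow> idt (Op P n) p \<in> hom n p p"
  using cat[of n] by (auto simp: category_def hom_def)

lemma hom_cmp: "f \<in> hom n p q \<Longrightarrow> g \<in> hom n q r \<Longrightarrow> cmp (Op P n) g f \<in> hom n p r"
  using cat[of n] by (simp add: category_def hom_def)

lemma hom_assoc:
  assumes "f \<in> hom n p q" "g \<in> hom n q r" "h \<in> hom n r s"
  shows "cmp (Op P n) h (cmp (Op P n) g f) = cmp (Op P n) (cmp (Op P n) h g) f"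
proof -
  have "f \<in> arr n" "g \<in> arr n" "h \<in> arr n" "trg (Op P n) f = src (Op P n) g" "trg (Op P n) g = src (Op P n) h"
    using assms by (auto simp: hom_def)
  then show ?thesis using cat[of n] unfolding category_def by simp
qed

lemma hom_idt_left: "f \<in> hom n p q \<Longrightarrow> cmp (Op P n) (idt (Op P n) q) f = f"
  using cat[of n] by (auto simp: category_def hom_def)

lemma hom_act: "\<sigma> permutes {1..n} \<Longrightarrow> f \<in> hom n p q \<Longrightarrow> aa n \<sigma> f \<in> hom n (ao n \<sigma> p) (ao n \<sigma> q)"
  using act_functor[of \<sigma> n] by (auto simp: is_functor_def hom_def)

lemma hom_mu:
  assumes "f \<in> hom (length ks) p p'" "length gs = length ks" "length qs = length ks" "length qs' = length ks"
    and "\<And>i. i < length ks \<Longrightarrow> gs ! i \<in> hom (ks ! i) (qs ! i) (qs' ! i)"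
  shows "ma ks f gs \<in> hom (sum_list ks) (mo ks p qs) (mo ks p' qs')"
proof -
  have "arrs ks gs" "map2 (\<lambda>k. src (Op P k)) ks gs = qs" "map2 (\<lambda>k. trg (Op P k)) ks gs = qs'"
    using assms by (auto simp: list_all2_conv_all_nth hom_def intro!: nth_equalityI)
  then show ?thesis using mu_arr[of f ks gs] assms(1) by (simp add: hom_def)
qed

section \<open>Sources and targets of the structure isomorphisms\<close>

definition lam_src :: "nat \<Rightarrow> nat \<Rightarrow> 'o \<Rightarrow> 'o \<Rightarrow> 'o" where
  "lam_src n m p q = ao (m * n) (transpose_perm m n) (mo (replicate n m) p (replicate n q))"

definition lam_trg :: "nat \<Rightarrow> nat \<Rightarrow> 'o \<Rightarrow> 'o \<Rightarrow> 'o" where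
  "lam_trg n m p q = mo (replicate m n) q (replicate m p)"

lemma mu_replicate_obj: "p \<in> obj n \<Longrightarrow> q \<in> obj m \<Longrightarrow> mo (replicate n m) p (replicate n q) \<in> obj (m * n)"
  using mu_obj[of p "replicate n m" "replicate n q"]
  by (simp add: list_all2_conv_all_nth sum_list_replicate mult.commute)

lemma lam_src_obj: "p \<in> obj n \<Longrightarrow> q \<in> obj m \<Longrightarrow> lam_src n m p q \<in> obj (m * n)"
  by (simp add: lam_src_def mu_replicate_obj permutes_transpose)

lemma lam_trg_obj: "p \<in> obj n \<Longrightarrow> q \<in> obj m \<Longrightarrow> lam_trg n m p q \<in> obj (m * n)"
  using mu_replicate_obj[of q m p n] by (simp add: lam_trg_def mult.commute)

text \<open>Inner equivariance contributes the block sum, outer equivariance the block permutation.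
  The inputs form a constant list, which the permutation of inputs leaves alone, so the two
  contributions compose to \<open>mu_sym\<close>.\<close>

lemma mu_replicate_act:
  assumes "p \<in> obj n" "q \<in> obj m" "g permutes {1..n}" "h permutes {1..m}"
  shows "mo (replicate n m) (ao n g p) (replicate n (ao m h q)) =
    ao (m * n) (mu_sym (replicate n m) g (replicate n h)) (mo (replicate n m) p (replicate n q))"
proof -
  have s: "sum_list (replicate n m) = m * n" by (simp add: sum_list_replicate)
  have o: "objs (replicate n m) (replicate n q)" using assms(2) by (simp add: list_all2_conv_all_nth)
  have h: "list_all2 (\<lambda>k \<tau>. \<tau> permutes {1..k}) (replicate n m) (replicate n h)"
    using assms(4) by (simp add: list_all2_conv_all_nth)
  have p: "block_sum (replicate n m) (replicate n h) permutes {1..m * n}"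
    "block_perm (replicate n m) g permutes {1..m * n}"
    using permutes_block_sum[OF h] permutes_block_perm[of g "replicate n m"] assms(3) unfolding s by simp_all
  have "mo (replicate n m) (ao n g p) (replicate n (ao m h q)) =
    ao (m * n) (block_sum (replicate n m) (replicate n h)) (mo (replicate n m) (ao n g p) (replicate n q))"
    using mu_act_inner(1)[OF h _ o, of "ao n g p"] assms by (simp add: s)
  also have "mo (replicate n m) (ao n g p) (replicate n q) =
    ao (m * n) (block_perm (replicate n m) g) (mo (replicate n m) p (replicate n q))"
    using mu_act_outer(1)[of g "replicate n m" p "replicate n q"] assms o by (simp add: s)
  finally show ?thesis using act_act(1)[OF p(2,1)] mu_replicate_obj[OF assms(1,2)] by (simp add: mu_sym_def)
qed

text \<open>For a right action, acting by the transposition and then by \<open>mu_sym\<close> is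
  acting by their composite; axiom (2) exchanges it for the composite that acts by the transposition
  last, and \<open>mu_replicate_act\<close> absorbs the other factor.\<close>

lemma lam_src_act:
  assumes "p \<in> obj n" "q \<in> obj m" "g permutes {1..n}" "h permutes {1..m}"
  shows "ao (m * n) (mu_sym (replicate m n) h (replicate m g)) (lam_src n m p q) = lam_src n m (ao n g p) (ao m h q)"
proof -
  have "mu_sym (replicate m n) h (replicate m g) permutes {1..m * n}"
    using permutes_mu_sym[OF assms(4,3)] by (simp add: mult.commute)
  then show ?thesis
    unfolding lam_src_def mu_replicate_act[OF assms]
    using permutes_mu_sym[OF assms(3,4)] mu_replicate_obj[OF assms(1,2)]
    by (simp add: act_act permutes_transpose mu_sym_transpose[OF assms(3,4)])
qed

lemma lam_trg_act:
  assumes "p \<in> obj n" "q \<in> obj m" "g permutes {1..n}" "h permutes {1..m}"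
  shows "ao (m * n) (mu_sym (replicate m n) h (replicate m g)) (lam_trg n m p q) = lam_trg n m (ao n g p) (ao m h q)"
  unfolding lam_trg_def mu_replicate_act[OF assms(2,1,4,3)] by (simp add: mult.commute)

text \<open>Three instances of associativity of \<open>mu\<close>: constant innermost operations,
  constant middle operations, and identical copies of one composite. They are the identifications
  that axioms (6) and (7) leave implicit. In (6) they treat source, intermediate object and target
  in this order, in (7) in the reverse order.\<close>

lemma mu_mu_replicate:
  assumes "p \<in> obj (length ms)" "objs ms qs" "r \<in> obj n"
  shows "mo (replicate (sum_list ms) n) (mo ms p qs) (replicate (sum_list ms) r) =
      mo (map (\<lambda>k. k * n) ms) p (map2 (\<lambda>k q. mo (replicate k n) q (replicate k r)) ms qs)"
    and "mo (map (\<lambda>k. n * k) ms) p (map2 (\<lambda>k q. mo (replicate n k) r (replicate n q)) ms qs) =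
      mo (concat (map (\<lambda>k. replicate n k) ms)) (mo (replicate (length ms) n) p (replicate (length ms) r))
        (concat (map (\<lambda>q. replicate n q) qs))"
    and "mo (replicate n (sum_list ms)) r (replicate n (mo ms p qs)) =
      mo (concat (replicate n ms)) (mo (replicate n (length ms)) r (replicate n p)) (concat (replicate n qs))"
proof -
  have l: "length qs = length ms" using assms(2) list_all2_lengthD by force
  show "mo (replicate (sum_list ms) n) (mo ms p qs) (replicate (sum_list ms) r) =
      mo (map (\<lambda>k. k * n) ms) p (map2 (\<lambda>k q. mo (replicate k n) q (replicate k r)) ms qs)"
  proof -
    have "mo (concat (map (\<lambda>k. replicate k n) ms)) (mo (map length (map (\<lambda>k. replicate k n) ms)) p qs)
        (concat (map (\<lambda>k. replicate k r) ms)) =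
      mo (map sum_list (map (\<lambda>k. replicate k n) ms)) p
        (map2 (\<lambda>ks (q, rs). mo ks q rs) (map (\<lambda>k. replicate k n) ms) (zip qs (map (\<lambda>k. replicate k r) ms)))"
      by (rule mu_assoc) (use assms l in \<open>simp_all add: list_all2_conv_all_nth\<close>)
    also have "map2 (\<lambda>ks (q, rs). mo ks q rs) (map (\<lambda>k. replicate k n) ms) (zip qs (map (\<lambda>k. replicate k r) ms)) =
        map2 (\<lambda>k q. mo (replicate k n) q (replicate k r)) ms qs"
      using l by (intro nth_equalityI) simp_all
    finally show ?thesis by (simp add: concat_map_replicate_const o_def sum_list_replicate)
  qed
  show "mo (map (\<lambda>k. n * k) ms) p (map2 (\<lambda>k q. mo (replicate n k) r (replicate n q)) ms qs) =
      mo (concat (map (\<lambda>k. replicate n k) ms)) (mo (replicate (length ms) n) p (replicate (length ms) r))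
        (concat (map (\<lambda>q. replicate n q) qs))"
  proof -
    have "mo (concat (map (\<lambda>k. replicate n k) ms)) (mo (map length (map (\<lambda>k. replicate n k) ms)) p (replicate (length ms) r))
        (concat (map (\<lambda>q. replicate n q) qs)) =
      mo (map sum_list (map (\<lambda>k. replicate n k) ms)) p
        (map2 (\<lambda>ks (q, rs). mo ks q rs) (map (\<lambda>k. replicate n k) ms)
          (zip (replicate (length ms) r) (map (\<lambda>q. replicate n q) qs)))"
      by (rule mu_assoc) (use assms l in \<open>simp_all add: list_all2_conv_all_nth\<close>)
    also have "map2 (\<lambda>ks (q, rs). mo ks q rs) (map (\<lambda>k. replicate n k) ms)
          (zip (replicate (length ms) r) (map (\<lambda>q. replicate n q) qs)) =
        map2 (\<lambda>k q. mo (replicate n k) r (replicate n q)) ms qs"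
      using l by (intro nth_equalityI) simp_all
    finally show ?thesis by (simp add: o_def sum_list_replicate map_replicate_const)
  qed
  show "mo (replicate n (sum_list ms)) r (replicate n (mo ms p qs)) =
      mo (concat (replicate n ms)) (mo (replicate n (length ms)) r (replicate n p)) (concat (replicate n qs))"
    using mu_assoc[of r "replicate n ms" "replicate n p" "replicate n qs"] assms
    by (simp add: list_all2_conv_all_nth)
qed

lemma sum_list_concat_replicate:
  fixes ms :: "nat list"
  shows "sum_list (concat (replicate n ms)) = n * sum_list ms"
    "length (concat (replicate n xs)) = n * length xs"
    "sum_list (concat (map (\<lambda>k. replicate n k) ms)) = sum_list ms * n"
    "length (concat (map (\<lambda>x. replicate n (f x)) ys)) = length ys * n"
proof -
  show "sum_list (concat (replicate n ms)) = n * sum_list ms" "length (concat (replicate n xs)) = n * length xs"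
    by (induction n) simp_all
  show "sum_list (concat (map (\<lambda>k. replicate n k) ms)) = sum_list ms * n"
    by (induction ms) (simp_all add: sum_list_replicate algebra_simps)
  show "length (concat (map (\<lambda>x. replicate n (f x)) ys)) = length ys * n"
    by (induction ys) simp_all
qed

lemma objs_concat:
  assumes "objs ms qs"
  shows "objs (concat (replicate n ms)) (concat (replicate n qs))"
    "objs (concat (map (\<lambda>k. replicate n k) ms)) (concat (map (\<lambda>q. replicate n q) qs))"
proof -
  show "objs (concat (replicate n ms)) (concat (replicate n qs))"
    by (induction n) (auto intro!: list_all2_appendI assms)
  show "objs (concat (map (\<lambda>k. replicate n k) ms)) (concat (map (\<lambda>q. replicate n q) qs))"
    using assms
  proof (induction rule: list_all2_induct)
    case (Cons k ks q qs)
    have "objs (replicate n k) (replicate n q)" using Cons(1) by (simp add: list_all2_conv_all_nth)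
    then show ?case using Cons(3) by (simp add: list_all2_appendI)
  qed simp
qed

lemma map2_concat:
  assumes "length ms = length qs"
  shows "concat (replicate n (map2 f ms qs)) = map2 f (concat (replicate n ms)) (concat (replicate n qs))"
    "concat (map2 (\<lambda>k q. replicate n (f k q)) ms qs) =
      map2 f (concat (map (\<lambda>k. replicate n k) ms)) (concat (map (\<lambda>q. replicate n q) qs))"
proof -
  show "concat (replicate n (map2 f ms qs)) = map2 f (concat (replicate n ms)) (concat (replicate n qs))"
    using assms by (induction n) simp_all
  show "concat (map2 (\<lambda>k q. replicate n (f k q)) ms qs) =
      map2 f (concat (map (\<lambda>k. replicate n k) ms)) (concat (map (\<lambda>q. replicate n q) qs))"
    using assms by (induction ms qs rule: list_induct2) (simp_all add: zip_replicate map_replicate_const)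
qed

text \<open>Types the two factors of axiom (6). In the source, the transpositions of the inner
  \<lambda> come out by inner equivariance as a block sum, which \<open>transpose_perm_sum\<close>
  merges with \<delta>. In the middle, \<delta> is produced by outer equivariance. The target is
  plain associativity.\<close>

lemma lam_mu_left:
  assumes "p \<in> obj (length ms)" "objs ms qs" "r \<in> obj n"
  shows "lam_src (sum_list ms) n (mo ms p qs) r =
     ao (n * sum_list ms) (block_perm (concat (replicate n ms)) (transpose_perm n (length ms)))
       (mo (map (\<lambda>k. n * k) ms) p (map2 (\<lambda>k q. lam_src k n q r) ms qs))" (is "?s = ao _ ?\<delta> ?b")
    "ao (n * sum_list ms) (block_perm (concat (replicate n ms)) (transpose_perm n (length ms)))
       (mo (map (\<lambda>k. n * k) ms) p (map2 (\<lambda>k q. lam_trg k n q r) ms qs)) =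
     mo (concat (replicate n ms)) (lam_src (length ms) n p r) (concat (replicate n qs))"
    "lam_trg (sum_list ms) n (mo ms p qs) r =
     mo (concat (replicate n ms)) (lam_trg (length ms) n p r) (concat (replicate n qs))"
proof -
  have lq: "length qs = length ms" using assms(2) list_all2_lengthD by force
  note m = mu_mu_replicate[OF assms]
  let ?\<beta> = "block_sum (map (\<lambda>k. n * k) ms) (map (\<lambda>k. transpose_perm n k) ms)"
  let ?x = "mo (map (\<lambda>k. n * k) ms) p (map2 (\<lambda>k q. mo (replicate k n) q (replicate k r)) ms qs)"
  have xo: "objs (map (\<lambda>k. n * k) ms) (map2 (\<lambda>k q. mo (replicate k n) q (replicate k r)) ms qs)"
    using assms mu_replicate_obj by (simp add: list_all2_conv_all_nth)
  have x: "?x \<in> obj (n * sum_list ms)"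
    using mu_obj[of p "map (\<lambda>k. n * k) ms", OF _ xo] assms(1) by (simp add: sum_list_const_mult)
  have "?b = mo (map (\<lambda>k. n * k) ms) p (map2 (\<lambda>k (\<tau>, q). ao k \<tau> q) (map (\<lambda>k. n * k) ms)
       (zip (map (\<lambda>k. transpose_perm n k) ms) (map2 (\<lambda>k q. mo (replicate k n) q (replicate k r)) ms qs)))"
    using lq by (intro arg_cong[where f = "mo _ p"] nth_equalityI) (simp_all add: lam_src_def)
  also have "\<dots> = ao (n * sum_list ms) ?\<beta> ?x"
    by (subst mu_act_inner(1)[OF _ _ xo])
      (use permutes_transpose assms in \<open>simp_all add: list_all2_conv_all_nth sum_list_const_mult\<close>)
  finally have b: "?b = ao (n * sum_list ms) ?\<beta> ?x" .
  show "?s = ao (n * sum_list ms) ?\<delta> ?b"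
    unfolding b act_act(1)[OF permutes_block_sum_transpose(1) permutes_block_perm_transpose(1) x] transpose_perm_sum
    by (simp add: lam_src_def m(1) mult.commute[of _ n])
  \<comment> \<open>The transposition inside \<open>lam_src\<close> comes out as \<delta> and
    rearranges the lists of arities and of inner operations on its way.\<close>
  have "mo (concat (replicate n ms)) (lam_src (length ms) n p r) (concat (replicate n qs)) =
    ao (n * sum_list ms) ?\<delta> (mo (act_list (transpose_perm n (length ms)) (concat (replicate n ms)))
      (mo (replicate (length ms) n) p (replicate (length ms) r))
      (act_list (transpose_perm n (length ms)) (concat (replicate n qs))))"
    using mu_act_outer(1)[of "transpose_perm n (length ms)" "concat (replicate n ms)" _ "concat (replicate n qs)"]
      permutes_transpose mu_replicate_obj[OF assms(1,3)] objs_concat[OF assms(2)]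
    by (simp add: sum_list_concat_replicate lam_src_def)
  then show "ao (n * sum_list ms) ?\<delta> (mo (map (\<lambda>k. n * k) ms) p (map2 (\<lambda>k q. lam_trg k n q r) ms qs)) =
     mo (concat (replicate n ms)) (lam_src (length ms) n p r) (concat (replicate n qs))"
    using act_list_transpose_replicate(1)[of "length ms" ms n] act_list_transpose_replicate(1)[of "length ms" qs n] lq
    by (simp add: lam_trg_def m(2))
  show "lam_trg (sum_list ms) n (mo ms p qs) r =
     mo (concat (replicate n ms)) (lam_trg (length ms) n p r) (concat (replicate n qs))"
    by (simp add: lam_trg_def m(3))
qed

text \<open>Types the two factors of axiom (7). The roles are exchanged: in the source, \<delta>
  comes from outer equivariance applied to the transposition of \<lambda> at \<open>p\<close> and
  \<open>q\<close>, and merges with the block sum by \<open>transpose_perm_sum'\<close>; in the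
  middle, the block sum enters the inner operations as their transpositions.\<close>

lemma lam_mu_right:
  assumes "p \<in> obj l" "q \<in> obj (length ns)" "objs ns rs"
  shows "lam_src l (sum_list ns) p (mo ns q rs) =
     ao (sum_list ns * l) (block_sum (map (\<lambda>k. k * l) ns) (map (\<lambda>k. transpose_perm k l) ns))
       (mo (concat (map (\<lambda>k. replicate l k) ns)) (lam_src l (length ns) p q) (concat (map (\<lambda>r. replicate l r) rs)))"
       (is "?s = ao _ ?\<beta> ?b")
    "ao (sum_list ns * l) (block_sum (map (\<lambda>k. k * l) ns) (map (\<lambda>k. transpose_perm k l) ns))
       (mo (concat (map (\<lambda>k. replicate l k) ns)) (lam_trg l (length ns) p q) (concat (map (\<lambda>r. replicate l r) rs))) =
     mo (map (\<lambda>k. k * l) ns) q (map2 (\<lambda>k r. lam_src l k p r) ns rs)"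
    "lam_trg l (sum_list ns) p (mo ns q rs) = mo (map (\<lambda>k. k * l) ns) q (map2 (\<lambda>k r. lam_trg l k p r) ns rs)"
proof -
  have lr: "length rs = length ns" using assms(3) list_all2_lengthD by force
  note m = mu_mu_replicate[OF assms(2,3,1)]
  let ?\<delta> = "block_perm (concat (map (\<lambda>k. replicate l k) ns)) (transpose_perm (length ns) l)"
  let ?x = "mo (concat (replicate l ns)) (mo (replicate l (length ns)) p (replicate l q)) (concat (replicate l rs))"
  have x: "?x \<in> obj (sum_list ns * l)"
    using mu_obj[of "mo (replicate l (length ns)) p (replicate l q)", OF _ objs_concat(1)[OF assms(3)], of l]
      mu_replicate_obj[OF assms(1,2)] by (simp add: sum_list_concat_replicate mult.commute)
  have "?b = ao (sum_list ns * l) ?\<delta> (mo (act_list (transpose_perm (length ns) l) (concat (map (\<lambda>k. replicate l k) ns)))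
      (mo (replicate l (length ns)) p (replicate l q))
      (act_list (transpose_perm (length ns) l) (concat (map (\<lambda>r. replicate l r) rs))))"
    using mu_act_outer(1)[of "transpose_perm (length ns) l" "concat (map (\<lambda>k. replicate l k) ns)" _ "concat (map (\<lambda>r. replicate l r) rs)"]
      permutes_transpose mu_replicate_obj[OF assms(1,2)] objs_concat[OF assms(3)]
    by (simp add: sum_list_concat_replicate lam_src_def)
  then have b: "?b = ao (sum_list ns * l) ?\<delta> ?x"
    using act_list_transpose_replicate(2)[of "length ns" ns l] act_list_transpose_replicate(2)[of "length ns" rs l] lr
    by simp
  show "?s = ao (sum_list ns * l) ?\<beta> ?b"
    unfolding b act_act(1)[OF permutes_block_perm_transpose(2) permutes_block_sum_transpose(2) x] transpose_perm_sum'
    by (simp add: lam_src_def m(3))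
  have xo: "objs (map (\<lambda>k. k * l) ns) (map2 (\<lambda>k r. mo (replicate l k) p (replicate l r)) ns rs)"
    using assms mu_replicate_obj by (simp add: list_all2_conv_all_nth)
  have "mo (map (\<lambda>k. k * l) ns) q (map2 (\<lambda>k r. lam_src l k p r) ns rs) =
    mo (map (\<lambda>k. k * l) ns) q (map2 (\<lambda>k (\<tau>, q). ao k \<tau> q) (map (\<lambda>k. k * l) ns)
       (zip (map (\<lambda>k. transpose_perm k l) ns) (map2 (\<lambda>k r. mo (replicate l k) p (replicate l r)) ns rs)))"
    using lr by (intro arg_cong[where f = "mo _ q"] nth_equalityI) (simp_all add: lam_src_def)
  also have "\<dots> = ao (sum_list ns * l) ?\<beta> (mo (map (\<lambda>k. k * l) ns) q (map2 (\<lambda>k r. mo (replicate l k) p (replicate l r)) ns rs))"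
    by (subst mu_act_inner(1)[OF _ _ xo])
      (use permutes_transpose assms in \<open>simp_all add: list_all2_conv_all_nth sum_list_mult_const\<close>)
  finally show "ao (sum_list ns * l) ?\<beta>
       (mo (concat (map (\<lambda>k. replicate l k) ns)) (lam_trg l (length ns) p q) (concat (map (\<lambda>r. replicate l r) rs))) =
     mo (map (\<lambda>k. k * l) ns) q (map2 (\<lambda>k r. lam_src l k p r) ns rs)"
    using m(2) by (simp add: lam_trg_def mult.commute)
  show "lam_trg l (sum_list ns) p (mo ns q rs) = mo (map (\<lambda>k. k * l) ns) q (map2 (\<lambda>k r. lam_trg l k p r) ns rs)"
    by (simp add: lam_trg_def m(1))
qed

end

lemma replicate_one: "replicate 1 x = [x]"
  by (simp add: One_nat_def)

section \<open>Existence and uniqueness of the structure under contractibility\<close>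

locale contractible_operad_in_Cat = operad_in_Cat P for P :: "('o, 'a) operad" +
  assumes contractible: "contractible_operad P"
begin

text \<open>The functor \<open>G \<odot> F\<close> factors through the terminal category and is
  constant at the object \<open>?a\<close>. Naturality of \<eta> at \<open>h\<close> from
  \<open>p\<close> to \<open>q\<close> therefore says that \<eta> at \<open>q\<close> after
  \<open>h\<close> is \<eta> at \<open>p\<close>; cancelling the invertible \<eta> at
  \<open>q\<close> leaves one possible \<open>h\<close>. Existence goes through \<open>?a\<close> as
  well.\<close>

lemma
  shows hom_unique: "f \<in> hom n p q \<Longrightarrow> g \<in> hom n p q \<Longrightarrow> f = g"
    and hom_ex: "p \<in> obj n \<Longrightarrow> q \<in> obj n \<Longrightarrow> \<exists>f. f \<in> hom n p q"
proof -
  obtain F :: "('o, 'a, unit, unit) fnct" and G :: "(unit, unit, 'o, 'a) fnct" and \<eta>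
    where G: "is_functor terminal_cat (Op P n) G" and n: "nat_iso (Op P n) (Op P n) id_fnct (G \<odot> F) \<eta>"
    using contractible unfolding contractible_operad_def equivalent_cats_def by blast
  let ?c = "cmp (Op P n)" and ?a = "FO G ()"
  have GF: "FO (G \<odot> F) x = ?a" "FA (G \<odot> F) f = idt (Op P n) ?a" for x f
    using G by (simp_all add: fcomp_def is_functor_def terminal_cat_def)
  have e: "\<eta> x \<in> hom n x ?a" "\<exists>e. e \<in> hom n ?a x \<and> ?c e (\<eta> x) = idt (Op P n) x" if "x \<in> obj n" for x
    using n that unfolding nat_iso_def nat_trans_def iso_arrow_def inverse_arrows_def GF hom_def id_fnct_def
    by auto (metis (no_types, lifting))
  show "\<exists>f. f \<in> hom n p q" if "p \<in> obj n" "q \<in> obj n"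
    using e(1)[OF that(1)] e(2)[OF that(2)] hom_cmp by blast
  show "f = g" if fg: "f \<in> hom n p q" "g \<in> hom n p q"
  proof -
    have o: "p \<in> obj n" "q \<in> obj n" using hom_obj[OF fg(1)] by auto
    obtain e where e': "e \<in> hom n ?a q" "?c e (\<eta> q) = idt (Op P n) q" using e(2)[OF o(2)] by blast
    have "h = ?c e (\<eta> p)" if h: "h \<in> hom n p q" for h
    proof -
      have "?c (\<eta> q) h = ?c (idt (Op P n) ?a) (\<eta> p)"
        using n h unfolding nat_iso_def nat_trans_def GF hom_def id_fnct_def by auto
      also have "\<dots> = \<eta> p" using cat[of n] e(1)[OF o(1)] by (auto simp: category_def hom_def)
      finally have "?c e (?c (\<eta> q) h) = ?c e (\<eta> p)" by simp
      moreover have "?c e (?c (\<eta> q) h) = ?c (?c e (\<eta> q)) h"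
        by (rule hom_assoc[OF h e(1)[OF o(2)] e'(1)])
      ultimately show ?thesis by (simp add: e'(2) hom_idt_left[OF h])
    qed
    then show ?thesis using fg by metis
  qed
qed

text \<open>By \<open>hom_unique\<close> there is at most one candidate, so the choice operator
  selects nothing arbitrary on objects of the operad.\<close>

definition lam :: "nat \<Rightarrow> nat \<Rightarrow> 'o \<Rightarrow> 'o \<Rightarrow> 'a" where
  "lam n m p q = (SOME f. f \<in> hom (m * n) (lam_src n m p q) (lam_trg n m p q))"

lemma lam_hom: "p \<in> obj n \<Longrightarrow> q \<in> obj m \<Longrightarrow> lam n m p q \<in> hom (m * n) (lam_src n m p q) (lam_trg n m p q)"
  unfolding lam_def by (rule someI_ex) (intro hom_ex lam_src_obj lam_trg_obj)

text \<open>Both composites are endomorphisms, and the only endomorphism of an object is its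
  identity.\<close>

lemma inverse_arrowsI: "f \<in> hom n p q \<Longrightarrow> g \<in> hom n q p \<Longrightarrow> inverse_arrows (Op P n) f g"
  using hom_unique[OF hom_cmp hom_idt, of f n p q g] hom_unique[OF hom_cmp hom_idt, of g n q p f] hom_obj[of f n p q]
  by (auto simp: inverse_arrows_def hom_def)

lemma hom_mu_idt:
  assumes "f \<in> hom (length ks) p p'" "objs ks qs"
  shows "ma ks f (map2 (\<lambda>k. idt (Op P k)) ks qs) \<in> hom (sum_list ks) (mo ks p qs) (mo ks p' qs)"
  using assms by (intro hom_mu) (auto simp: list_all2_conv_all_nth hom_idt)

lemma hom_mu_lam_left:
  assumes "p \<in> obj (length ms)" "objs ms qs" "r \<in> obj n"
  shows "ma (map (\<lambda>k. n * k) ms) (idt (Op P (length ms)) p) (map2 (\<lambda>k q. lam k n q r) ms qs) \<in>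
    hom (n * sum_list ms) (mo (map (\<lambda>k. n * k) ms) p (map2 (\<lambda>k q. lam_src k n q r) ms qs))
      (mo (map (\<lambda>k. n * k) ms) p (map2 (\<lambda>k q. lam_trg k n q r) ms qs))"
proof -
  have "ma (map (\<lambda>k. n * k) ms) (idt (Op P (length ms)) p) (map2 (\<lambda>k q. lam k n q r) ms qs) \<in>
    hom (sum_list (map (\<lambda>k. n * k) ms)) (mo (map (\<lambda>k. n * k) ms) p (map2 (\<lambda>k q. lam_src k n q r) ms qs))
      (mo (map (\<lambda>k. n * k) ms) p (map2 (\<lambda>k q. lam_trg k n q r) ms qs))"
    using assms by (intro hom_mu) (auto simp: list_all2_conv_all_nth hom_idt lam_hom)
  then show ?thesis by (simp add: sum_list_const_mult)
qed

lemma hom_mu_lam_right: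
  assumes "p \<in> obj l" "q \<in> obj (length ns)" "objs ns rs"
  shows "ma (map (\<lambda>k. k * l) ns) (idt (Op P (length ns)) q) (map2 (\<lambda>k r. lam l k p r) ns rs) \<in>
    hom (sum_list ns * l) (mo (map (\<lambda>k. k * l) ns) q (map2 (\<lambda>k r. lam_src l k p r) ns rs))
      (mo (map (\<lambda>k. k * l) ns) q (map2 (\<lambda>k r. lam_trg l k p r) ns rs))"
proof -
  have "ma (map (\<lambda>k. k * l) ns) (idt (Op P (length ns)) q) (map2 (\<lambda>k r. lam l k p r) ns rs) \<in>
    hom (sum_list (map (\<lambda>k. k * l) ns)) (mo (map (\<lambda>k. k * l) ns) q (map2 (\<lambda>k r. lam_src l k p r) ns rs))
      (mo (map (\<lambda>k. k * l) ns) q (map2 (\<lambda>k r. lam_trg l k p r) ns rs))"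
    using assms by (intro hom_mu) (auto simp: list_all2_conv_all_nth hom_idt lam_hom)
  then show ?thesis by (simp add: sum_list_mult_const)
qed

lemma hom_lam_left:
  assumes "p \<in> obj (length ms)" "objs ms qs" "r \<in> obj n"
  shows "ma (concat (replicate n ms)) (lam (length ms) n p r) (concat (replicate n (map2 (\<lambda>k. idt (Op P k)) ms qs))) \<in>
      hom (n * sum_list ms) (mo (concat (replicate n ms)) (lam_src (length ms) n p r) (concat (replicate n qs)))
        (lam_trg (sum_list ms) n (mo ms p qs) r)"
    and "aa (n * sum_list ms) (block_perm (concat (replicate n ms)) (transpose_perm n (length ms)))
        (ma (map (\<lambda>k. n * k) ms) (idt (Op P (length ms)) p) (map2 (\<lambda>k q. lam k n q r) ms qs)) \<in>
      hom (n * sum_list ms) (lam_src (sum_list ms) n (mo ms p qs) r)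
        (mo (concat (replicate n ms)) (lam_src (length ms) n p r) (concat (replicate n qs)))"
proof -
  have "ma (concat (replicate n ms)) (lam (length ms) n p r)
      (map2 (\<lambda>k. idt (Op P k)) (concat (replicate n ms)) (concat (replicate n qs))) \<in> hom (n * sum_list ms)
    (mo (concat (replicate n ms)) (lam_src (length ms) n p r) (concat (replicate n qs)))
    (mo (concat (replicate n ms)) (lam_trg (length ms) n p r) (concat (replicate n qs)))"
    using hom_mu_idt[OF _ objs_concat(1)[OF assms(2)], of "lam (length ms) n p r" n] lam_hom[OF assms(1,3)]
    by (simp add: sum_list_concat_replicate)
  then show "ma (concat (replicate n ms)) (lam (length ms) n p r) (concat (replicate n (map2 (\<lambda>k. idt (Op P k)) ms qs))) \<in>
      hom (n * sum_list ms) (mo (concat (replicate n ms)) (lam_src (length ms) n p r) (concat (replicate n qs)))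
        (lam_trg (sum_list ms) n (mo ms p qs) r)"
    unfolding lam_mu_left(3)[OF assms] map2_concat(1)[OF list_all2_lengthD[OF assms(2)]] .
  show "aa (n * sum_list ms) (block_perm (concat (replicate n ms)) (transpose_perm n (length ms)))
        (ma (map (\<lambda>k. n * k) ms) (idt (Op P (length ms)) p) (map2 (\<lambda>k q. lam k n q r) ms qs)) \<in>
      hom (n * sum_list ms) (lam_src (sum_list ms) n (mo ms p qs) r)
        (mo (concat (replicate n ms)) (lam_src (length ms) n p r) (concat (replicate n qs)))"
    using hom_act[OF permutes_block_perm_transpose(1) hom_mu_lam_left[OF assms]]
    unfolding lam_mu_left(1)[OF assms] lam_mu_left(2)[OF assms] .
qed

lemma hom_lam_right:
  assumes "p \<in> obj l" "q \<in> obj (length ns)" "objs ns rs"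
  shows "aa (sum_list ns * l) (block_sum (map (\<lambda>k. k * l) ns) (map (\<lambda>k. transpose_perm k l) ns))
        (ma (concat (map (\<lambda>k. replicate l k) ns)) (lam l (length ns) p q)
           (concat (map2 (\<lambda>k r. replicate l (idt (Op P k) r)) ns rs))) \<in>
      hom (sum_list ns * l) (lam_src l (sum_list ns) p (mo ns q rs))
        (mo (map (\<lambda>k. k * l) ns) q (map2 (\<lambda>k r. lam_src l k p r) ns rs))"
    and "ma (map (\<lambda>k. k * l) ns) (idt (Op P (length ns)) q) (map2 (\<lambda>k r. lam l k p r) ns rs) \<in>
      hom (sum_list ns * l) (mo (map (\<lambda>k. k * l) ns) q (map2 (\<lambda>k r. lam_src l k p r) ns rs))
        (lam_trg l (sum_list ns) p (mo ns q rs))"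
proof -
  have "ma (concat (map (\<lambda>k. replicate l k) ns)) (lam l (length ns) p q)
       (map2 (\<lambda>k. idt (Op P k)) (concat (map (\<lambda>k. replicate l k) ns)) (concat (map (\<lambda>r. replicate l r) rs))) \<in>
     hom (sum_list ns * l)
    (mo (concat (map (\<lambda>k. replicate l k) ns)) (lam_src l (length ns) p q) (concat (map (\<lambda>r. replicate l r) rs)))
    (mo (concat (map (\<lambda>k. replicate l k) ns)) (lam_trg l (length ns) p q) (concat (map (\<lambda>r. replicate l r) rs)))"
    using hom_mu_idt[OF _ objs_concat(2)[OF assms(3)], of "lam l (length ns) p q" l] lam_hom[OF assms(1,2)]
    by (simp add: sum_list_concat_replicate)
  from hom_act[OF permutes_block_sum_transpose(2) this]
  show "aa (sum_list ns * l) (block_sum (map (\<lambda>k. k * l) ns) (map (\<lambda>k. transpose_perm k l) ns))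
        (ma (concat (map (\<lambda>k. replicate l k) ns)) (lam l (length ns) p q)
           (concat (map2 (\<lambda>k r. replicate l (idt (Op P k) r)) ns rs))) \<in>
      hom (sum_list ns * l) (lam_src l (sum_list ns) p (mo ns q rs))
        (mo (map (\<lambda>k. k * l) ns) q (map2 (\<lambda>k r. lam_src l k p r) ns rs))"
    using list_all2_lengthD[OF assms(3)]
    unfolding lam_mu_right(1)[OF assms] lam_mu_right(2)[OF assms, symmetric]
    by (simp add: map2_concat)
  show "ma (map (\<lambda>k. k * l) ns) (idt (Op P (length ns)) q) (map2 (\<lambda>k r. lam l k p r) ns rs) \<in>
      hom (sum_list ns * l) (mo (map (\<lambda>k. k * l) ns) q (map2 (\<lambda>k r. lam_src l k p r) ns rs))
        (lam_trg l (sum_list ns) p (mo ns q rs))"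
    using hom_mu_lam_right[OF assms] unfolding lam_mu_right(3)[OF assms] .
qed

lemma lam_mu_left_eq:
  assumes "p \<in> obj (length ms)" "objs ms qs" "r \<in> obj n"
  shows "lam (sum_list ms) n (mo ms p qs) r =
        cmp (Op P (n * sum_list ms))
          (ma (concat (replicate n ms)) (lam (length ms) n p r) (concat (replicate n (map2 (\<lambda>k. idt (Op P k)) ms qs))))
          (aa (n * sum_list ms) (block_perm (concat (replicate n ms)) (transpose_perm n (length ms)))
             (ma (map (\<lambda>k. n * k) ms) (idt (Op P (length ms)) p) (map2 (\<lambda>k q. lam k n q r) ms qs)))"
proof (rule hom_unique)
  show "lam (sum_list ms) n (mo ms p qs) r \<in> hom (n * sum_list ms)
    (lam_src (sum_list ms) n (mo ms p qs) r) (lam_trg (sum_list ms) n (mo ms p qs) r)"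
    using assms by (intro lam_hom mu_obj)
  show "cmp (Op P (n * sum_list ms))
          (ma (concat (replicate n ms)) (lam (length ms) n p r) (concat (replicate n (map2 (\<lambda>k. idt (Op P k)) ms qs))))
          (aa (n * sum_list ms) (block_perm (concat (replicate n ms)) (transpose_perm n (length ms)))
             (ma (map (\<lambda>k. n * k) ms) (idt (Op P (length ms)) p) (map2 (\<lambda>k q. lam k n q r) ms qs))) \<in>
     hom (n * sum_list ms) (lam_src (sum_list ms) n (mo ms p qs) r) (lam_trg (sum_list ms) n (mo ms p qs) r)"
    by (rule hom_cmp[OF hom_lam_left(2,1)[OF assms]])
qed

lemma lam_mu_right_eq:
  assumes "p \<in> obj l" "q \<in> obj (length ns)" "objs ns rs"
  shows "lam l (sum_list ns) p (mo ns q rs) =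
        cmp (Op P (sum_list ns * l))
          (ma (map (\<lambda>k. k * l) ns) (idt (Op P (length ns)) q) (map2 (\<lambda>k r. lam l k p r) ns rs))
          (aa (sum_list ns * l) (block_sum (map (\<lambda>k. k * l) ns) (map (\<lambda>k. transpose_perm k l) ns))
             (ma (concat (map (\<lambda>k. replicate l k) ns)) (lam l (length ns) p q)
                (concat (map2 (\<lambda>k r. replicate l (idt (Op P k) r)) ns rs))))"
proof (rule hom_unique)
  show "lam l (sum_list ns) p (mo ns q rs) \<in> hom (sum_list ns * l)
    (lam_src l (sum_list ns) p (mo ns q rs)) (lam_trg l (sum_list ns) p (mo ns q rs))"
    using assms by (intro lam_hom mu_obj)
  show "cmp (Op P (sum_list ns * l))
          (ma (map (\<lambda>k. k * l) ns) (idt (Op P (length ns)) q) (map2 (\<lambda>k r. lam l k p r) ns rs))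
          (aa (sum_list ns * l) (block_sum (map (\<lambda>k. k * l) ns) (map (\<lambda>k. transpose_perm k l) ns))
             (ma (concat (map (\<lambda>k. replicate l k) ns)) (lam l (length ns) p q)
                (concat (map2 (\<lambda>k r. replicate l (idt (Op P k) r)) ns rs)))) \<in>
     hom (sum_list ns * l) (lam_src l (sum_list ns) p (mo ns q rs)) (lam_trg l (sum_list ns) p (mo ns q rs))"
    by (rule hom_cmp[OF hom_lam_right(1,2)[OF assms]])
qed

text \<open>For one input and the unit the transposition is the identity permutation, so source and
  target both collapse to \<open>p\<close> by the unit laws, and the identity is an arrow between
  them.\<close>

lemma lam_unit:
  assumes "p \<in> obj n"
  shows "lam n 1 p (unit P) = idt (Op P n) p" "lam 1 n (unit P) p = idt (Op P n) p"
proof -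
  have "lam_src n 1 p (unit P) = p" "lam_trg n 1 p (unit P) = p" "lam_src 1 n (unit P) p = p" "lam_trg 1 n (unit P) p = p"
    using mu_unit(1)[OF assms] mu_unit(2)[OF assms] assms
    by (simp_all add: lam_src_def lam_trg_def transpose_perm_one act_id replicate_one)
  then show "lam n 1 p (unit P) = idt (Op P n) p" "lam 1 n (unit P) p = idt (Op P n) p"
    using lam_hom[OF assms unit_obj(1)] lam_hom[OF unit_obj(1) assms] hom_idt[OF assms] hom_unique by fastforce+
qed

lemma lam_act:
  assumes "p \<in> obj n" "q \<in> obj m" "g permutes {1..n}" "h permutes {1..m}"
  shows "aa (m * n) (mu_sym (replicate m n) h (replicate m g)) (lam n m p q) = lam n m (ao n g p) (ao m h q)"
proof (rule hom_unique)
  have "mu_sym (replicate m n) h (replicate m g) permutes {1..m * n}"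
    using permutes_mu_sym[OF assms(4,3)] by (simp add: mult.commute)
  from hom_act[OF this lam_hom[OF assms(1,2)]]
  show "aa (m * n) (mu_sym (replicate m n) h (replicate m g)) (lam n m p q) \<in>
    hom (m * n) (lam_src n m (ao n g p) (ao m h q)) (lam_trg n m (ao n g p) (ao m h q))"
    by (simp add: lam_src_act[OF assms] lam_trg_act[OF assms])
qed (use assms lam_hom in simp)

lemma lam_dom_eq:
  "FO (lam_dom P transpose_perm n m) (p, q) = lam_src n m p q" "FO (lam_cod P n m) (p, q) = lam_trg n m p q"
  by (simp_all add: lam_dom_def lam_cod_def fcomp_def lam_src_def lam_trg_def)

lemma mu_replicate_hom:
  assumes "f \<in> hom n p p'" "g \<in> hom m q q'"
  shows "ma (replicate n m) f (replicate n g) \<in> hom (m * n) (mo (replicate n m) p (replicate n q)) (mo (replicate n m) p' (replicate n q'))"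
proof -
  have "ma (replicate n m) f (replicate n g) \<in>
    hom (sum_list (replicate n m)) (mo (replicate n m) p (replicate n q)) (mo (replicate n m) p' (replicate n q'))"
    using assms by (intro hom_mu) auto
  then show ?thesis by (simp add: sum_list_replicate mult.commute)
qed

lemma operad_pseudo_comm_lam: "operad_pseudo_comm P transpose_perm lam"
proof -
  have n: "nat_iso (prod_cat (Op P n) (Op P m)) (Op P (m * n))
        (lam_dom P transpose_perm n m) (lam_cod P n m) (\<lambda>(p, q). lam n m p q)" for n m
    unfolding nat_iso_def nat_trans_def
  proof (intro conjI ballI; (elim conjE)?)
    fix x assume "x \<in> Obj (prod_cat (Op P n) (Op P m))"
    then obtain p q where x: "x = (p, q)" "p \<in> obj n" "q \<in> obj m" by (auto simp: prod_cat_def)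
    show "(case x of (p, q) \<Rightarrow> lam n m p q) \<in> arr (m * n)"
      "src (Op P (m * n)) (case x of (p, q) \<Rightarrow> lam n m p q) = FO (lam_dom P transpose_perm n m) x"
      "trg (Op P (m * n)) (case x of (p, q) \<Rightarrow> lam n m p q) = FO (lam_cod P n m) x"
      using lam_hom[OF x(2,3)] by (simp_all add: x(1) lam_dom_eq hom_def)
    show "iso_arrow (Op P (m * n)) (case x of (p, q) \<Rightarrow> lam n m p q)"
      using inverse_arrowsI[OF lam_hom[OF x(2,3)]] hom_ex[OF lam_trg_obj[OF x(2,3)] lam_src_obj[OF x(2,3)]]
      unfolding iso_arrow_def x(1) by auto
  next
    fix x assume "x \<in> Arr (prod_cat (Op P n) (Op P m))"
    then obtain f g where x: "x = (f, g)" "f \<in> arr n" "g \<in> arr m" by (auto simp: prod_cat_def)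
    obtain p p' q q' where h: "f \<in> hom n p p'" "g \<in> hom m q q'" using x by (auto simp: hom_def)
    note l = lam_hom[of p n q m] lam_hom[of p' n q' m] hom_obj[OF h(1)] hom_obj[OF h(2)]
    have d: "FA (lam_dom P transpose_perm n m) x \<in> hom (m * n) (lam_src n m p q) (lam_src n m p' q')"
      using hom_act[OF permutes_transpose mu_replicate_hom[OF h]]
      by (simp add: x lam_dom_def fcomp_def lam_src_def)
    have c: "FA (lam_cod P n m) x \<in> hom (m * n) (lam_trg n m p q) (lam_trg n m p' q')"
      using mu_replicate_hom[OF h(2,1)]
      by (simp add: x lam_cod_def fcomp_def lam_trg_def mult.commute)
    have s: "src (prod_cat (Op P n) (Op P m)) x = (p, q)" "trg (prod_cat (Op P n) (Op P m)) x = (p', q')"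
      using h by (simp_all add: prod_cat_def x hom_def)
    show "cmp (Op P (m * n)) (case trg (prod_cat (Op P n) (Op P m)) x of (p, q) \<Rightarrow> lam n m p q) (FA (lam_dom P transpose_perm n m) x) =
      cmp (Op P (m * n)) (FA (lam_cod P n m) x) (case src (prod_cat (Op P n) (Op P m)) x of (p, q) \<Rightarrow> lam n m p q)"
      unfolding s prod.case
      by (rule hom_unique[OF hom_cmp[OF d] hom_cmp[OF _ c]]) (use l in auto)
  qed
  show ?thesis
    unfolding operad_pseudo_comm_def
    apply (intro conjI allI impI ballI)
    subgoal by (rule HOL.refl)
    subgoal by (rule n)
    subgoal by (rule transpose_perm_one)
    subgoal by (rule transpose_perm_one)
    subgoal by (rule lam_unit)
    subgoal by (rule lam_unit)
    subgoal by (rule mu_sym_transpose)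
    subgoal by (rule lam_act)
    subgoal by (hypsubst, rule transpose_perm_sum)
    subgoal by (hypsubst, rule transpose_perm_sum')
    subgoal by (hypsubst, rule lam_mu_left_eq)
    subgoal by (hypsubst, rule lam_mu_right_eq)
    done
qed

text \<open>Once \<open>t'\<close> is the transposition, \<open>lam'\<close> has the same source and
  target as \<open>lam\<close>, and \<open>hom_unique\<close> decides.\<close>

lemma operad_pseudo_comm_unique:
  assumes "operad_pseudo_comm P t' lam'" "0 < m" "0 < n"
  shows "t' m n = transpose_perm m n" "p \<in> obj n \<Longrightarrow> q \<in> obj m \<Longrightarrow> lam' n m p q = lam n m p q"
proof -
  show t: "t' m n = transpose_perm m n"
    using assms(1)[unfolded operad_pseudo_comm_def, THEN conjunct1] assms(2,3) by simp
  assume o: "p \<in> obj n" "q \<in> obj m"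
  have "nat_iso (prod_cat (Op P n) (Op P m)) (Op P (m * n)) (lam_dom P t' n m) (lam_cod P n m) (\<lambda>(p, q). lam' n m p q)"
    by (rule assms(1)[unfolded operad_pseudo_comm_def, THEN conjunct2, THEN conjunct1, rule_format, OF assms(3,2)])
  moreover have "lam_dom P t' n m = lam_dom P transpose_perm n m" by (simp add: lam_dom_def t)
  moreover have "(p, q) \<in> Obj (prod_cat (Op P n) (Op P m))" using o by (simp add: prod_cat_def)
  ultimately have "lam' n m p q \<in> hom (m * n) (lam_src n m p q) (lam_trg n m p q)"
    unfolding nat_iso_def nat_trans_def hom_def by (auto simp: lam_dom_eq)
  then show "lam' n m p q = lam n m p q" using hom_unique lam_hom[OF o] by blast
qed

end

subsection \<open>The induced 2-monad on representatives\<close>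

lemma cat_src_trg: "category X \<Longrightarrow> f \<in> Arr X \<Longrightarrow> src X f \<in> Obj X" "category X \<Longrightarrow> f \<in> Arr X \<Longrightarrow> trg X f \<in> Obj X"
  by (simp_all add: category_def)

lemma cat_idt:
  assumes "category X" "x \<in> Obj X"
  shows "idt X x \<in> Arr X" "src X (idt X x) = x" "trg X (idt X x) = x"
  using assms by (simp_all add: category_def)

lemma cat_cmp_idt:
  assumes "category X" "f \<in> Arr X"
  shows "cmp X f (idt X (src X f)) = f" "cmp X (idt X (trg X f)) f = f"
  using assms by (simp_all add: category_def)

lemma cat_cmp:
  assumes "category X" "f \<in> Arr X" "g \<in> Arr X" "trg X f = src X g"
  shows "cmp X g f \<in> Arr X" "src X (cmp X g f) = src X f" "trg X (cmp X g f) = trg X g"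
  using assms by (simp_all add: category_def)

lemma is_functorD:
  assumes "is_functor X Y F"
  shows "x \<in> Obj X \<Longrightarrow> FO F x \<in> Obj Y" "x \<in> Obj X \<Longrightarrow> FA F (idt X x) = idt Y (FO F x)"
    "f \<in> Arr X \<Longrightarrow> FA F f \<in> Arr Y" "f \<in> Arr X \<Longrightarrow> src Y (FA F f) = FO F (src X f)"
    "f \<in> Arr X \<Longrightarrow> trg Y (FA F f) = FO F (trg X f)"
    "f \<in> Arr X \<Longrightarrow> g \<in> Arr X \<Longrightarrow> trg X f = src X g \<Longrightarrow> FA F (cmp X g f) = cmp Y (FA F g) (FA F f)"
  using assms by (simp_all add: is_functor_def)

lemma uprod_simps [simp]:
  "UPair x y \<in> Obj (A \<otimes> B) \<longleftrightarrow> x \<in> Obj A \<and> y \<in> Obj B"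
  "UPair f g \<in> Arr (A \<otimes> B) \<longleftrightarrow> f \<in> Arr A \<and> g \<in> Arr B"
  "src (A \<otimes> B) (UPair f g) = UPair (src A f) (src B g)"
  "trg (A \<otimes> B) (UPair f g) = UPair (trg A f) (trg B g)"
  "idt (A \<otimes> B) (UPair x y) = UPair (idt A x) (idt B y)"
  "cmp (A \<otimes> B) (UPair f' g') (UPair f g) = UPair (cmp A f' f) (cmp B g' g)"
  by (simp_all add: uprod_def)

lemma uprod_objE: "z \<in> Obj (A \<otimes> B) \<Longrightarrow> (\<And>x y. z = UPair x y \<Longrightarrow> x \<in> Obj A \<Longrightarrow> y \<in> Obj B \<Longrightarrow> thesis) \<Longrightarrow> thesis"
  by (auto simp: uprod_def)

lemma uprod_arrE: "z \<in> Arr (A \<otimes> B) \<Longrightarrow> (\<And>x y. z = UPair x y \<Longrightarrow> x \<in> Arr A \<Longrightarrow> y \<in> Arr B \<Longrightarrow> thesis) \<Longrightarrow> thesis"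
  by (auto simp: uprod_def)

lemma uprod_category:
  assumes "category A" "category B"
  shows "category (A \<otimes> B)"
  using assms unfolding category_def by (auto elim!: uprod_objE uprod_arrE)

section \<open>Functions on classes of terms: functor action and strengths\<close>

context operad_in_Cat
begin

abbreviation T :: "('o, 'a, 'x, 'y) ucat \<Rightarrow> ('o, 'a, 'x, 'y) ucat" where "T \<equiv> Tcat P"
abbreviation oc :: "('o, 'a, 'x, 'y) ucat \<Rightarrow> 'o \<times> ('o, 'x) univ list \<Rightarrow> ('o, 'x) univ" where "oc \<equiv> ocls P"
abbreviation ac :: "('o, 'a, 'x, 'y) ucat \<Rightarrow> 'a \<times> ('a, 'y) univ list \<Rightarrow> ('a, 'y) univ" where "ac \<equiv> acls P"
abbreviation C :: "('o, 'a, 'x, 'y) ucat \<Rightarrow> ('o \<times> ('o, 'x) univ list, 'a \<times> ('a, 'y) univ list) cat" where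
  "C \<equiv> terms_cat P"

lemma terms_simps [simp]:
  "(p, xs) \<in> Obj (C X) \<longleftrightarrow> p \<in> obj (length xs) \<and> set xs \<subseteq> Obj X"
  "(f, ys) \<in> Arr (C X) \<longleftrightarrow> f \<in> arr (length ys) \<and> set ys \<subseteq> Arr X"
  "src (C X) (f, ys) = (src (Op P (length ys)) f, map (src X) ys)"
  "trg (C X) (f, ys) = (trg (Op P (length ys)) f, map (trg X) ys)"
  "idt (C X) (p, xs) = (idt (Op P (length xs)) p, map (idt X) xs)"
  "cmp (C X) (g, zs) (f, ys) = (cmp (Op P (length ys)) g f, map2 (cmp X) zs ys)"
  by (simp_all add: terms_cat_def)

lemma operad_on_category: "category X \<Longrightarrow> operad_on_category P X"
  by (simp add: operad_on_category_def P)

lemmas T_category = operad_on_category.Q_category[OF operad_on_category]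
lemmas C_category = operad_on_category.C[OF operad_on_category]
lemmas T_simps = operad_on_category.Q_simps[OF operad_on_category]
lemmas T_cmp = operad_on_category.Q_cmp0[OF operad_on_category]
lemmas T_lift = operad_on_category.Q_lift[OF operad_on_category]

lemma T_mem [simp]: "z \<in> Obj (C X) \<Longrightarrow> oc X z \<in> Obj (T X)" "w \<in> Arr (C X) \<Longrightarrow> ac X w \<in> Arr (T X)"
  by (auto simp: Tcat_def)

text \<open>\<open>T_fun\<close>, \<open>T_mu\<close>, \<open>lstr\<close> and \<open>rstr\<close>
  are defined on the representative chosen by \<open>uterm\<close>. This equation feeds
  \<open>oc_invariant\<close>, which replaces the chosen representative by the given one.\<close>

lemma oc_uterm: "oc X (uterm (oc X z)) = oc X z"
  using equiv_uterm_ocls[of P X z] ocls_eq_iff obj_equiv.sym by metis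

lemma ac_uterm: "ac X (uterm (ac X z)) = ac X z"
  using equiv_uterm_acls[of P X z] acls_eq_iff arr_equiv.sym by metis

lemma T_objE:
  assumes "t \<in> Obj (T X)"
  obtains p xs where "t = oc X (p, xs)" "p \<in> obj (length xs)" "set xs \<subseteq> Obj X"
  using assms by (auto simp: Tcat_def)

lemma T_arrE:
  assumes "t \<in> Arr (T X)"
  obtains f ys where "t = ac X (f, ys)" "f \<in> arr (length ys)" "set ys \<subseteq> Arr X"
  using assms by (auto simp: Tcat_def)

lemma oc_carrier: "category X \<Longrightarrow> oc X z = oc X w \<Longrightarrow> z \<in> Obj (C X) \<Longrightarrow> w \<in> Obj (C X)"
  using operad_on_category.oeq_carrier[OF operad_on_category] ocls_eq_iff by blast

lemma ac_carrier: "category X \<Longrightarrow> ac X z = ac X w \<Longrightarrow> z \<in> Arr (C X) \<Longrightarrow> w \<in> Arr (C X)"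
  using operad_on_category.aeq_carrier[OF operad_on_category] acls_eq_iff by blast

lemma oc_act: "p \<in> obj (length xs) \<Longrightarrow> set xs \<subseteq> Obj X \<Longrightarrow> \<sigma> permutes {1..length xs} \<Longrightarrow>
    oc X (ao (length xs) \<sigma> p, xs) = oc X (p, act_list \<sigma> xs)"
  by (simp add: ocls_eq_iff obj_equiv.orbit)

lemma ac_act: "f \<in> arr (length ys) \<Longrightarrow> set ys \<subseteq> Arr X \<Longrightarrow> \<sigma> permutes {1..length ys} \<Longrightarrow>
    ac X (aa (length ys) \<sigma> f, ys) = ac X (f, act_list \<sigma> ys)"
  by (simp add: acls_eq_iff arr_equiv.orbit)

lemma oc_invariant:
  assumes "oc X z = oc X w"
    and "\<And>p xs \<sigma>. p \<in> obj (length xs) \<Longrightarrow> set xs \<subseteq> Obj X \<Longrightarrow> \<sigma> permutes {1..length xs} \<Longrightarrow>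
      H (ao (length xs) \<sigma> p, xs) = H (p, act_list \<sigma> xs)"
  shows "H z = H w"
proof -
  have "obj_equiv P X z w" using assms(1) ocls_eq_iff by blast
  then show ?thesis by induction (simp_all add: assms(2))
qed

text \<open>The equivalence of arrows is closed under composition, so besides orbits the induction
  needs that \<open>H\<close> on a composite is a function \<open>M\<close> of its values on the
  factors. The type of the values is free; taking them to be functions lets composition change
  further arguments.\<close>

lemma ac_invariant:
  assumes "ac X z = ac X w"
    and "\<And>f ys \<sigma>. f \<in> arr (length ys) \<Longrightarrow> set ys \<subseteq> Arr X \<Longrightarrow> \<sigma> permutes {1..length ys} \<Longrightarrow>
      H (aa (length ys) \<sigma> f, ys) = H (f, act_list \<sigma> ys)"
    and "\<And>f g. f \<in> Arr (C X) \<Longrightarrow> g \<in> Arr (C X) \<Longrightarrow> trg (C X) f = src (C X) g \<Longrightarrow>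
      H (cmp (C X) g f) = M (H g) (H f)"
  shows "H z = H w"
proof -
  have "arr_equiv P X z w" using assms(1) acls_eq_iff by blast
  then show ?thesis by induction (simp_all add: assms(2,3))
qed

lemma ac_src_trg:
  assumes "category X" "f \<in> arr (length ys)" "set ys \<subseteq> Arr X"
  shows "src (T X) (ac X (f, ys)) = oc X (src (Op P (length ys)) f, map (src X) ys)"
    "trg (T X) (ac X (f, ys)) = oc X (trg (Op P (length ys)) f, map (trg X) ys)"
  using assms by (simp_all add: T_simps)

lemma ac_cmp:
  assumes "category X" "f \<in> arr (length ys)" "set ys \<subseteq> Arr X" "g \<in> arr (length ys)" "set zs \<subseteq> Arr X"
    "trg (Op P (length ys)) f = src (Op P (length ys)) g" "map (trg X) ys = map (src X) zs"
  shows "cmp (T X) (ac X (g, zs)) (ac X (f, ys)) = ac X (cmp (Op P (length ys)) g f, map2 (cmp X) zs ys)"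
proof -
  have "length zs = length ys" using assms(7) by (metis length_map)
  then show ?thesis using assms by (subst T_cmp) simp_all
qed

lemma T_fun_oc:
  assumes "is_functor X Y F" "p \<in> obj (length xs)" "set xs \<subseteq> Obj X"
  shows "FO (T_fun P Y F) (oc X (p, xs)) = oc Y (p, map (FO F) xs)"
proof -
  define H where "H = (\<lambda>(p, xs). oc Y (p, map (FO F) xs))"
  have "FO (T_fun P Y F) (oc X (p, xs)) = H (uterm (oc X (p, xs)))"
    by (simp add: T_fun_def H_def uterm_def)
  also have "\<dots> = H (p, xs)"
  proof (rule oc_invariant[OF oc_uterm])
    fix p xs \<sigma> assume a: "p \<in> obj (length xs)" "set xs \<subseteq> Obj X" "\<sigma> permutes {1..length xs}"
    then have "set (map (FO F) xs) \<subseteq> Obj Y" using is_functorD(1)[OF assms(1)] by auto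
    then show "H (ao (length xs) \<sigma> p, xs) = H (p, act_list \<sigma> xs)"
      using a oc_act[of p "map (FO F) xs" Y \<sigma>] by (simp add: H_def map_act_list)
  qed
  finally show ?thesis by (simp add: H_def)
qed

lemma T_fun_ac:
  assumes Y: "category Y" and F: "is_functor X Y F" and "f \<in> arr (length ys)" "set ys \<subseteq> Arr X"
  shows "FA (T_fun P Y F) (ac X (f, ys)) = ac Y (f, map (FA F) ys)"
proof -
  define H where "H = (\<lambda>(p, xs). ac Y (p, map (FA F) xs))"
  have m: "set ys \<subseteq> Arr X \<Longrightarrow> set (map (FA F) ys) \<subseteq> Arr Y" for ys using is_functorD(3)[OF F] by auto
  have "FA (T_fun P Y F) (ac X (f, ys)) = H (uterm (ac X (f, ys)))"
    by (simp add: T_fun_def H_def uterm_def)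
  also have "\<dots> = H (f, ys)"
  proof (rule ac_invariant[OF ac_uterm, where M = "cmp (T Y)"])
    fix f ys \<sigma> assume a: "f \<in> arr (length ys)" "set ys \<subseteq> Arr X" "\<sigma> permutes {1..length ys}"
    then show "H (aa (length ys) \<sigma> f, ys) = H (f, act_list \<sigma> ys)"
      using ac_act[of f "map (FA F) ys" Y \<sigma>] m[of ys] by (simp add: H_def map_act_list)
  next
    fix f g assume a: "f \<in> Arr (C X)" "g \<in> Arr (C X)" "trg (C X) f = src (C X) g"
    obtain f' ys g' zs where [simp]: "f = (f', ys)" "g = (g', zs)" by (cases f, cases g) auto
    have l: "length ys = length zs" using a(3) by (auto dest: len_eq)
    have e: "\<forall>i<length ys. trg X (ys ! i) = src X (zs ! i)" using a(3) l by (auto simp: list_eq_iff_nth_eq)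
    with a l is_functorD(6)[OF F] have "map (FA F) (map2 (cmp X) zs ys) = map2 (cmp Y) (map (FA F) zs) (map (FA F) ys)"
      by (intro nth_equalityI) (auto simp: subset_iff)
    moreover have "map (trg Y) (map (FA F) ys) = map (src Y) (map (FA F) zs)"
      using a l e is_functorD(4,5)[OF F] by (intro nth_equalityI) (auto simp: subset_iff)
    ultimately show "H (cmp (C X) g f) = cmp (T Y) (H g) (H f)"
      using a l m[of ys] m[of zs] by (simp add: H_def ac_cmp[OF Y] del: map_map)
  qed
  finally show ?thesis by (simp add: H_def)
qed

lemma lstr_oc:
  assumes "a \<in> Obj A" "q \<in> obj (length bs)" "set bs \<subseteq> Obj B"
  shows "FO (lstr P A B) (UPair a (oc B (q, bs))) = oc (A \<otimes> B) (q, map (UPair a) bs)"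
proof -
  define H where "H = (\<lambda>(q, bs). oc (A \<otimes> B) (q, map (UPair a) bs))"
  have "FO (lstr P A B) (UPair a (oc B (q, bs))) = H (uterm (oc B (q, bs)))"
    by (simp add: lstr_def H_def uterm_def)
  also have "\<dots> = H (q, bs)"
  proof (rule oc_invariant[OF oc_uterm])
    fix p xs \<sigma> assume a: "p \<in> obj (length xs)" "set xs \<subseteq> Obj B" "\<sigma> permutes {1..length xs}"
    then have "set (map (UPair a) xs) \<subseteq> Obj (A \<otimes> B)" using assms(1) by auto
    then show "H (ao (length xs) \<sigma> p, xs) = H (p, act_list \<sigma> xs)"
      using a oc_act[of p "map (UPair a) xs" "A \<otimes> B" \<sigma>] by (simp add: H_def map_act_list)
  qed
  finally show ?thesis by (simp add: H_def)
qed

lemma rstr_oc: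
  assumes "b \<in> Obj B" "p \<in> obj (length as)" "set as \<subseteq> Obj A"
  shows "FO (rstr P A B) (UPair (oc A (p, as)) b) = oc (A \<otimes> B) (p, map (\<lambda>a. UPair a b) as)"
proof -
  define H where "H = (\<lambda>(q, bs). oc (A \<otimes> B) (q, map (\<lambda>a. UPair a b) bs))"
  have "FO (rstr P A B) (UPair (oc A (p, as)) b) = H (uterm (oc A (p, as)))"
    by (simp add: rstr_def H_def uterm_def)
  also have "\<dots> = H (p, as)"
  proof (rule oc_invariant[OF oc_uterm])
    fix p xs \<sigma> assume a: "p \<in> obj (length xs)" "set xs \<subseteq> Obj A" "\<sigma> permutes {1..length xs}"
    then have "set (map (\<lambda>a. UPair a b) xs) \<subseteq> Obj (A \<otimes> B)" using assms(1) by auto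
    then show "H (ao (length xs) \<sigma> p, xs) = H (p, act_list \<sigma> xs)"
      using a oc_act[of p "map (\<lambda>a. UPair a b) xs" "A \<otimes> B" \<sigma>] by (simp add: H_def map_act_list)
  qed
  finally show ?thesis by (simp add: H_def)
qed

text \<open>With \<open>a\<close> fixed, inserting \<open>a\<close> into all entries does not
  respect composition, because composing would insert \<open>a\<close> after \<open>a\<close>. Hence
  \<open>H\<close> takes \<open>a\<close> as an argument, and \<open>M\<close> evaluates the later
  factor at \<open>a\<close> and the earlier one at the identity of its source.\<close>

lemma lstr_ac:
  assumes A: "category A" and B: "category B" and "a \<in> Arr A" "g \<in> arr (length zs)" "set zs \<subseteq> Arr B"
  shows "FA (lstr P A B) (UPair a (ac B (g, zs))) = ac (A \<otimes> B) (g, map (UPair a) zs)"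
proof -
  let ?AB = "A \<otimes> B"
  note AB = uprod_category[OF A B]
  \<comment> \<open>The value \<open>undefined\<close> outside \<open>Arr A\<close> makes the
    functions comparable as total functions, with something to check only for arrows of
    \<open>A\<close>.\<close>
  define H where "H = (\<lambda>(g, zs) a. if a \<in> Arr A then ac ?AB (g, map (UPair a) zs) else undefined)"
  have "FA (lstr P A B) (UPair a (ac B (g, zs))) = H (uterm (ac B (g, zs))) a"
    using assms(3) by (simp add: lstr_def H_def uterm_def)
  also have "H (uterm (ac B (g, zs))) = H (g, zs)"
  proof (rule ac_invariant[OF ac_uterm, where M = "\<lambda>G F a. if a \<in> Arr A then cmp (T ?AB) (G a) (F (idt A (src A a))) else undefined"])
    fix f ys \<sigma> assume a: "f \<in> arr (length ys)" "set ys \<subseteq> Arr B" "\<sigma> permutes {1..length ys}"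
    show "H (aa (length ys) \<sigma> f, ys) = H (f, act_list \<sigma> ys)"
    proof
      fix a
      have "a \<in> Arr A \<Longrightarrow> set (map (UPair a) ys) \<subseteq> Arr ?AB" using a by auto
      then show "H (aa (length ys) \<sigma> f, ys) a = H (f, act_list \<sigma> ys) a"
        using a ac_act[of f "map (UPair a) ys" "A \<otimes> B" \<sigma>] by (auto simp: H_def map_act_list)
    qed
  next
    fix f g assume a: "f \<in> Arr (C B)" "g \<in> Arr (C B)" "trg (C B) f = src (C B) g"
    obtain f' ys g' zs where [simp]: "f = (f', ys)" "g = (g', zs)" by (cases f, cases g) auto
    have l: "length ys = length zs" using a(3) by (auto dest: len_eq)
    have e: "\<forall>i<length ys. trg B (ys ! i) = src B (zs ! i)" using a(3) l by (auto simp: list_eq_iff_nth_eq)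
    show "H (cmp (C B) g f) = (\<lambda>a. if a \<in> Arr A then cmp (T ?AB) (H g a) (H f (idt A (src A a))) else undefined)"
    proof
      fix a
      show "H (cmp (C B) g f) a = (if a \<in> Arr A then cmp (T ?AB) (H g a) (H f (idt A (src A a))) else undefined)"
      proof (cases "a \<in> Arr A")
        case True
        note i = cat_idt[OF A cat_src_trg(1)[OF A True]]
        have "map (UPair a) (map2 (cmp B) zs ys) = map2 (cmp ?AB) (map (UPair a) zs) (map (UPair (idt A (src A a))) ys)"
          using l cat_cmp_idt[OF A True] by (intro nth_equalityI) auto
        moreover have "cmp (T ?AB) (ac ?AB (g', map (UPair a) zs)) (ac ?AB (f', map (UPair (idt A (src A a))) ys)) =
            ac ?AB (cmp (Op P (length (map (UPair (idt A (src A a))) ys))) g' f',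
              map2 (cmp ?AB) (map (UPair a) zs) (map (UPair (idt A (src A a))) ys))"
        proof (rule ac_cmp[OF AB])
          show "map (trg ?AB) (map (UPair (idt A (src A a))) ys) = map (src ?AB) (map (UPair a) zs)"
            using e l i by (intro nth_equalityI) auto
        qed (use True a l i in auto)
        ultimately show ?thesis using True i by (simp add: H_def)
      qed (simp add: H_def)
    qed
  qed
  finally show ?thesis using assms(3) by (simp add: H_def)
qed

lemma rstr_ac:
  assumes A: "category A" and B: "category B" and "b \<in> Arr B" "f \<in> arr (length ys)" "set ys \<subseteq> Arr A"
  shows "FA (rstr P A B) (UPair (ac A (f, ys)) b) = ac (A \<otimes> B) (f, map (\<lambda>a. UPair a b) ys)"
proof -
  let ?AB = "A \<otimes> B"
  note AB = uprod_category[OF A B]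
  define H where "H = (\<lambda>(g, zs) b. if b \<in> Arr B then ac ?AB (g, map (\<lambda>a. UPair a b) zs) else undefined)"
  have "FA (rstr P A B) (UPair (ac A (f, ys)) b) = H (uterm (ac A (f, ys))) b"
    using assms(3) by (simp add: rstr_def H_def uterm_def)
  also have "H (uterm (ac A (f, ys))) = H (f, ys)"
  proof (rule ac_invariant[OF ac_uterm, where M = "\<lambda>G F b. if b \<in> Arr B then cmp (T ?AB) (G b) (F (idt B (src B b))) else undefined"])
    fix f ys \<sigma> assume a: "f \<in> arr (length ys)" "set ys \<subseteq> Arr A" "\<sigma> permutes {1..length ys}"
    show "H (aa (length ys) \<sigma> f, ys) = H (f, act_list \<sigma> ys)"
    proof
      fix b
      have "b \<in> Arr B \<Longrightarrow> set (map (\<lambda>a. UPair a b) ys) \<subseteq> Arr ?AB" using a by auto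
      then show "H (aa (length ys) \<sigma> f, ys) b = H (f, act_list \<sigma> ys) b"
        using a ac_act[of f "map (\<lambda>a. UPair a b) ys" "A \<otimes> B" \<sigma>] by (auto simp: H_def map_act_list)
    qed
  next
    fix f g assume a: "f \<in> Arr (C A)" "g \<in> Arr (C A)" "trg (C A) f = src (C A) g"
    obtain f' ys g' zs where [simp]: "f = (f', ys)" "g = (g', zs)" by (cases f, cases g) auto
    have l: "length ys = length zs" using a(3) by (auto dest: len_eq)
    have e: "\<forall>i<length ys. trg A (ys ! i) = src A (zs ! i)" using a(3) l by (auto simp: list_eq_iff_nth_eq)
    show "H (cmp (C A) g f) = (\<lambda>b. if b \<in> Arr B then cmp (T ?AB) (H g b) (H f (idt B (src B b))) else undefined)"
    proof
      fix b
      show "H (cmp (C A) g f) b = (if b \<in> Arr B then cmp (T ?AB) (H g b) (H f (idt B (src B b))) else undefined)"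
      proof (cases "b \<in> Arr B")
        case True
        note i = cat_idt[OF B cat_src_trg(1)[OF B True]]
        have "map (\<lambda>a. UPair a b) (map2 (cmp A) zs ys) =
          map2 (cmp ?AB) (map (\<lambda>a. UPair a b) zs) (map (\<lambda>a. UPair a (idt B (src B b))) ys)"
          using l cat_cmp_idt[OF B True] by (intro nth_equalityI) auto
        moreover have "cmp (T ?AB) (ac ?AB (g', map (\<lambda>a. UPair a b) zs))
              (ac ?AB (f', map (\<lambda>a. UPair a (idt B (src B b))) ys)) =
            ac ?AB (cmp (Op P (length (map (\<lambda>a. UPair a (idt B (src B b))) ys))) g' f',
              map2 (cmp ?AB) (map (\<lambda>a. UPair a b) zs) (map (\<lambda>a. UPair a (idt B (src B b))) ys))"
        proof (rule ac_cmp[OF AB])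
          show "map (trg ?AB) (map (\<lambda>a. UPair a (idt B (src B b))) ys) = map (src ?AB) (map (\<lambda>a. UPair a b) zs)"
            using e l i by (intro nth_equalityI) auto
        qed (use True a l i in auto)
        ultimately show ?thesis using True i by (simp add: H_def)
      qed (simp add: H_def)
    qed
  qed
  finally show ?thesis using assms(3) by (simp add: H_def)
qed

section \<open>The multiplication of the 2-monad\<close>

lemma concat_map2_act_single:
  "concat (map2 act_list (replicate (length us) id @ \<sigma> # replicate (length vs) id) (us @ y # vs)) =
    concat us @ act_list \<sigma> y @ concat vs"
proof -
  have "map2 act_list (replicate (length us) id) us = us" for us :: "'b list list"
    by (induction us) (simp_all add: act_list_id[unfolded id_def])
  then show ?thesis by (simp add: zip_append)
qed

text \<open>The multiplication before passing to classes: an outer operation with a list of inner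
  terms. Independence of the inner representatives is \<open>muC_cong\<close>; that of the outer one
  is part of \<open>T_mu_ac\<close>.\<close>

definition muC :: "('o, 'a, 'x, 'y) ucat \<Rightarrow> 'a \<times> ('a \<times> ('a, 'y) univ list) list \<Rightarrow> ('a, 'y) univ" where
  "muC X = (\<lambda>(f, zs). ac X (ma (map (length \<circ> snd) zs) f (map fst zs), concat (map snd zs)))"

definition muO :: "('o, 'a, 'x, 'y) ucat \<Rightarrow> 'o \<times> ('o \<times> ('o, 'x) univ list) list \<Rightarrow> ('o, 'x) univ" where
  "muO X = (\<lambda>(p, zs). oc X (mo (map (length \<circ> snd) zs) p (map fst zs), concat (map snd zs)))"

lemma arrs_terms: "set zs \<subseteq> Arr (C X) \<Longrightarrow> arrs (map (length \<circ> snd) zs) (map fst zs)"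
  by (force simp: list_all2_conv_all_nth subset_iff dest: nth_mem)

lemma objs_terms: "set zs \<subseteq> Obj (C X) \<Longrightarrow> objs (map (length \<circ> snd) zs) (map fst zs)"
  by (force simp: list_all2_conv_all_nth subset_iff dest: nth_mem)

lemma muC_mem:
  assumes "f \<in> arr (length zs)" "set zs \<subseteq> Arr (C X)"
  shows "ma (map (length \<circ> snd) zs) f (map fst zs) \<in> arr (length (concat (map snd zs)))"
    "set (concat (map snd zs)) \<subseteq> Arr X"
proof -
  show "ma (map (length \<circ> snd) zs) f (map fst zs) \<in> arr (length (concat (map snd zs)))"
    using mu_arr(1)[OF _ arrs_terms[OF assms(2)], of f] assms(1) by (simp add: length_concat)
  show "set (concat (map snd zs)) \<subseteq> Arr X" using assms(2) by force
qed

lemma muO_mem: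
  assumes "p \<in> obj (length zs)" "set zs \<subseteq> Obj (C X)"
  shows "mo (map (length \<circ> snd) zs) p (map fst zs) \<in> obj (length (concat (map snd zs)))"
    "set (concat (map snd zs)) \<subseteq> Obj X"
proof -
  show "mo (map (length \<circ> snd) zs) p (map fst zs) \<in> obj (length (concat (map snd zs)))"
    using mu_obj[OF _ objs_terms[OF assms(2)], of p] assms(1) by (simp add: length_concat)
  show "set (concat (map snd zs)) \<subseteq> Obj X" using assms(2) by force
qed

text \<open>Functoriality of \<open>mu\<close> composes the operations. Composable inner terms have
  equal lengths, so concatenation commutes with composing the entries.\<close>

lemma muC_cmp:
  assumes X: "category X" and "f \<in> arr (length zs)" "set zs \<subseteq> Arr (C X)" "g \<in> arr (length zs)" "set ws \<subseteq> Arr (C X)"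
    "trg (Op P (length zs)) f = src (Op P (length zs)) g" "map (trg (C X)) zs = map (src (C X)) ws"
  shows "muC X (cmp (Op P (length zs)) g f, map2 (cmp (C X)) ws zs) = cmp (T X) (muC X (g, ws)) (muC X (f, zs))"
proof -
  have l: "length ws = length zs" using assms(7) by (metis length_map)
  have e: "trg (C X) (zs ! i) = src (C X) (ws ! i)" if "i < length zs" for i
    using assms(7) that l by (auto simp: list_eq_iff_nth_eq)
  have e': "length (snd (ws ! i)) = length (snd (zs ! i))"
    "trg (Op P (length (snd (zs ! i)))) (fst (zs ! i)) = src (Op P (length (snd (zs ! i)))) (fst (ws ! i))"
    "map (trg X) (snd (zs ! i)) = map (src X) (snd (ws ! i))"
    "fst (cmp (C X) (ws ! i) (zs ! i)) = cmp (Op P (length (snd (zs ! i)))) (fst (ws ! i)) (fst (zs ! i))"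
    "snd (cmp (C X) (ws ! i) (zs ! i)) = map2 (cmp X) (snd (ws ! i)) (snd (zs ! i))" if "i < length zs" for i
  proof -
    obtain a b c d where z: "zs ! i = (a, b)" "ws ! i = (c, d)" by (cases "zs ! i", cases "ws ! i") auto
    have "length d = length b" using e[OF that] z by (auto dest: len_eq)
    then show "length (snd (ws ! i)) = length (snd (zs ! i))"
    "trg (Op P (length (snd (zs ! i)))) (fst (zs ! i)) = src (Op P (length (snd (zs ! i)))) (fst (ws ! i))"
    "map (trg X) (snd (zs ! i)) = map (src X) (snd (ws ! i))"
    "fst (cmp (C X) (ws ! i) (zs ! i)) = cmp (Op P (length (snd (zs ! i)))) (fst (ws ! i)) (fst (zs ! i))"
    "snd (cmp (C X) (ws ! i) (zs ! i)) = map2 (cmp X) (snd (ws ! i)) (snd (zs ! i))"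
      using e[OF that] z by auto
  qed
  let ?ks = "map (length \<circ> snd) zs"
  have kw: "map (length \<circ> snd) ws = ?ks" using l e'(1) by (intro nth_equalityI) auto
  have kc: "map (length \<circ> snd) (map2 (cmp (C X)) ws zs) = ?ks" using l e'(1,5) by (intro nth_equalityI) auto
  have fc: "map fst (map2 (cmp (C X)) ws zs) = map2 (\<lambda>k (g', g). cmp (Op P k) g' g) ?ks (zip (map fst ws) (map fst zs))"
    using l e'(4) by (intro nth_equalityI) auto
  have sc: "concat (map snd (map2 (cmp (C X)) ws zs)) = map2 (cmp X) (concat (map snd ws)) (concat (map snd zs))"
    using l e'(1,5)
  proof (induction ws zs rule: list_induct2)
    case (Cons w ws z zs)
    have "concat (map snd (map2 (cmp (C X)) ws zs)) = map2 (cmp X) (concat (map snd ws)) (concat (map snd zs))"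
      by (rule Cons.IH) (use Cons.prems[of "Suc _"] in auto)
    then show ?case using Cons.prems[of 0] by simp
  qed simp
  have tc: "map (trg X) (concat (map snd zs)) = map (src X) (concat (map snd ws))"
    using l e'(3)
  proof (induction ws zs rule: list_induct2)
    case (Cons w ws z zs)
    have "map (trg X) (concat (map snd zs)) = map (src X) (concat (map snd ws))"
      by (rule Cons.IH) (use Cons.prems[of "Suc _"] in auto)
    then show ?case using Cons.prems[of 0] by simp
  qed simp
  have aw: "arrs ?ks (map fst ws)" using arrs_terms[OF assms(5)] kw by simp
  note az = arrs_terms[OF assms(3)]
  have t: "map2 (\<lambda>k. trg (Op P k)) ?ks (map fst zs) = map2 (\<lambda>k. src (Op P k)) ?ks (map fst ws)"
    using l e'(2) by (intro nth_equalityI) auto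
  have mc: "ma ?ks (cmp (Op P (length zs)) g f) (map2 (\<lambda>k (g', g). cmp (Op P k) g' g) ?ks (zip (map fst ws) (map fst zs))) =
    cmp (Op P (sum_list ?ks)) (ma ?ks g (map fst ws)) (ma ?ks f (map fst zs))"
    using mu_cmp[of f ?ks "map fst zs" g "map fst ws"] assms az aw t by simp
  have s: "sum_list ?ks = length (concat (map snd zs))" by (simp add: length_concat)
  have "cmp (T X) (ac X (ma ?ks g (map fst ws), concat (map snd ws))) (ac X (ma ?ks f (map fst zs), concat (map snd zs))) =
    ac X (cmp (Op P (length (concat (map snd zs)))) (ma ?ks g (map fst ws)) (ma ?ks f (map fst zs)),
      map2 (cmp X) (concat (map snd ws)) (concat (map snd zs)))"
  proof (rule ac_cmp[OF X])
    show "map (trg X) (concat (map snd zs)) = map (src X) (concat (map snd ws))" by (rule tc)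
    show "ma ?ks g (map fst ws) \<in> arr (length (concat (map snd zs)))" "ma ?ks f (map fst zs) \<in> arr (length (concat (map snd zs)))"
      "trg (Op P (length (concat (map snd zs)))) (ma ?ks f (map fst zs)) =
        src (Op P (length (concat (map snd zs)))) (ma ?ks g (map fst ws))"
      using mu_arr[of f ?ks "map fst zs"] mu_arr[of g ?ks "map fst ws"] assms az aw t unfolding s[symmetric] by simp_all
    show "set (concat (map snd zs)) \<subseteq> Arr X" "set (concat (map snd ws)) \<subseteq> Arr X" using assms(3,5) by force+
  qed
  then show ?thesis by (simp only: muC_def prod.case kw kc fc sc mc s)
qed

text \<open>\<open>arr_equiv\<close> is closed under composition, so the induction needs that composing at the entry \<open>z\<close>
  is a composition of whole terms, with identities at all other places.\<close>

lemma muC_single: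
  assumes X: "category X" and "ac X z = ac X w" "z \<in> Arr (C X)"
    and "f \<in> arr (length (us @ z # vs))" "set us \<subseteq> Arr (C X)" "set vs \<subseteq> Arr (C X)"
  shows "muC X (f, us @ z # vs) = muC X (f, us @ w # vs)"
proof -
  \<comment> \<open>\<open>K\<close> describes the admissible contexts of the entry under
    consideration. Outside \<open>K\<close> the functions below take the value
    \<open>undefined\<close>, so that they can be equated as total functions.\<close>
  define K where "K = (\<lambda>(f, us, vs). f \<in> arr (Suc (length us + length vs)) \<and> set us \<subseteq> Arr (C X) \<and> set vs \<subseteq> Arr (C X))"
  define H where "H = (\<lambda>z (f, us, vs). if K (f, us, vs) then muC X (f, us @ z # vs) else undefined)"
  define M where "M = (\<lambda>G F (f, us, vs). if K (f, us, vs) then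
     cmp (T X) (G (f, us, vs)) (F (idt (Op P (Suc (length us + length vs))) (src (Op P (Suc (length us + length vs))) f),
       map (\<lambda>u. idt (C X) (src (C X) u)) us, map (\<lambda>u. idt (C X) (src (C X) u)) vs)) else undefined)"
  note CX = C_category[OF X]
  have "H z = H w"
  proof (rule ac_invariant[OF assms(2), where M = M])
    fix g ys \<sigma> assume a: "g \<in> arr (length ys)" "set ys \<subseteq> Arr X" "\<sigma> permutes {1..length ys}"
    show "H (aa (length ys) \<sigma> g, ys) = H (g, act_list \<sigma> ys)"
    proof (rule ext, clarify)
      fix f us vs
      show "H (aa (length ys) \<sigma> g, ys) (f, us, vs) = H (g, act_list \<sigma> ys) (f, us, vs)"
      proof (cases "K (f, us, vs)")
        case True
        \<comment> \<open>A permutation of the entries of one inner term is a block sum with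
          identities on all other blocks.\<close>
        let ?zs = "us @ (g, ys) # vs" and ?\<tau>s = "replicate (length us) id @ \<sigma> # replicate (length vs) id"
        let ?ks = "map (length \<circ> snd) ?zs"
        have zs: "set ?zs \<subseteq> Arr (C X)" "f \<in> arr (length ?zs)" using True a by (auto simp: K_def)
        have p: "list_all2 (\<lambda>k \<tau>. \<tau> permutes {1..k}) ?ks ?\<tau>s"
          using a(3) by (auto simp: list_all2_conv_all_nth nth_append nth_Cons permutes_id split: nat.splits)
        have i: "map2 (\<lambda>k (\<tau>, q). aa k \<tau> q) (map (length \<circ> snd) us) (zip (replicate (length us) id) (map fst us)) = map fst us"
          if "set us \<subseteq> Arr (C X)" for us
          using that by (intro nth_equalityI) (force simp: act_id subset_iff dest: nth_mem)+
        have "map2 (\<lambda>k (\<tau>, q). aa k \<tau> q) ?ks (zip ?\<tau>s (map fst ?zs)) = map fst (us @ (aa (length ys) \<sigma> g, ys) # vs)"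
          using i[of us] i[of vs] True by (simp add: K_def)
        then have m: "ma ?ks f (map fst (us @ (aa (length ys) \<sigma> g, ys) # vs)) = aa (sum_list ?ks) (block_sum ?ks ?\<tau>s) (ma ?ks f (map fst ?zs))"
          using mu_act_inner(2)[OF p, of f "map fst ?zs"] zs(2) arrs_terms[OF zs(1)] by simp
        have s: "sum_list ?ks = length (concat (map snd ?zs))" by (simp add: length_concat)
        have "ac X (aa (sum_list ?ks) (block_sum ?ks ?\<tau>s) (ma ?ks f (map fst ?zs)), concat (map snd ?zs)) =
          ac X (ma ?ks f (map fst ?zs), act_list (block_sum ?ks ?\<tau>s) (concat (map snd ?zs)))"
          unfolding s using permutes_block_sum[OF p] muC_mem[OF zs(2,1)] by (intro ac_act) (simp_all only: s)
        also have "act_list (block_sum ?ks ?\<tau>s) (concat (map snd ?zs)) = concat (map2 act_list ?\<tau>s (map snd ?zs))"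
          by (rule act_list_block_sum) (use p in \<open>simp_all only: list_all2_map1 o_apply map_map\<close>)
        also have "\<dots> = concat (map snd (us @ (g, act_list \<sigma> ys) # vs))"
          using concat_map2_act_single[of "map snd us" \<sigma> "map snd vs" ys] by simp
        also have "ac X (ma ?ks f (map fst ?zs), \<dots>) = muC X (f, us @ (g, act_list \<sigma> ys) # vs)"
          by (simp add: muC_def)
        finally have "muC X (f, us @ (aa (length ys) \<sigma> g, ys) # vs) = muC X (f, us @ (g, act_list \<sigma> ys) # vs)"
          unfolding m[symmetric] by (simp add: muC_def)
        then show ?thesis by (simp add: H_def True)
      qed (simp add: H_def)
    qed
  next
    fix g h assume a: "g \<in> Arr (C X)" "h \<in> Arr (C X)" "trg (C X) g = src (C X) h"
    show "H (cmp (C X) h g) = M (H h) (H g)"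
    proof (rule ext, clarify)
      fix f us vs
      show "H (cmp (C X) h g) (f, us, vs) = M (H h) (H g) (f, us, vs)"
      proof (cases "K (f, us, vs)")
        case True
        let ?i = "\<lambda>u. idt (C X) (src (C X) u)"
        let ?n = "Suc (length us + length vs)"
        let ?f = "idt (Op P ?n) (src (Op P ?n) f)"
        have f: "f \<in> arr ?n" "set us \<subseteq> Arr (C X)" "set vs \<subseteq> Arr (C X)" using True by (auto simp: K_def)
        have i: "u \<in> Arr (C X) \<Longrightarrow> ?i u \<in> Arr (C X) \<and> trg (C X) (?i u) = src (C X) u \<and> cmp (C X) u (?i u) = u" for u
          using cat_idt[OF CX cat_src_trg(1)[OF CX]] cat_cmp_idt(1)[OF CX] by blast
        have fi: "?f \<in> arr ?n" "trg (Op P ?n) ?f = src (Op P ?n) f" "cmp (Op P ?n) f ?f = f"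
          using cat_idt[OF cat cat_src_trg(1)[OF cat f(1)]] cat_cmp_idt(1)[OF cat f(1)] by auto
        have c: "map2 (cmp (C X)) us (map ?i us) = us" if "set us \<subseteq> Arr (C X)" for us
        proof (rule nth_equalityI)
          fix k assume k: "k < length (map2 (cmp (C X)) us (map ?i us))"
          then have "us ! k \<in> Arr (C X)" using that by auto
          then show "map2 (cmp (C X)) us (map ?i us) ! k = us ! k" using i[of "us ! k"] k by simp
        qed simp
        have t: "map (trg (C X)) (map ?i us) = map (src (C X)) us" if "set us \<subseteq> Arr (C X)" for us
          unfolding map_map o_def by (rule map_cong[OF HOL.refl], rule i[THEN conjunct2, THEN conjunct1], rule subsetD[OF that])
        have "muC X (cmp (Op P (length (map ?i us @ g # map ?i vs))) f ?f, map2 (cmp (C X)) (us @ h # vs) (map ?i us @ g # map ?i vs)) =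
          cmp (T X) (muC X (f, us @ h # vs)) (muC X (?f, map ?i us @ g # map ?i vs))"
        proof (rule muC_cmp[OF X])
          show "map (trg (C X)) (map ?i us @ g # map ?i vs) = map (src (C X)) (us @ h # vs)"
            using t[OF f(2)] t[OF f(3)] a(3) by simp
          show "set (map ?i us @ g # map ?i vs) \<subseteq> Arr (C X)" "set (us @ h # vs) \<subseteq> Arr (C X)"
            unfolding set_append list.set set_map using f(2,3) a(1,2) i[THEN conjunct1, OF subsetD, OF f(2)]
              i[THEN conjunct1, OF subsetD, OF f(3)] by blast+
        qed (use f fi in simp_all)
        moreover have "map2 (cmp (C X)) (us @ h # vs) (map ?i us @ g # map ?i vs) = us @ cmp (C X) h g # vs"
          using c[OF f(2)] c[OF f(3)] by simp
        moreover have "K (?f, map ?i us, map ?i vs)" unfolding K_def prod.case length_map set_map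
          using fi(1) i[THEN conjunct1, OF subsetD, OF f(2)] i[THEN conjunct1, OF subsetD, OF f(3)] by blast
        ultimately show ?thesis using True fi by (simp add: H_def M_def)
      qed (simp add: H_def M_def)
    qed
  qed
  then have "H z (f, us, vs) = H w (f, us, vs)" by simp
  moreover have "K (f, us, vs)" using assms(4-6) by (simp add: K_def)
  ultimately show ?thesis by (simp add: H_def)
qed

text \<open>The inner terms are replaced one at a time from the left by \<open>muC_single\<close>.
  Those already replaced have moved into the prefix \<open>us\<close>, over which the induction
  generalizes.\<close>

lemma muC_cong:
  assumes X: "category X" and "list_all2 (\<lambda>z w. ac X z = ac X w) zs ws" "set zs \<subseteq> Arr (C X)" "f \<in> arr (length zs)"
  shows "muC X (f, zs) = muC X (f, ws)"
proof -
  have "muC X (f, us @ zs) = muC X (f, us @ ws)"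
    if "set us \<subseteq> Arr (C X)" "f \<in> arr (length (us @ zs))" "set zs \<subseteq> Arr (C X)" for us
    using assms(2) that
  proof (induction arbitrary: us rule: list_all2_induct)
    case (Cons z zs w ws)
    have "muC X (f, us @ z # zs) = muC X (f, us @ w # zs)"
      using Cons.prems Cons.hyps by (intro muC_single[OF X]) auto
    also have "\<dots> = muC X (f, (us @ [w]) @ zs)" by simp
    also have "\<dots> = muC X (f, (us @ [w]) @ ws)"
      using Cons.prems ac_carrier[OF X Cons.hyps(1)] by (intro Cons.IH) auto
    finally show ?case by simp
  qed simp
  from this[of "[]"] show ?thesis using assms by simp
qed

lemma muC_idt:
  assumes X: "category X" and "p \<in> obj (length zs)" "set zs \<subseteq> Obj (C X)"
  shows "muC X (idt (Op P (length zs)) p, map (idt (C X)) zs) = idt (T X) (muO X (p, zs))"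
proof -
  have k: "map (length \<circ> snd) (map (idt (C X)) zs) = map (length \<circ> snd) zs"
    "concat (map snd (map (idt (C X)) zs)) = map (idt X) (concat (map snd zs))"
    "map fst (map (idt (C X)) zs) = map2 (\<lambda>k. idt (Op P k)) (map (length \<circ> snd) zs) (map fst zs)"
    by (induction zs) (auto simp: terms_cat_def)
  show ?thesis
    using mu_idt[of p "map (length \<circ> snd) zs", OF _ objs_terms[OF assms(3)]] assms(2) muO_mem[OF assms(2,3)]
    unfolding muC_def muO_def prod.case k by (subst T_simps(3)[OF X]) (simp_all add: length_concat)
qed

text \<open>Follows from the arrow version: equivalent objects have equivalent identities, the
  multiplication sends identities to identities, and an identity determines its object as its
  source.\<close>

lemma muO_cong:
  assumes X: "category X" and "list_all2 (\<lambda>z w. oc X z = oc X w) zs ws" "set zs \<subseteq> Obj (C X)" "p \<in> obj (length zs)"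
  shows "muO X (p, zs) = muO X (p, ws)"
proof -
  have l: "length ws = length zs" using assms(2) list_all2_lengthD by force
  have ws: "set ws \<subseteq> Obj (C X)"
  proof
    fix w assume "w \<in> set ws"
    then obtain i where i: "i < length zs" "w = ws ! i" using l unfolding in_set_conv_nth by metis
    have "oc X (zs ! i) = oc X (ws ! i)" using list_all2_nthD[OF assms(2) i(1)] .
    then show "w \<in> Obj (C X)" unfolding i(2) by (rule oc_carrier[OF X _ subsetD[OF assms(3) nth_mem[OF i(1)]]])
  qed
  have "list_all2 (\<lambda>z w. ac X z = ac X w) (map (idt (C X)) zs) (map (idt (C X)) ws)"
    unfolding list_all2_map1 list_all2_map2
  proof (rule list_all2_all_nthI)
    fix i assume i: "i < length zs"
    have "obj_equiv P X (zs ! i) (ws ! i)" using list_all2_nthD[OF assms(2) i] ocls_eq_iff by blast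
    then show "ac X (idt (C X) (zs ! i)) = ac X (idt (C X) (ws ! i))"
      unfolding acls_eq_iff using subsetD[OF assms(3) nth_mem[OF i]]
      by (rule operad_on_category.oeq_idt[OF operad_on_category[OF X]])
  qed (simp add: l)
  moreover have "set (map (idt (C X)) zs) \<subseteq> Arr (C X)"
    unfolding set_map using cat_idt(1)[OF C_category[OF X]] assms(3) by blast
  moreover have "idt (Op P (length zs)) p \<in> arr (length zs)" using cat_idt(1)[OF cat assms(4)] .
  ultimately have "muC X (idt (Op P (length zs)) p, map (idt (C X)) zs) = muC X (idt (Op P (length zs)) p, map (idt (C X)) ws)"
    by (intro muC_cong[OF X]) (simp_all only: length_map)
  then have "idt (T X) (muO X (p, zs)) = idt (T X) (muO X (p, ws))"
    using muC_idt[OF X assms(4,3)] muC_idt[OF X _ ws, of p] assms(4) l by simp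
  moreover have "muO X (p, zs) \<in> Obj (T X)" "muO X (p, ws) \<in> Obj (T X)"
    using muO_mem[OF assms(4,3)] muO_mem[OF _ ws, of p] assms(4) l by (auto simp: muO_def)
  ultimately show ?thesis using cat_idt(2)[OF T_category[OF X]] by metis
qed

text \<open>A permutation of the outer term becomes, by outer equivariance, a block permutation of
  the concatenated entries, hence an orbit step for the result. The inner representatives are dealt
  with by \<open>muO_cong\<close>.\<close>

lemma T_mu_oc:
  assumes X: "category X" and "p \<in> obj (length zs)" "set zs \<subseteq> Obj (C X)"
  shows "FO (T_mu P X) (oc (T X) (p, map (oc X) zs)) = muO X (p, zs)"
proof -
  define H where "H = (\<lambda>(p, ts). muO X (p, map uterm ts))"
  have "FO (T_mu P X) (oc (T X) (p, map (oc X) zs)) = H (uterm (oc (T X) (p, map (oc X) zs)))"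
    by (simp add: T_mu_def H_def muO_def uterm_def o_def)
  also have "\<dots> = H (p, map (oc X) zs)"
  proof (rule oc_invariant[OF oc_uterm])
    fix p ts \<sigma> assume a: "p \<in> obj (length ts)" "set ts \<subseteq> Obj (T X)" "\<sigma> permutes {1..length ts}"
    let ?zs = "map uterm ts"
    let ?ks = "map (length \<circ> snd) ?zs"
    have zs: "set ?zs \<subseteq> Obj (C X)"
      using a(2) oc_carrier[OF X, of _ "uterm _"] by (auto simp: Tcat_def oc_uterm)
    note m = objs_terms[OF zs]
    have s: "sum_list ?ks = length (concat (map snd ?zs))" by (simp add: length_concat o_def)
    have l: "length ?ks = length ts" by simp
    have k: "map (length \<circ> snd) (act_list \<sigma> ?zs) = act_list \<sigma> ?ks" "map fst (act_list \<sigma> ?zs) = act_list \<sigma> (map fst ?zs)"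
      "map snd (act_list \<sigma> ?zs) = act_list \<sigma> (map snd ?zs)" "map uterm (act_list \<sigma> ts) = act_list \<sigma> ?zs"
      using a(3) by (simp_all add: map_act_list)
    have p: "block_perm ?ks \<sigma> permutes {1..length (concat (map snd ?zs))}"
      using permutes_block_perm[of \<sigma> ?ks] a(3) unfolding s l by simp
    have za: "set (act_list \<sigma> ?zs) \<subseteq> Obj (C X)" using zs set_act_list[of \<sigma> ?zs] a(3) by simp
    have "length (concat (map snd (act_list \<sigma> ?zs))) = length (concat (map snd ?zs))"
      using sum_list_act_list[of \<sigma> ?ks] a(3) k by (simp add: length_concat o_def map_act_list)
    then have "mo (act_list \<sigma> ?ks) p (act_list \<sigma> (map fst ?zs)) \<in> obj (length (concat (map snd ?zs)))"
      using muO_mem(1)[OF _ za, of p] a(1) k by simp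
    then have "oc X (ao (length (concat (map snd ?zs))) (block_perm ?ks \<sigma>) (mo (act_list \<sigma> ?ks) p (act_list \<sigma> (map fst ?zs))), concat (map snd ?zs)) =
      oc X (mo (act_list \<sigma> ?ks) p (act_list \<sigma> (map fst ?zs)), act_list (block_perm ?ks \<sigma>) (concat (map snd ?zs)))"
      using p muO_mem(2)[OF _ zs, of p] a(1) by (intro oc_act) simp_all
    also have "act_list (block_perm ?ks \<sigma>) (concat (map snd ?zs)) = concat (act_list \<sigma> (map snd ?zs))"
      using a(3) by (intro act_list_block_perm) (simp_all add: o_def)
    finally show "H (ao (length ts) \<sigma> p, ts) = H (p, act_list \<sigma> ts)"
      unfolding H_def muO_def prod.case k mu_act_outer(1)[of \<sigma> ?ks p "map fst ?zs", unfolded s l, OF a(3,1) m] .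
  qed
  also have "\<dots> = muO X (p, zs)"
    unfolding H_def prod.case
    by (rule muO_cong[OF X, symmetric]) (use assms in \<open>auto simp: list_all2_conv_all_nth oc_uterm\<close>)
  finally show ?thesis .
qed

lemma T_mu_ac:
  assumes X: "category X" and "f \<in> arr (length zs)" "set zs \<subseteq> Arr (C X)"
  shows "FA (T_mu P X) (ac (T X) (f, map (ac X) zs)) = muC X (f, zs)"
proof -
  define H where "H = (\<lambda>(p, ts). muC X (p, map uterm ts))"
  have uC: "uterm t \<in> Arr (C X)" "ac X (uterm t) = t" if "t \<in> Arr (T X)" for t
    using that ac_carrier[OF X, of _ "uterm _"] by (auto simp: Tcat_def ac_uterm)
  have "FA (T_mu P X) (ac (T X) (f, map (ac X) zs)) = H (uterm (ac (T X) (f, map (ac X) zs)))"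
    by (simp add: T_mu_def H_def muC_def uterm_def o_def)
  also have "\<dots> = H (f, map (ac X) zs)"
  proof (rule ac_invariant[OF ac_uterm, where M = "cmp (T X)"])
    fix p ts \<sigma> assume a: "p \<in> arr (length ts)" "set ts \<subseteq> Arr (T X)" "\<sigma> permutes {1..length ts}"
    let ?zs = "map uterm ts"
    let ?ks = "map (length \<circ> snd) ?zs"
    have zs: "set ?zs \<subseteq> Arr (C X)" using a(2) uC(1) by auto
    note m = arrs_terms[OF zs]
    have s: "sum_list ?ks = length (concat (map snd ?zs))" by (simp add: length_concat o_def)
    have l: "length ?ks = length ts" by simp
    have k: "map (length \<circ> snd) (act_list \<sigma> ?zs) = act_list \<sigma> ?ks" "map fst (act_list \<sigma> ?zs) = act_list \<sigma> (map fst ?zs)"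
      "map snd (act_list \<sigma> ?zs) = act_list \<sigma> (map snd ?zs)" "map uterm (act_list \<sigma> ts) = act_list \<sigma> ?zs"
      using a(3) by (simp_all add: map_act_list)
    have p: "block_perm ?ks \<sigma> permutes {1..length (concat (map snd ?zs))}"
      using permutes_block_perm[of \<sigma> ?ks] a(3) unfolding s l by simp
    have za: "set (act_list \<sigma> ?zs) \<subseteq> Arr (C X)" using zs set_act_list[of \<sigma> ?zs] a(3) by simp
    have "length (concat (map snd (act_list \<sigma> ?zs))) = length (concat (map snd ?zs))"
      using sum_list_act_list[of \<sigma> ?ks] a(3) k by (simp add: length_concat o_def map_act_list)
    then have "ma (act_list \<sigma> ?ks) p (act_list \<sigma> (map fst ?zs)) \<in> arr (length (concat (map snd ?zs)))"
      using muC_mem(1)[OF _ za, of p] a(1) k by simp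
    then have "ac X (aa (length (concat (map snd ?zs))) (block_perm ?ks \<sigma>) (ma (act_list \<sigma> ?ks) p (act_list \<sigma> (map fst ?zs))), concat (map snd ?zs)) =
      ac X (ma (act_list \<sigma> ?ks) p (act_list \<sigma> (map fst ?zs)), act_list (block_perm ?ks \<sigma>) (concat (map snd ?zs)))"
      using p muC_mem(2)[OF _ zs, of p] a(1) by (intro ac_act) simp_all
    also have "act_list (block_perm ?ks \<sigma>) (concat (map snd ?zs)) = concat (act_list \<sigma> (map snd ?zs))"
      using a(3) by (intro act_list_block_perm) (simp_all add: o_def)
    finally show "H (aa (length ts) \<sigma> p, ts) = H (p, act_list \<sigma> ts)"
      unfolding H_def muC_def prod.case k mu_act_outer(2)[of \<sigma> ?ks p "map fst ?zs", unfolded s l, OF a(3,1) m] .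
  next
    fix F G assume a: "F \<in> Arr (C (T X))" "G \<in> Arr (C (T X))" "trg (C (T X)) F = src (C (T X)) G"
    obtain f ss g ts where FG: "F = (f, ss)" "G = (g, ts)" by (cases F, cases G) auto
    have l: "length ts = length ss" using a(3) FG by (auto dest: len_eq)
    have f: "f \<in> arr (length ss)" "g \<in> arr (length ss)" "trg (Op P (length ss)) f = src (Op P (length ss)) g"
      and st: "set ss \<subseteq> Arr (T X)" "set ts \<subseteq> Arr (T X)" "map (trg (T X)) ss = map (src (T X)) ts"
      using a FG l by auto
    \<comment> \<open>The inner classes are composable, but the target of one chosen representative
      is only equivalent to the source of the next. \<open>T_lift\<close> exchanges the
      representative of \<open>ts ! i\<close> for one that composes strictly with that of
      \<open>ss ! i\<close>.\<close>
    have "\<exists>z. ac X z = ts ! i \<and> z \<in> Arr (C X) \<and> trg (C X) (uterm (ss ! i)) = src (C X) z" if i: "i < length ss" for i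
    proof -
      have m: "ss ! i \<in> Arr (T X)" "ts ! i \<in> Arr (T X)" using st(1,2) i l nth_mem by (metis subsetD)+
      have "trg (T X) (ss ! i) = src (T X) (ts ! i)" using st(3) i l by (metis nth_map)
      from T_lift[OF X m this uC(2)[OF m(1), symmetric] uC(1)[OF m(1)]] show ?thesis by metis
    qed
    then obtain w where w: "\<And>i. i < length ss \<Longrightarrow> ac X (w i) = ts ! i \<and> w i \<in> Arr (C X) \<and> trg (C X) (uterm (ss ! i)) = src (C X) (w i)"
      by metis
    define ws where "ws = map w [0..<length ss]"
    have ws: "length ws = length ss" "\<And>i. i < length ss \<Longrightarrow> ac X (ws ! i) = ts ! i"
      "\<And>i. i < length ss \<Longrightarrow> ws ! i \<in> Arr (C X)" "\<And>i. i < length ss \<Longrightarrow> trg (C X) (uterm (ss ! i)) = src (C X) (ws ! i)"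
      using w by (simp_all add: ws_def)
    have sws: "set ws \<subseteq> Arr (C X)" using ws(1,3) by (metis in_set_conv_nth subsetI)
    have us: "set (map uterm ss) \<subseteq> Arr (C X)" "set (map uterm ts) \<subseteq> Arr (C X)" using st uC(1) by auto
    have ssi: "ss ! i \<in> Arr (T X)" "ts ! i \<in> Arr (T X)" if "i < length ss" for i using st(1,2) that l nth_mem by (metis subsetD)+
    have cmps: "cmp (C X) (ws ! i) (uterm (ss ! i)) \<in> Arr (C X)"
      "ac X (cmp (C X) (ws ! i) (uterm (ss ! i))) = cmp (T X) (ts ! i) (ss ! i)" if i: "i < length ss" for i
    proof -
      note c = uC[OF ssi(1)[OF i]]
      show "cmp (C X) (ws ! i) (uterm (ss ! i)) \<in> Arr (C X)" by (rule cat_cmp(1)[OF C_category[OF X] c(1) ws(3,4)[OF i]])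
      show "ac X (cmp (C X) (ws ! i) (uterm (ss ! i))) = cmp (T X) (ts ! i) (ss ! i)"
        using T_cmp[OF X c(1) ws(3,4)[OF i]] ws(2)[OF i] c(2) by simp
    qed
    have "H (cmp (C (T X)) G F) = muC X (cmp (Op P (length ss)) g f, map uterm (map2 (cmp (T X)) ts ss))"
      by (simp add: H_def FG)
    \<comment> \<open>The representative chosen for a composite need not be the composite of
      representatives; \<open>muC_cong\<close> bridges the difference.\<close>
    also have "\<dots> = muC X (cmp (Op P (length ss)) g f, map2 (cmp (C X)) ws (map uterm ss))"
    proof (rule muC_cong[OF X, symmetric])
      show "list_all2 (\<lambda>z w. ac X z = ac X w) (map2 (cmp (C X)) ws (map uterm ss)) (map uterm (map2 (cmp (T X)) ts ss))"
      proof (rule list_all2_all_nthI)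
        fix i assume "i < length (map2 (cmp (C X)) ws (map uterm ss))"
        then have i: "i < length ss" by simp
        have "cmp (T X) (ts ! i) (ss ! i) \<in> Arr (T X)"
          using T_mem(2)[OF cmps(1)[OF i]] cmps(2)[OF i] by simp
        then show "ac X (map2 (cmp (C X)) ws (map uterm ss) ! i) = ac X (map uterm (map2 (cmp (T X)) ts ss) ! i)"
          using i l ws(1) cmps(2)[OF i] uC(2) by simp
      qed (simp add: l ws(1))
      show "set (map2 (cmp (C X)) ws (map uterm ss)) \<subseteq> Arr (C X)"
      proof
        fix z assume "z \<in> set (map2 (cmp (C X)) ws (map uterm ss))"
        then obtain i where "i < length ss" "z = cmp (C X) (ws ! i) (uterm (ss ! i))"
          using ws(1) by (auto simp: set_zip)
        then show "z \<in> Arr (C X)" using cmps(1) by simp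
      qed
      show "cmp (Op P (length ss)) g f \<in> arr (length (map2 (cmp (C X)) ws (map uterm ss)))"
        using cat_cmp(1)[OF cat f] ws(1) by simp
    qed
    also have "\<dots> = cmp (T X) (muC X (g, ws)) (muC X (f, map uterm ss))"
    proof -
      have "map (trg (C X)) (map uterm ss) = map (src (C X)) ws"
        using ws by (intro nth_equalityI) simp_all
      from muC_cmp[OF X _ us(1) _ sws _ this, of f g] f show ?thesis by simp
    qed
    also have "muC X (g, ws) = muC X (g, map uterm ts)"
      using ws l uC(2) ssi(2) f(2) sws by (intro muC_cong[OF X] list_all2_all_nthI) simp_all
    finally show "H (cmp (C (T X)) G F) = cmp (T X) (H G) (H F)"
      by (simp add: H_def FG)
  qed
  also have "\<dots> = muC X (f, zs)"
    unfolding H_def prod.case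
  proof (rule muC_cong[OF X, symmetric])
    show "list_all2 (\<lambda>z w. ac X z = ac X w) zs (map uterm (map (ac X) zs))"
      by (simp add: list_all2_conv_all_nth ac_uterm)
  qed (use assms in simp_all)
  finally show ?thesis .
qed

end

subsection \<open>The pseudo-commutativity of the induced 2-monad\<close>

context operad_in_Cat
begin

text \<open>The arrow \<open>[f; 1, \<dots>, 1]\<close>; all components of \<open>\<gamma>\<close> and of its whiskerings have this form.\<close>

definition sarr :: "('o, 'a, 'x, 'y) ucat \<Rightarrow> 'a \<Rightarrow> ('o, 'x) univ list \<Rightarrow> ('a, 'y) univ" where
  "sarr X f xs = ac X (f, map (idt X) xs)"

lemma map_idt_mem: "category X \<Longrightarrow> set xs \<subseteq> Obj X \<Longrightarrow> set (map (idt X) xs) \<subseteq> Arr X"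
  using cat_idt(1) by fastforce

lemma map_idt_src_trg:
  assumes "category X" "set xs \<subseteq> Obj X"
  shows "map (src X) (map (idt X) xs) = xs" "map (trg X) (map (idt X) xs) = xs"
  using assms by (auto simp: o_def subset_iff cat_idt intro!: map_idI)

lemma sarr_mem: "category X \<Longrightarrow> f \<in> arr (length xs) \<Longrightarrow> set xs \<subseteq> Obj X \<Longrightarrow> sarr X f xs \<in> Arr (T X)"
  using map_idt_mem[of X xs] by (simp add: sarr_def)

lemma sarr_src_trg:
  assumes X: "category X" and "f \<in> arr (length xs)" "set xs \<subseteq> Obj X"
  shows "src (T X) (sarr X f xs) = oc X (src (Op P (length xs)) f, xs)"
    "trg (T X) (sarr X f xs) = oc X (trg (Op P (length xs)) f, xs)"
  using assms ac_src_trg[OF X, of f "map (idt X) xs"] map_idt_mem[OF X assms(3)] map_idt_src_trg[OF X assms(3)]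
  by (simp_all add: sarr_def)

lemma sarr_act:
  assumes X: "category X" and "f \<in> arr (length xs)" "set xs \<subseteq> Obj X" "\<sigma> permutes {1..length xs}"
  shows "sarr X (aa (length xs) \<sigma> f) xs = sarr X f (act_list \<sigma> xs)"
  using assms ac_act[of f "map (idt X) xs" X \<sigma>] map_idt_mem[OF X assms(3)]
  by (simp add: sarr_def map_act_list)

lemma sarr_idt: "category X \<Longrightarrow> p \<in> obj (length xs) \<Longrightarrow> set xs \<subseteq> Obj X \<Longrightarrow>
    idt (T X) (oc X (p, xs)) = sarr X (idt (Op P (length xs)) p) xs"
  by (subst T_simps(3)) (simp_all add: sarr_def)

text \<open>The entries \<open>ys\<close> are composed with identities only. With
  \<open>sarr_cmp_right\<close> this treats the two sides of the naturality square of
  \<gamma>.\<close>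

lemma sarr_cmp_left:
  assumes X: "category X" and "f \<in> hom n p q" "g \<in> hom n q r" "n = length ys" "set ys \<subseteq> Arr X"
  shows "cmp (T X) (sarr X g (map (trg X) ys)) (ac X (f, ys)) = ac X (cmp (Op P n) g f, ys)"
proof -
  have o: "set (map (trg X) ys) \<subseteq> Obj X" using assms(5) cat_src_trg[OF X] by auto
  have "cmp (T X) (ac X (g, map (idt X) (map (trg X) ys))) (ac X (f, ys)) =
    ac X (cmp (Op P (length ys)) g f, map2 (cmp X) (map (idt X) (map (trg X) ys)) ys)"
    by (rule ac_cmp[OF X]) (use assms map_idt_mem[OF X o] map_idt_src_trg[OF X o] in \<open>simp_all add: hom_def\<close>)
  then show ?thesis using map2_idt_r[OF X assms(5)] by (simp add: sarr_def assms(4))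
qed

lemma sarr_cmp_right:
  assumes X: "category X" and "f \<in> hom n p q" "g \<in> hom n q r" "n = length ys" "set ys \<subseteq> Arr X"
  shows "cmp (T X) (ac X (g, ys)) (sarr X f (map (src X) ys)) = ac X (cmp (Op P n) g f, ys)"
proof -
  have o: "set (map (src X) ys) \<subseteq> Obj X" using assms(5) cat_src_trg[OF X] by auto
  have "cmp (T X) (ac X (g, ys)) (ac X (f, map (idt X) (map (src X) ys))) =
    ac X (cmp (Op P (length (map (idt X) (map (src X) ys)))) g f, map2 (cmp X) ys (map (idt X) (map (src X) ys)))"
    by (rule ac_cmp[OF X]) (use assms map_idt_mem[OF X o] map_idt_src_trg[OF X o] in \<open>simp_all add: hom_def\<close>)
  then show ?thesis using map2_idt_l[OF X assms(5)] by (simp add: sarr_def assms(4))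
qed

lemma sarr_cmp:
  assumes X: "category X" and "f \<in> hom n p q" "g \<in> hom n q r" "n = length xs" "set xs \<subseteq> Obj X"
  shows "cmp (T X) (sarr X g xs) (sarr X f xs) = sarr X (cmp (Op P n) g f) xs"
  using sarr_cmp_left[OF X assms(2,3), of "map (idt X) xs"] assms map_idt_mem[OF X] map_idt_src_trg[OF X]
  by (simp add: sarr_def del: map_map)

lemma T_fun_sarr:
  assumes "category X" "category Y" "is_functor X Y F" "f \<in> arr (length xs)" "set xs \<subseteq> Obj X"
  shows "FA (T_fun P Y F) (sarr X f xs) = sarr Y f (map (FO F) xs)"
proof -
  have "map (FA F) (map (idt X) xs) = map (idt Y) (map (FO F) xs)"
    using assms(5) is_functorD(2)[OF assms(3)] by auto
  then show ?thesis
    using T_fun_ac[OF assms(2,3), of f "map (idt X) xs"] assms map_idt_mem[of X xs] by (simp add: sarr_def del: map_map)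
qed

lemma lstr_sarr:
  assumes "category A" "category B" "a \<in> Obj A" "g \<in> arr (length bs)" "set bs \<subseteq> Obj B"
  shows "FA (lstr P A B) (UPair (idt A a) (sarr B g bs)) = sarr (A \<otimes> B) g (map (UPair a) bs)"
  using assms map_idt_mem[of B bs] by (simp add: sarr_def lstr_ac cat_idt o_def)

lemma rstr_sarr:
  assumes "category A" "category B" "b \<in> Obj B" "f \<in> arr (length as)" "set as \<subseteq> Obj A"
  shows "FA (rstr P A B) (UPair (sarr A f as) (idt B b)) = sarr (A \<otimes> B) f (map (\<lambda>a. UPair a b) as)"
  using assms map_idt_mem[of A as] by (simp add: sarr_def rstr_ac cat_idt o_def)

lemma T_mu_oc_map:
  assumes "category X" "p \<in> obj (length is)"
    and "\<And>i. i \<in> set is \<Longrightarrow> q i \<in> obj (length (xs i)) \<and> set (xs i) \<subseteq> Obj X"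
  shows "FO (T_mu P X) (oc (T X) (p, map (\<lambda>i. oc X (q i, xs i)) is)) =
    oc X (mo (map (\<lambda>i. length (xs i)) is) p (map q is), concat (map xs is))"
  using T_mu_oc[of X p "map (\<lambda>i. (q i, xs i)) is"] assms by (simp add: muO_def o_def image_subset_iff)

lemma T_mu_ac_map:
  assumes "category X" "f \<in> arr (length is)"
    and "\<And>i. i \<in> set is \<Longrightarrow> g i \<in> arr (length (ys i)) \<and> set (ys i) \<subseteq> Arr X"
  shows "FA (T_mu P X) (ac (T X) (f, map (\<lambda>i. ac X (g i, ys i)) is)) =
    ac X (ma (map (\<lambda>i. length (ys i)) is) f (map g is), concat (map ys is))"
  using T_mu_ac[of X f "map (\<lambda>i. (g i, ys i)) is"] assms by (simp add: muC_def o_def image_subset_iff)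

lemma T_mu_sarr_map:
  assumes X: "category X" and "f \<in> arr (length is)"
    and "\<And>i. i \<in> set is \<Longrightarrow> g i \<in> arr (length (xs i)) \<and> set (xs i) \<subseteq> Obj X"
  shows "FA (T_mu P X) (ac (T X) (f, map (\<lambda>i. sarr X (g i) (xs i)) is)) =
    sarr X (ma (map (\<lambda>i. length (xs i)) is) f (map g is)) (concat (map xs is))"
  using T_mu_ac_map[OF X assms(2), of g "\<lambda>i. map (idt X) (xs i)"] assms map_idt_mem[OF X]
  by (simp add: sarr_def map_concat o_def)

lemma lstr_functor:
  assumes A: "category A" and B: "category B"
  shows "is_functor (A \<otimes> T B) (T (A \<otimes> B)) (lstr P A B)"
  unfolding is_functor_def
proof (intro conjI ballI impI)
  note AB = uprod_category[OF A B]
  fix z assume "z \<in> Obj (A \<otimes> T B)"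
  then obtain a p bs where z: "z = UPair a (oc B (p, bs))" "a \<in> Obj A" "p \<in> obj (length bs)" "set bs \<subseteq> Obj B"
    by (metis uprod_objE T_objE)
  have s: "set (map (UPair a) bs) \<subseteq> Obj (A \<otimes> B)" using z by auto
  show "FO (lstr P A B) z \<in> Obj (T (A \<otimes> B))" using z s by (simp add: lstr_oc)
  show "FA (lstr P A B) (idt (A \<otimes> T B) z) = idt (T (A \<otimes> B)) (FO (lstr P A B) z)"
    using z s sarr_idt[OF AB, of p "map (UPair a) bs"] by (simp add: lstr_oc sarr_idt[OF B] lstr_sarr[OF A B] cat_idt[OF cat])
next
  note AB = uprod_category[OF A B]
  fix z assume "z \<in> Arr (A \<otimes> T B)"
  then obtain a f ys where z: "z = UPair a (ac B (f, ys))" "a \<in> Arr A" "f \<in> arr (length ys)" "set ys \<subseteq> Arr B"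
    by (metis uprod_arrE T_arrE)
  have s: "set (map (UPair a) ys) \<subseteq> Arr (A \<otimes> B)" using z by auto
  have o: "set (map (src B) ys) \<subseteq> Obj B" "set (map (trg B) ys) \<subseteq> Obj B" using z cat_src_trg[OF B] by auto
  show "FA (lstr P A B) z \<in> Arr (T (A \<otimes> B))" using z s by (simp add: lstr_ac[OF A B])
  show "src (T (A \<otimes> B)) (FA (lstr P A B) z) = FO (lstr P A B) (src (A \<otimes> T B) z)"
    "trg (T (A \<otimes> B)) (FA (lstr P A B) z) = FO (lstr P A B) (trg (A \<otimes> T B) z)"
    using z s o cat_src_trg[OF cat z(3)] cat_src_trg[OF A z(2)]
    by (simp_all add: lstr_ac[OF A B] ac_src_trg[OF AB] ac_src_trg[OF B] lstr_oc o_def)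
  fix w assume "w \<in> Arr (A \<otimes> T B)" and tw: "trg (A \<otimes> T B) z = src (A \<otimes> T B) w"
  then obtain c G where w: "w = UPair c G" "c \<in> Arr A" "G \<in> Arr (T B)" by (metis uprod_arrE)
  have e: "trg A a = src A c" "trg (T B) (ac B (f, ys)) = src (T B) G" using tw z w by simp_all
  have "ac B (f, ys) \<in> Arr (T B)" "(f, ys) \<in> Arr (C B)" using z by simp_all
  \<comment> \<open>Classes that compose need not have strictly composable representatives; the one
    for \<open>G\<close> is chosen to fit \<open>(f, ys)\<close>.\<close>
  then obtain G' where G': "G = ac B G'" "G' \<in> Arr (C B)" "trg (C B) (f, ys) = src (C B) G'"
    using T_lift[OF B _ w(3) e(2) HOL.refl] by metis
  obtain g zs where g: "G' = (g, zs)" by (cases G')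
  have l: "length zs = length ys" using G'(3) g by (auto dest: len_eq)
  have s': "set (map (UPair c) zs) \<subseteq> Arr (A \<otimes> B)" using w G' g by auto
  have t: "map (trg B) ys = map (src B) zs" using G' g by simp
  have "map (trg (A \<otimes> B)) (map (UPair a) ys) = map (src (A \<otimes> B)) (map (UPair c) zs)"
    using t e(1) l by (simp add: list_eq_iff_nth_eq)
  moreover have "map2 (cmp (A \<otimes> B)) (map (UPair c) zs) (map (UPair a) ys) = map (UPair (cmp A c a)) (map2 (cmp B) zs ys)"
    using l by (intro nth_equalityI) simp_all
  moreover have "set (map2 (cmp B) zs ys) \<subseteq> Arr B" using map2_cmp[OF B z(4) _ t] G' g by simp
  moreover have "cmp (Op P (length ys)) g f \<in> arr (length ys)" using cat_cmp(1)[OF cat z(3)] G' g l by simp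
  ultimately show "FA (lstr P A B) (cmp (A \<otimes> T B) w z) = cmp (T (A \<otimes> B)) (FA (lstr P A B) w) (FA (lstr P A B) z)"
    using z w s s' G' g l t cat_cmp(1)[OF A z(2) w(2) e(1)]
      ac_cmp[OF AB, of f "map (UPair a) ys" g "map (UPair c) zs"] ac_cmp[OF B, of f ys g zs]
    by (simp add: lstr_ac[OF A B] del: map_map)
qed

lemma rstr_functor:
  assumes A: "category A" and B: "category B"
  shows "is_functor (T A \<otimes> B) (T (A \<otimes> B)) (rstr P A B)"
  unfolding is_functor_def
proof (intro conjI ballI impI)
  note AB = uprod_category[OF A B]
  fix z assume "z \<in> Obj (T A \<otimes> B)"
  then obtain b p as where z: "z = UPair (oc A (p, as)) b" "b \<in> Obj B" "p \<in> obj (length as)" "set as \<subseteq> Obj A"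
    by (metis uprod_objE T_objE)
  have s: "set (map (\<lambda>a. UPair a b) as) \<subseteq> Obj (A \<otimes> B)" using z by auto
  show "FO (rstr P A B) z \<in> Obj (T (A \<otimes> B))" using z s by (simp add: rstr_oc)
  show "FA (rstr P A B) (idt (T A \<otimes> B) z) = idt (T (A \<otimes> B)) (FO (rstr P A B) z)"
    using z s sarr_idt[OF AB, of p "map (\<lambda>a. UPair a b) as"] by (simp add: rstr_oc sarr_idt[OF A] rstr_sarr[OF A B] cat_idt[OF cat])
next
  note AB = uprod_category[OF A B]
  fix z assume "z \<in> Arr (T A \<otimes> B)"
  then obtain b f ys where z: "z = UPair (ac A (f, ys)) b" "b \<in> Arr B" "f \<in> arr (length ys)" "set ys \<subseteq> Arr A"
    by (metis uprod_arrE T_arrE)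
  have s: "set (map (\<lambda>a. UPair a b) ys) \<subseteq> Arr (A \<otimes> B)" using z by auto
  have o: "set (map (src A) ys) \<subseteq> Obj A" "set (map (trg A) ys) \<subseteq> Obj A" using z cat_src_trg[OF A] by auto
  show "FA (rstr P A B) z \<in> Arr (T (A \<otimes> B))" using z s by (simp add: rstr_ac[OF A B])
  show "src (T (A \<otimes> B)) (FA (rstr P A B) z) = FO (rstr P A B) (src (T A \<otimes> B) z)"
    "trg (T (A \<otimes> B)) (FA (rstr P A B) z) = FO (rstr P A B) (trg (T A \<otimes> B) z)"
    using z s o cat_src_trg[OF cat z(3)] cat_src_trg[OF B z(2)]
    by (simp_all add: rstr_ac[OF A B] ac_src_trg[OF AB] ac_src_trg[OF A] rstr_oc o_def)
  fix w assume "w \<in> Arr (T A \<otimes> B)" and tw: "trg (T A \<otimes> B) z = src (T A \<otimes> B) w"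
  then obtain c G where w: "w = UPair G c" "c \<in> Arr B" "G \<in> Arr (T A)" by (metis uprod_arrE)
  have e: "trg B b = src B c" "trg (T A) (ac A (f, ys)) = src (T A) G" using tw z w by simp_all
  have "ac A (f, ys) \<in> Arr (T A)" "(f, ys) \<in> Arr (C A)" using z by simp_all
  then obtain G' where G': "G = ac A G'" "G' \<in> Arr (C A)" "trg (C A) (f, ys) = src (C A) G'"
    using T_lift[OF A _ w(3) e(2) HOL.refl] by metis
  obtain g zs where g: "G' = (g, zs)" by (cases G')
  have l: "length zs = length ys" using G'(3) g by (auto dest: len_eq)
  have s': "set (map (\<lambda>a. UPair a c) zs) \<subseteq> Arr (A \<otimes> B)" using w G' g by auto
  have t: "map (trg A) ys = map (src A) zs" using G' g by simp
  have "map (trg (A \<otimes> B)) (map (\<lambda>a. UPair a b) ys) = map (src (A \<otimes> B)) (map (\<lambda>a. UPair a c) zs)"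
    using t e(1) l by (simp add: list_eq_iff_nth_eq)
  moreover have "map2 (cmp (A \<otimes> B)) (map (\<lambda>a. UPair a c) zs) (map (\<lambda>a. UPair a b) ys) = map (\<lambda>a. UPair a (cmp B c b)) (map2 (cmp A) zs ys)"
    using l by (intro nth_equalityI) simp_all
  moreover have "set (map2 (cmp A) zs ys) \<subseteq> Arr A" using map2_cmp[OF A z(4) _ t] G' g by simp
  moreover have "cmp (Op P (length ys)) g f \<in> arr (length ys)" using cat_cmp(1)[OF cat z(3)] G' g l by simp
  ultimately show "FA (rstr P A B) (cmp (T A \<otimes> B) w z) = cmp (T (A \<otimes> B)) (FA (rstr P A B) w) (FA (rstr P A B) z)"
    using z w s s' G' g l t cat_cmp(1)[OF B z(2) w(2) e(1)]
      ac_cmp[OF AB, of f "map (\<lambda>a. UPair a b) ys" g "map (\<lambda>a. UPair a c) zs"] ac_cmp[OF A, of f ys g zs]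
    by (simp add: rstr_ac[OF A B] del: map_map)
qed

end

lemma uassoc_functor: "is_functor ((A \<otimes> B) \<otimes> D) (A \<otimes> (B \<otimes> D)) uassoc"
  unfolding is_functor_def by (auto elim!: uprod_objE uprod_arrE simp: uassoc_def)

lemma uswap_functor: "is_functor (A \<otimes> B) (B \<otimes> A) uswap"
  unfolding is_functor_def by (auto elim!: uprod_objE uprod_arrE simp: uswap_def)

lemma fprod_functor: "is_functor A A' F \<Longrightarrow> is_functor B B' G \<Longrightarrow> is_functor (A \<otimes> B) (A' \<otimes> B') (F \<otimes>\<^sub>f G)"
  unfolding is_functor_def by (auto elim!: uprod_objE uprod_arrE simp: fprod_def)

section \<open>The components of the pseudo-commutativity\<close>

context contractible_operad_in_Cat
begin

definition gam :: "('o, 'a, 'x, 'y) ucat \<Rightarrow> ('o, 'a, 'x, 'y) ucat \<Rightarrow> ('o, 'a, 'x, 'y) utrans" where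
  "gam A B z = (case (uterm (ufst z), uterm (usnd z)) of ((p, as), (q, bs)) \<Rightarrow>
     sarr (A \<otimes> B) (lam (length as) (length bs) p q) (grid (\<lambda>b a. UPair a b) bs as))"

lemma grid_pair_mem:
  assumes "set as \<subseteq> Obj A" "set bs \<subseteq> Obj B"
  shows "set (grid (\<lambda>b a. UPair a b) bs as) \<subseteq> Obj (A \<otimes> B)" "set (grid UPair as bs) \<subseteq> Obj (A \<otimes> B)"
  using assms by auto

text \<open>Independence of the representatives is equivariance of \<lambda>: permuting the two
  operations acts on \<lambda> by \<open>mu_sym\<close>, and carried over to the entries this
  permutes the rows and columns of the grid. The two arguments are exchanged one after the other,
  with the identity permutation in the other place.\<close>

lemma gam_oc:
  assumes A: "category A" and B: "category B"
    and p: "p \<in> obj (length as)" "set as \<subseteq> Obj A" and q: "q \<in> obj (length bs)" "set bs \<subseteq> Obj B"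
  shows "gam A B (UPair (oc A (p, as)) (oc B (q, bs))) =
    sarr (A \<otimes> B) (lam (length as) (length bs) p q) (grid (\<lambda>b a. UPair a b) bs as)"
proof -
  define H where "H = (\<lambda>(p, as) (q, bs). sarr (A \<otimes> B) (lam (length as) (length bs) p q) (grid (\<lambda>b a. UPair a b) bs as))"
  have act: "H (ao (length as) g p, as) (ao (length bs) h q, bs) = H (p, act_list g as) (q, act_list h bs)"
    if "p \<in> obj (length as)" "set as \<subseteq> Obj A" "q \<in> obj (length bs)" "set bs \<subseteq> Obj B"
      "g permutes {1..length as}" "h permutes {1..length bs}" for p as q bs g h
  proof -
    have l: "length (grid (\<lambda>b a. UPair a b) bs as) = length bs * length as" by (rule length_grid)
    have "mu_sym (replicate (length bs) (length as)) h (replicate (length bs) g) permutes {1..length bs * length as}"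
      using permutes_mu_sym[OF that(6,5)] by (simp add: mult.commute)
    then show ?thesis
      using sarr_act[OF uprod_category[OF A B] _ grid_pair_mem(1)[OF that(2,4)], unfolded l,
          of "lam (length as) (length bs) p q" "mu_sym (replicate (length bs) (length as)) h (replicate (length bs) g)"]
        lam_act[OF that(1,3,5,6)] hom_arr[OF lam_hom[OF that(1,3)]]
        act_list_mu_sym[OF that(6,5), of "\<lambda>b a. UPair a b"]
      by (simp add: H_def)
  qed
  \<comment> \<open>While the first argument is being replaced, the second stays the chosen
    representative, of which membership in \<open>C B\<close> is all that is needed.\<close>
  define z where "z = uterm (oc B (q, bs))"
  have z: "z \<in> Obj (C B)" using oc_carrier[OF B oc_uterm[symmetric], of "(q, bs)"] q by (simp add: z_def)
  have "gam A B (UPair (oc A (p, as)) (oc B (q, bs))) = H (uterm (oc A (p, as))) z"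
    by (simp add: gam_def H_def z_def split: prod.split)
  also have "\<dots> = H (p, as) z"
  proof (rule oc_invariant[OF oc_uterm])
    fix p xs \<sigma> assume a: "p \<in> obj (length xs)" "set xs \<subseteq> Obj A" "\<sigma> permutes {1..length xs}"
    show "H (ao (length xs) \<sigma> p, xs) z = H (p, act_list \<sigma> xs) z"
      using act[OF a(1,2) _ _ a(3) permutes_id, of "fst z" "snd z"] z by (cases z) (simp add: act_id)
  qed
  also have "\<dots> = H (p, as) (q, bs)"
    unfolding z_def
  proof (rule oc_invariant[OF oc_uterm])
    fix q xs \<sigma> assume a: "q \<in> obj (length xs)" "set xs \<subseteq> Obj B" "\<sigma> permutes {1..length xs}"
    show "H (p, as) (ao (length xs) \<sigma> q, xs) = H (p, as) (q, act_list \<sigma> xs)"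
      using act[OF p a(1,2) permutes_id a(3)] p by (simp add: act_id)
  qed
  finally show ?thesis by (simp add: H_def)
qed

lemma gamma_dom_oc:
  assumes A: "category A" and B: "category B"
    and p: "p \<in> obj (length as)" "set as \<subseteq> Obj A" and q: "q \<in> obj (length bs)" "set bs \<subseteq> Obj B"
  shows "FO (gamma_dom P A B) (UPair (oc A (p, as)) (oc B (q, bs))) =
    oc (A \<otimes> B) (mo (replicate (length as) (length bs)) p (replicate (length as) q), grid UPair as bs)"
proof -
  note AB = uprod_category[OF A B]
  have s: "set (map (\<lambda>a. UPair a (oc B (q, bs))) as) \<subseteq> Obj (A \<otimes> T B)" using p q by auto
  have "map (FO (lstr P A B)) (map (\<lambda>a. UPair a (oc B (q, bs))) as) = map (\<lambda>a. oc (A \<otimes> B) (q, map (UPair a) bs)) as"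
    using p q by (auto simp: lstr_oc)
  then show ?thesis
    using p q T_fun_oc[OF lstr_functor[OF A B] _ s, of p] T_mem(1)[of "(q, bs)" B]
    by (simp add: gamma_dom_def fcomp_def rstr_oc del: map_map)
      (subst T_mu_oc_map[OF AB], auto simp: map_replicate_const)
qed

lemma gamma_cod_oc:
  assumes A: "category A" and B: "category B"
    and p: "p \<in> obj (length as)" "set as \<subseteq> Obj A" and q: "q \<in> obj (length bs)" "set bs \<subseteq> Obj B"
  shows "FO (gamma_cod P A B) (UPair (oc A (p, as)) (oc B (q, bs))) =
    oc (A \<otimes> B) (mo (replicate (length bs) (length as)) q (replicate (length bs) p), grid (\<lambda>b a. UPair a b) bs as)"
proof -
  note AB = uprod_category[OF A B]
  have s: "set (map (UPair (oc A (p, as))) bs) \<subseteq> Obj (T A \<otimes> B)" using p q by auto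
  have "map (FO (rstr P A B)) (map (UPair (oc A (p, as))) bs) = map (\<lambda>b. oc (A \<otimes> B) (p, map (\<lambda>a. UPair a b) as)) bs"
    using p q by (auto simp: rstr_oc)
  then show ?thesis
    using p q T_fun_oc[OF rstr_functor[OF A B] _ s, of q] T_mem(1)[of "(p, as)" A]
    by (simp add: gamma_cod_def fcomp_def lstr_oc del: map_map)
      (subst T_mu_oc_map[OF AB], auto simp: map_replicate_const)
qed

lemma gamma_dom_ac:
  assumes A: "category A" and B: "category B"
    and f: "f \<in> arr (length ys)" "set ys \<subseteq> Arr A" and g: "g \<in> arr (length zs)" "set zs \<subseteq> Arr B"
  shows "FA (gamma_dom P A B) (UPair (ac A (f, ys)) (ac B (g, zs))) =
    ac (A \<otimes> B) (ma (replicate (length ys) (length zs)) f (replicate (length ys) g), grid UPair ys zs)"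
proof -
  note AB = uprod_category[OF A B]
  have s: "set (map (\<lambda>a. UPair a (ac B (g, zs))) ys) \<subseteq> Arr (A \<otimes> T B)" using f g by auto
  have "map (FA (lstr P A B)) (map (\<lambda>a. UPair a (ac B (g, zs))) ys) = map (\<lambda>a. ac (A \<otimes> B) (g, map (UPair a) zs)) ys"
    using f g by (auto simp: lstr_ac[OF A B])
  then show ?thesis
    using f g T_fun_ac[OF T_category[OF AB] lstr_functor[OF A B] _ s, of f] T_mem(2)[of "(g, zs)" B]
    by (simp add: gamma_dom_def fcomp_def rstr_ac[OF A T_category[OF B]] del: map_map)
      (subst T_mu_ac_map[OF AB], auto simp: map_replicate_const)
qed

lemma gamma_cod_ac:
  assumes A: "category A" and B: "category B"
    and f: "f \<in> arr (length ys)" "set ys \<subseteq> Arr A" and g: "g \<in> arr (length zs)" "set zs \<subseteq> Arr B"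
  shows "FA (gamma_cod P A B) (UPair (ac A (f, ys)) (ac B (g, zs))) =
    ac (A \<otimes> B) (ma (replicate (length zs) (length ys)) g (replicate (length zs) f), grid (\<lambda>b a. UPair a b) zs ys)"
proof -
  note AB = uprod_category[OF A B]
  have s: "set (map (UPair (ac A (f, ys))) zs) \<subseteq> Arr (T A \<otimes> B)" using f g by auto
  have "map (FA (rstr P A B)) (map (UPair (ac A (f, ys))) zs) = map (\<lambda>b. ac (A \<otimes> B) (f, map (\<lambda>a. UPair a b) ys)) zs"
    using f g by (auto simp: rstr_ac[OF A B])
  then show ?thesis
    using f g T_fun_ac[OF T_category[OF AB] rstr_functor[OF A B] _ s, of g] T_mem(2)[of "(f, ys)" A]
    by (simp add: gamma_cod_def fcomp_def lstr_ac[OF T_category[OF A] B] del: map_map)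
      (subst T_mu_ac_map[OF AB], auto simp: map_replicate_const)
qed

lemma sarr_inverse:
  assumes X: "category X" and "f \<in> hom n p q" "g \<in> hom n q p" "n = length xs" "set xs \<subseteq> Obj X"
  shows "inverse_arrows (T X) (sarr X f xs) (sarr X g xs)"
proof -
  have o: "p \<in> obj (length xs)" "q \<in> obj (length xs)" using hom_obj[OF assms(2)] assms(4) by auto
  have "cmp (Op P n) g f = idt (Op P n) p" "cmp (Op P n) f g = idt (Op P n) q"
    using inverse_arrowsI[OF assms(2,3)] assms(2) by (auto simp: inverse_arrows_def hom_def)
  then show ?thesis
    using assms o sarr_mem[OF X _ assms(5)] sarr_src_trg[OF X _ assms(5)]
      sarr_cmp[OF X assms(2,3,4,5)] sarr_cmp[OF X assms(3,2,4,5)]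
    by (auto simp: inverse_arrows_def hom_def sarr_idt[OF X])
qed

lemma gam_pair_lam:
  assumes "p \<in> obj (length as)" "q \<in> obj (length bs)"
  shows "lam (length as) (length bs) p q \<in> hom (length (grid (\<lambda>b a. UPair a b) bs as))
    (lam_src (length as) (length bs) p q) (lam_trg (length as) (length bs) p q)"
  unfolding length_grid using lam_hom[OF assms] .

text \<open>The entries are listed in the order of the codomain. The transposition in the source of
  \<lambda>, moved onto the entries, turns this into the order of the domain.\<close>

lemma gam_src:
  assumes A: "category A" and B: "category B"
    and p: "p \<in> obj (length as)" "set as \<subseteq> Obj A" and q: "q \<in> obj (length bs)" "set bs \<subseteq> Obj B"
  shows "oc (A \<otimes> B) (lam_src (length as) (length bs) p q, grid (\<lambda>b a. UPair a b) bs as) =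
    oc (A \<otimes> B) (mo (replicate (length as) (length bs)) p (replicate (length as) q), grid UPair as bs)"
proof -
  have "oc (A \<otimes> B) (ao (length (grid (\<lambda>b a. UPair a b) bs as)) (transpose_perm (length bs) (length as))
      (mo (replicate (length as) (length bs)) p (replicate (length as) q)), grid (\<lambda>b a. UPair a b) bs as) =
     oc (A \<otimes> B) (mo (replicate (length as) (length bs)) p (replicate (length as) q),
       act_list (transpose_perm (length bs) (length as)) (grid (\<lambda>b a. UPair a b) bs as))"
    by (rule oc_act)
      (use mu_replicate_obj[OF p(1) q(1)] permutes_transpose grid_pair_mem[OF p(2) q(2)] in \<open>simp_all only: length_grid\<close>)
  then show ?thesis unfolding length_grid lam_src_def by (simp add: act_list_transpose)
qed

lemma gam_nat_iso:
  assumes A: "category A" and B: "category B"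
  shows "nat_iso (T A \<otimes> T B) (T (A \<otimes> B)) (gamma_dom P A B) (gamma_cod P A B) (gam A B)"
  unfolding nat_iso_def nat_trans_def
proof (intro conjI ballI)
  note AB = uprod_category[OF A B]
  fix z assume "z \<in> Obj (T A \<otimes> T B)"
  then obtain p as q bs where z: "z = UPair (oc A (p, as)) (oc B (q, bs))"
    and p: "p \<in> obj (length as)" "set as \<subseteq> Obj A" and q: "q \<in> obj (length bs)" "set bs \<subseteq> Obj B"
    by (metis uprod_objE T_objE)
  note g = gam_oc[OF A B p q] and m = grid_pair_mem(1)[OF p(2) q(2)] and l = gam_pair_lam[OF p(1) q(1)]
  show "gam A B z \<in> Arr (T (A \<otimes> B))" unfolding z g by (rule sarr_mem[OF AB hom_arr[OF l] m])
  show "src (T (A \<otimes> B)) (gam A B z) = FO (gamma_dom P A B) z"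
    using sarr_src_trg(1)[OF AB hom_arr[OF l] m] l gam_src[OF A B p q]
    unfolding z g gamma_dom_oc[OF A B p q] hom_def by simp
  show "trg (T (A \<otimes> B)) (gam A B z) = FO (gamma_cod P A B) z"
    using sarr_src_trg(2)[OF AB hom_arr[OF l] m] l
    unfolding z g gamma_cod_oc[OF A B p q] hom_def lam_trg_def by simp
  obtain e where "e \<in> hom (length (grid (\<lambda>b a. UPair a b) bs as))
    (lam_trg (length as) (length bs) p q) (lam_src (length as) (length bs) p q)"
    using hom_ex hom_obj[OF l] by blast
  from sarr_inverse[OF AB l this HOL.refl m]
  show "iso_arrow (T (A \<otimes> B)) (gam A B z)" unfolding z g iso_arrow_def by blast
next
  note AB = uprod_category[OF A B]
  fix z assume "z \<in> Arr (T A \<otimes> T B)"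
  then obtain f ys g zs where z: "z = UPair (ac A (f, ys)) (ac B (g, zs))"
    and f: "f \<in> arr (length ys)" "set ys \<subseteq> Arr A" and g: "g \<in> arr (length zs)" "set zs \<subseteq> Arr B"
    by (metis uprod_arrE T_arrE)
  let ?n = "length ys" and ?m = "length zs"
  obtain p p' q q' where h: "f \<in> hom ?n p p'" "g \<in> hom ?m q q'" using f g by (auto simp: hom_def)
  have o: "p \<in> obj ?n" "p' \<in> obj ?n" "q \<in> obj ?m" "q' \<in> obj ?m" using hom_obj[OF h(1)] hom_obj[OF h(2)] by auto
  let ?G = "grid (\<lambda>b a. UPair a b) zs ys"
  have G: "set ?G \<subseteq> Arr (A \<otimes> B)" "set (grid UPair ys zs) \<subseteq> Arr (A \<otimes> B)" using f g by auto
  have l: "length ?G = ?m * ?n" by (rule length_grid)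
  have st: "map (src (A \<otimes> B)) ?G = grid (\<lambda>b a. UPair a b) (map (src B) zs) (map (src A) ys)"
    "map (trg (A \<otimes> B)) ?G = grid (\<lambda>b a. UPair a b) (map (trg B) zs) (map (trg A) ys)"
    by (simp_all add: map_concat o_def)
  have os: "set (map (src A) ys) \<subseteq> Obj A" "set (map (trg A) ys) \<subseteq> Obj A" "set (map (src B) zs) \<subseteq> Obj B" "set (map (trg B) zs) \<subseteq> Obj B"
    using f g cat_src_trg[OF A] cat_src_trg[OF B] by auto
  have zs: "src (T A \<otimes> T B) z = UPair (oc A (p, map (src A) ys)) (oc B (q, map (src B) zs))"
    "trg (T A \<otimes> T B) z = UPair (oc A (p', map (trg A) ys)) (oc B (q', map (trg B) zs))"
    using f g h by (simp_all add: z ac_src_trg[OF A] ac_src_trg[OF B] hom_def)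
  let ?d = "ma (replicate ?n ?m) f (replicate ?n g)" and ?c = "ma (replicate ?m ?n) g (replicate ?m f)"
  let ?t = "transpose_perm ?m ?n"
  have d: "aa (?m * ?n) ?t ?d \<in> hom (?m * ?n) (lam_src ?n ?m p q) (lam_src ?n ?m p' q')"
    unfolding lam_src_def by (rule hom_act[OF permutes_transpose mu_replicate_hom[OF h]])
  have c: "?c \<in> hom (?m * ?n) (lam_trg ?n ?m p q) (lam_trg ?n ?m p' q')"
    unfolding lam_trg_def using mu_replicate_hom[OF h(2,1)] by (simp add: mult.commute)
  \<comment> \<open>The value of the domain functor is rewritten over the entries \<open>?G\<close>
    in codomain order, at the price of a transposition acting on the operation. Both composites of
    the naturality square then have the same entries.\<close>
  have "ac (A \<otimes> B) (aa (length ?G) ?t ?d, ?G) = ac (A \<otimes> B) (?d, act_list ?t ?G)"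
    by (rule ac_act[OF _ G(1)]) (use hom_arr[OF mu_replicate_hom[OF h]] permutes_transpose in \<open>simp_all only: l\<close>)
  then have dd: "FA (gamma_dom P A B) z = ac (A \<otimes> B) (aa (?m * ?n) ?t ?d, ?G)"
    unfolding z gamma_dom_ac[OF A B f g] l by (simp add: act_list_transpose)
  have "cmp (T (A \<otimes> B)) (gam A B (trg (T A \<otimes> T B) z)) (FA (gamma_dom P A B) z) =
    cmp (T (A \<otimes> B)) (sarr (A \<otimes> B) (lam ?n ?m p' q') (map (trg (A \<otimes> B)) ?G)) (ac (A \<otimes> B) (aa (?m * ?n) ?t ?d, ?G))"
    using gam_oc[OF A B _ os(2) _ os(4), of p' q'] o unfolding zs st dd by simp
  also have "\<dots> = ac (A \<otimes> B) (cmp (Op P (?m * ?n)) (lam ?n ?m p' q') (aa (?m * ?n) ?t ?d), ?G)"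
    by (rule sarr_cmp_left[OF AB d lam_hom[OF o(2,4)] l[symmetric] G(1)])
  \<comment> \<open>What remains is a square of operations, which commutes because parallel arrows
    of a contractible operad are equal.\<close>
  also have "cmp (Op P (?m * ?n)) (lam ?n ?m p' q') (aa (?m * ?n) ?t ?d) = cmp (Op P (?m * ?n)) ?c (lam ?n ?m p q)"
    by (rule hom_unique[OF hom_cmp[OF d lam_hom[OF o(2,4)]] hom_cmp[OF lam_hom[OF o(1,3)] c]])
  also have "ac (A \<otimes> B) (cmp (Op P (?m * ?n)) ?c (lam ?n ?m p q), ?G) =
    cmp (T (A \<otimes> B)) (ac (A \<otimes> B) (?c, ?G)) (sarr (A \<otimes> B) (lam ?n ?m p q) (map (src (A \<otimes> B)) ?G))"
    by (rule sarr_cmp_right[OF AB lam_hom[OF o(1,3)] c l[symmetric] G(1), symmetric])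
  also have "\<dots> = cmp (T (A \<otimes> B)) (FA (gamma_cod P A B) z) (gam A B (src (T A \<otimes> T B) z))"
    using gam_oc[OF A B _ os(1) _ os(3), of p q] o unfolding zs st unfolding z gamma_cod_ac[OF A B f g] by simp
  finally show "cmp (T (A \<otimes> B)) (gam A B (trg (T A \<otimes> T B) z)) (FA (gamma_dom P A B) z) =
    cmp (T (A \<otimes> B)) (FA (gamma_cod P A B) z) (gam A B (src (T A \<otimes> T B) z))" .
qed

section \<open>Modification, strength, unit and symmetry axioms\<close>

lemma gam_sarr_T_fun:
  assumes "category A" "category B" "category D" "is_functor (A \<otimes> B) D F"
    and p: "p \<in> obj (length as)" "set as \<subseteq> Obj A" and q: "q \<in> obj (length bs)" "set bs \<subseteq> Obj B"
  shows "FA (T_fun P D F) (gam A B (UPair (oc A (p, as)) (oc B (q, bs)))) =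
    sarr D (lam (length as) (length bs) p q) (grid (\<lambda>b a. FO F (UPair a b)) bs as)"
  unfolding gam_oc[OF assms(1,2) p q] T_fun_sarr[OF uprod_category[OF assms(1,2)] assms(3,4)
     hom_arr[OF gam_pair_lam[OF p(1) q(1)]] grid_pair_mem(1)[OF p(2) q(2)]]
  by (simp add: map_concat o_def)

text \<open>\<lambda> depends on the operations alone, whereas \<open>F\<close> and \<open>G\<close>
  change the entries alone.\<close>

lemma gam_modification:
  assumes "category A" "category A'" "category B" "category B'" "is_functor A A' F" "is_functor B B' G"
    and "z \<in> Obj (T A \<otimes> T B)"
  shows "(T_fun P (A' \<otimes> B') (F \<otimes>\<^sub>f G) \<rhd> gam A B) z = (gam A' B' \<lhd> (T_fun P A' F \<otimes>\<^sub>f T_fun P B' G)) z"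
proof -
  obtain p as q bs where z: "z = UPair (oc A (p, as)) (oc B (q, bs))"
    and p: "p \<in> obj (length as)" "set as \<subseteq> Obj A" and q: "q \<in> obj (length bs)" "set bs \<subseteq> Obj B"
    using assms(7) by (metis uprod_objE T_objE)
  have o: "set (map (FO F) as) \<subseteq> Obj A'" "set (map (FO G) bs) \<subseteq> Obj B'"
    using p q is_functorD(1)[OF assms(5)] is_functorD(1)[OF assms(6)] by auto
  have "(T_fun P (A' \<otimes> B') (F \<otimes>\<^sub>f G) \<rhd> gam A B) z =
    sarr (A' \<otimes> B') (lam (length as) (length bs) p q) (grid (\<lambda>b a. UPair (FO F a) (FO G b)) bs as)"
    unfolding whisker_left_def z
      gam_sarr_T_fun[OF assms(1,3) uprod_category[OF assms(2,4)] fprod_functor[OF assms(5,6)] p q]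
    by (simp add: fprod_def)
  also have "\<dots> = gam A' B' (UPair (oc A' (p, map (FO F) as)) (oc B' (q, map (FO G) bs)))"
    using gam_oc[OF assms(2,4) _ o(1) _ o(2), of p q] p q by (simp add: o_def)
  finally show ?thesis
    using T_fun_oc[OF assms(5) p] T_fun_oc[OF assms(6) q] by (simp add: whisker_right_def fprod_def z)
qed

text \<open>In the three strength axioms the operations are untouched, so both sides carry the same
  \<lambda>. It remains to see that the two grids of triples are listed in the same order, once
  \<open>uassoc\<close> has adjusted the bracketing.\<close>

lemma gam_lstr_left:
  assumes A: "category A" and B: "category B" and D: "category D" and "z \<in> Obj ((A \<otimes> T B) \<otimes> T D)"
  shows "(T_fun P (A \<otimes> (B \<otimes> D)) uassoc \<rhd> (gam (A \<otimes> B) D \<lhd> (lstr P A B \<otimes>\<^sub>f id_fnct))) z =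
           ((lstr P A (B \<otimes> D) \<rhd> (idt A \<otimes>\<^sub>n gam B D)) \<lhd> uassoc) z"
proof -
  obtain a q bs r ds where z: "z = UPair (UPair a (oc B (q, bs))) (oc D (r, ds))" and a: "a \<in> Obj A"
    and q: "q \<in> obj (length bs)" "set bs \<subseteq> Obj B" and r: "r \<in> obj (length ds)" "set ds \<subseteq> Obj D"
    using assms(4) by (metis uprod_objE T_objE)
  have s: "set (map (UPair a) bs) \<subseteq> Obj (A \<otimes> B)" "q \<in> obj (length (map (UPair a) bs))" using a q by auto
  note ABD = uprod_category[OF A uprod_category[OF B D]]
  have "FA (T_fun P (A \<otimes> (B \<otimes> D)) uassoc) (gam (A \<otimes> B) D (UPair (oc (A \<otimes> B) (q, map (UPair a) bs)) (oc D (r, ds)))) =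
    FA (lstr P A (B \<otimes> D)) (UPair (idt A a) (gam B D (UPair (oc B (q, bs)) (oc D (r, ds)))))"
    unfolding gam_sarr_T_fun[OF uprod_category[OF A B] D ABD uassoc_functor s(2,1) r]
      gam_oc[OF B D q r] lstr_sarr[OF A uprod_category[OF B D] a hom_arr[OF gam_pair_lam[OF q(1) r(1)]] grid_pair_mem(1)[OF q(2) r(2)]]
    by (simp add: map_concat o_def uassoc_def)
  then show ?thesis
    by (simp add: whisker_left_def whisker_right_def ntprod_def fprod_def id_fnct_def z uassoc_def lstr_oc[OF a q])
qed

lemma gam_lstr_rstr:
  assumes A: "category A" and B: "category B" and D: "category D" and "z \<in> Obj ((T A \<otimes> B) \<otimes> T D)"
  shows "((gam A (B \<otimes> D) \<lhd> (id_fnct \<otimes>\<^sub>f lstr P B D)) \<lhd> uassoc) z =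
           (T_fun P (A \<otimes> (B \<otimes> D)) uassoc \<rhd> (gam (A \<otimes> B) D \<lhd> (rstr P A B \<otimes>\<^sub>f id_fnct))) z"
proof -
  obtain b p as r ds where z: "z = UPair (UPair (oc A (p, as)) b) (oc D (r, ds))" and b: "b \<in> Obj B"
    and p: "p \<in> obj (length as)" "set as \<subseteq> Obj A" and r: "r \<in> obj (length ds)" "set ds \<subseteq> Obj D"
    using assms(4) by (metis uprod_objE T_objE)
  have s: "set (map (\<lambda>a. UPair a b) as) \<subseteq> Obj (A \<otimes> B)" "p \<in> obj (length (map (\<lambda>a. UPair a b) as))"
    "set (map (UPair b) ds) \<subseteq> Obj (B \<otimes> D)" "r \<in> obj (length (map (UPair b) ds))"
    using b p r by auto
  note ABD = uprod_category[OF A uprod_category[OF B D]]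
  have "FA (T_fun P (A \<otimes> (B \<otimes> D)) uassoc) (gam (A \<otimes> B) D (UPair (oc (A \<otimes> B) (p, map (\<lambda>a. UPair a b) as)) (oc D (r, ds)))) =
    gam A (B \<otimes> D) (UPair (oc A (p, as)) (oc (B \<otimes> D) (r, map (UPair b) ds)))"
    unfolding gam_sarr_T_fun[OF uprod_category[OF A B] D ABD uassoc_functor s(2,1) r]
      gam_oc[OF A uprod_category[OF B D] p s(4,3)]
    by (simp add: o_def uassoc_def)
  then show ?thesis
    by (simp add: whisker_left_def whisker_right_def fprod_def id_fnct_def z uassoc_def lstr_oc[OF b r] rstr_oc[OF b p])
qed

lemma gam_rstr_right:
  assumes A: "category A" and B: "category B" and D: "category D" and "z \<in> Obj ((T A \<otimes> T B) \<otimes> D)"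
  shows "((gam A (B \<otimes> D) \<lhd> (id_fnct \<otimes>\<^sub>f rstr P B D)) \<lhd> uassoc) z =
           (T_fun P (A \<otimes> (B \<otimes> D)) uassoc \<rhd> (rstr P (A \<otimes> B) D \<rhd> (gam A B \<otimes>\<^sub>n idt D))) z"
proof -
  obtain p as q bs d where z: "z = UPair (UPair (oc A (p, as)) (oc B (q, bs))) d" and d: "d \<in> Obj D"
    and p: "p \<in> obj (length as)" "set as \<subseteq> Obj A" and q: "q \<in> obj (length bs)" "set bs \<subseteq> Obj B"
    using assms(4) by (metis uprod_objE T_objE)
  have s: "set (map (\<lambda>b. UPair b d) bs) \<subseteq> Obj (B \<otimes> D)" "q \<in> obj (length (map (\<lambda>b. UPair b d) bs))" using d q by auto
  note AB = uprod_category[OF A B] and ABD = uprod_category[OF A uprod_category[OF B D]]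
  let ?G = "grid (\<lambda>b a. UPair a b) bs as"
  have G: "set (map (\<lambda>x. UPair x d) ?G) \<subseteq> Obj ((A \<otimes> B) \<otimes> D)" using p q d by auto
  have l: "lam (length as) (length bs) p q \<in> arr (length (map (\<lambda>x. UPair x d) ?G))"
    unfolding length_map by (rule hom_arr[OF gam_pair_lam[OF p(1) q(1)]])
  have "FA (T_fun P (A \<otimes> (B \<otimes> D)) uassoc) (FA (rstr P (A \<otimes> B) D) (UPair (gam A B (UPair (oc A (p, as)) (oc B (q, bs)))) (idt D d))) =
    gam A (B \<otimes> D) (UPair (oc A (p, as)) (oc (B \<otimes> D) (q, map (\<lambda>b. UPair b d) bs)))"
    unfolding gam_oc[OF A uprod_category[OF B D] p s(2,1)] gam_oc[OF A B p q]
      rstr_sarr[OF AB D d hom_arr[OF gam_pair_lam[OF p(1) q(1)]] grid_pair_mem(1)[OF p(2) q(2)]]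
      T_fun_sarr[OF uprod_category[OF AB D] ABD uassoc_functor l G]
    by (simp add: map_concat o_def uassoc_def)
  then show ?thesis
    by (simp add: whisker_left_def whisker_right_def ntprod_def fprod_def id_fnct_def z uassoc_def rstr_oc[OF d q])
qed

text \<open>The unit turns \<open>a\<close> into a term of arity one, for which \<lambda> is an
  identity by \<open>lam_unit\<close> and the grid has a single column.\<close>

lemma gam_eta_left:
  assumes A: "category A" and B: "category B" and "z \<in> Obj (A \<otimes> T B)"
  shows "(gam A B \<lhd> (T_eta P A \<otimes>\<^sub>f id_fnct)) z = idt (T (A \<otimes> B)) (FO (lstr P A B) z)"
proof -
  obtain a q bs where z: "z = UPair a (oc B (q, bs))" and a: "a \<in> Obj A"
    and q: "q \<in> obj (length bs)" "set bs \<subseteq> Obj B"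
    using assms(3) by (metis uprod_objE T_objE)
  have l: "length [a] = 1" by (simp add: One_nat_def)
  have u: "unit P \<in> obj (length [a])" "set [a] \<subseteq> Obj A" using a by simp_all
  have s: "set (map (UPair a) bs) \<subseteq> Obj (A \<otimes> B)" using a q by auto
  have "gam A B (UPair (oc A (unit P, [a])) (oc B (q, bs))) = idt (T (A \<otimes> B)) (oc (A \<otimes> B) (q, map (UPair a) bs))"
    unfolding gam_oc[OF A B u q] l lam_unit(2)[OF q(1)]
    using sarr_idt[OF uprod_category[OF A B] _ s, of q] q(1) by simp
  then show ?thesis by (simp add: whisker_right_def fprod_def id_fnct_def T_eta_def z lstr_oc[OF a q])
qed

lemma gam_eta_right:
  assumes A: "category A" and B: "category B" and "z \<in> Obj (T A \<otimes> B)"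
  shows "(gam A B \<lhd> (id_fnct \<otimes>\<^sub>f T_eta P B)) z = idt (T (A \<otimes> B)) (FO (rstr P A B) z)"
proof -
  obtain b p as where z: "z = UPair (oc A (p, as)) b" and b: "b \<in> Obj B"
    and p: "p \<in> obj (length as)" "set as \<subseteq> Obj A"
    using assms(3) by (metis uprod_objE T_objE)
  have l: "length [b] = 1" by (simp add: One_nat_def)
  have u: "unit P \<in> obj (length [b])" "set [b] \<subseteq> Obj B" using b by simp_all
  have s: "set (map (\<lambda>a. UPair a b) as) \<subseteq> Obj (A \<otimes> B)" using b p by auto
  have "gam A B (UPair (oc A (p, as)) (oc B (unit P, [b]))) = idt (T (A \<otimes> B)) (oc (A \<otimes> B) (p, map (\<lambda>a. UPair a b) as))"
    unfolding gam_oc[OF A B p u] l lam_unit(1)[OF p(1)]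
    using sarr_idt[OF uprod_category[OF A B] _ s, of p] p(1) by simp
  then show ?thesis by (simp add: whisker_right_def fprod_def id_fnct_def T_eta_def z rstr_oc[OF b p])
qed

text \<open>After the swap the pairs are the same but listed in the other direction. Moving the
  transposition from the entries to the operation makes the two grids equal, and cancelling two
  transpositions shows that the transposed \<lambda> at \<open>p\<close> and \<open>q\<close> runs
  opposite to \<lambda> at \<open>q\<close> and \<open>p\<close>; opposite arrows are
  inverse.\<close>

lemma gam_swap:
  assumes A: "category A" and B: "category B" and "z \<in> Obj (T B \<otimes> T A)"
  shows "inverse_arrows (T (B \<otimes> A)) (gam B A z) ((T_fun P (B \<otimes> A) uswap \<rhd> (gam A B \<lhd> uswap)) z)"
proof -
  obtain p as q bs where z: "z = UPair (oc B (q, bs)) (oc A (p, as))"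
    and p: "p \<in> obj (length as)" "set as \<subseteq> Obj A" and q: "q \<in> obj (length bs)" "set bs \<subseteq> Obj B"
    using assms(3) by (metis uprod_objE T_objE)
  note BA = uprod_category[OF B A]
  let ?n = "length as" and ?m = "length bs" and ?G = "grid (\<lambda>a b. UPair b a) as bs"
  let ?t = "transpose_perm ?n ?m"
  have l: "length ?G = ?n * ?m" by (rule length_grid)
  have G: "set ?G \<subseteq> Obj (B \<otimes> A)" using p q by auto
  have o: "mo (replicate ?n ?m) p (replicate ?n q) \<in> obj (?n * ?m)"
    using mu_replicate_obj[OF p(1) q(1)] by (simp add: mult.commute)
  have t: "ao (?n * ?m) ?t (lam_src ?n ?m p q) = lam_trg ?m ?n q p"
    using act_act(1)[OF permutes_transpose[of ?m ?n, unfolded mult.commute[of ?m ?n]] permutes_transpose[of ?n ?m] o]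
      transpose_perm_comp[of ?m ?n] act_id(1)[OF o]
    by (simp add: lam_src_def lam_trg_def mult.commute)
  have s: "ao (?n * ?m) ?t (lam_trg ?n ?m p q) = lam_src ?m ?n q p"
    by (simp add: lam_src_def lam_trg_def)
  have "lam ?n ?m p q \<in> hom (?n * ?m) (lam_src ?n ?m p q) (lam_trg ?n ?m p q)"
    using lam_hom[OF p(1) q(1)] by (simp add: mult.commute)
  from hom_act[OF permutes_transpose[of ?n ?m] this]
  have h: "aa (?n * ?m) ?t (lam ?n ?m p q) \<in> hom (?n * ?m) (lam_trg ?m ?n q p) (lam_src ?m ?n q p)"
    unfolding s t .
  have "sarr (B \<otimes> A) (aa (length ?G) ?t (lam ?n ?m p q)) ?G = sarr (B \<otimes> A) (lam ?n ?m p q) (act_list ?t ?G)"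
    by (rule sarr_act[OF BA _ G])
      (use lam_hom[OF p(1) q(1)] permutes_transpose[of ?n ?m] in \<open>simp_all only: l hom_arr mult.commute[of ?n ?m]\<close>)
  then have "FA (T_fun P (B \<otimes> A) uswap) (gam A B (UPair (oc A (p, as)) (oc B (q, bs)))) =
     sarr (B \<otimes> A) (aa (?n * ?m) ?t (lam ?n ?m p q)) ?G"
    unfolding gam_sarr_T_fun[OF A B BA uswap_functor p q] l
    by (simp add: act_list_transpose uswap_def)
  moreover have "gam B A z = sarr (B \<otimes> A) (lam ?m ?n q p) ?G"
    unfolding z by (rule gam_oc[OF B A q p])
  moreover have "inverse_arrows (T (B \<otimes> A)) (sarr (B \<otimes> A) (lam ?m ?n q p) ?G) (sarr (B \<otimes> A) (aa (?n * ?m) ?t (lam ?n ?m p q)) ?G)"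
    by (rule sarr_inverse[OF BA lam_hom[OF q(1) p(1)] h l[symmetric] G])
  ultimately show ?thesis by (simp add: whisker_left_def whisker_right_def z uswap_def)
qed

section \<open>Compatibility with the multiplication\<close>

lemma T_mu_sarr_oc:
  assumes X: "category X" and "f \<in> arr (length is)"
    and "\<And>i. i \<in> set is \<Longrightarrow> q i \<in> obj (length (xs i)) \<and> set (xs i) \<subseteq> Obj X"
  shows "FA (T_mu P X) (sarr (T X) f (map (\<lambda>i. oc X (q i, xs i)) is)) =
    sarr X (ma (map (\<lambda>i. length (xs i)) is) f (map (\<lambda>i. idt (Op P (length (xs i))) (q i)) is)) (concat (map xs is))"
proof -
  have "map (idt (T X)) (map (\<lambda>i. oc X (q i, xs i)) is) = map (\<lambda>i. sarr X (idt (Op P (length (xs i))) (q i)) (xs i)) is"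
    using assms(3) by (auto simp: sarr_idt[OF X])
  then show ?thesis
    using T_mu_sarr_map[OF X assms(2), of "\<lambda>i. idt (Op P (length (xs i))) (q i)" xs] assms(3) cat_idt(1)[OF cat]
    by (simp add: sarr_def del: map_map)
qed

text \<open>The argument is an object, so only orbits have to be respected; since permutations act
  by functors, the identity of the permuted operation is the permuted identity.\<close>

lemma T_nt_oc:
  assumes "p \<in> obj (length xs)" "set xs \<subseteq> Obj X" "\<And>x. x \<in> Obj X \<Longrightarrow> \<alpha> x \<in> Arr Y"
  shows "T_nt P Y \<alpha> (oc X (p, xs)) = ac Y (idt (Op P (length xs)) p, map \<alpha> xs)"
proof -
  define H where "H = (\<lambda>(p, xs). ac Y (idt (Op P (length xs)) p, map \<alpha> xs))"
  have "T_nt P Y \<alpha> (oc X (p, xs)) = H (uterm (oc X (p, xs)))"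
    by (simp add: T_nt_def H_def uterm_def)
  also have "\<dots> = H (p, xs)"
  proof (rule oc_invariant[OF oc_uterm])
    fix p xs \<sigma> assume a: "p \<in> obj (length xs)" "set xs \<subseteq> Obj X" "\<sigma> permutes {1..length xs}"
    have "idt (Op P (length xs)) (ao (length xs) \<sigma> p) = aa (length xs) \<sigma> (idt (Op P (length xs)) p)"
      using is_functorD(2)[OF act_functor[OF a(3)] a(1)] by simp
    moreover have "set (map \<alpha> xs) \<subseteq> Arr Y" using a(2) assms(3) by auto
    ultimately show "H (ao (length xs) \<sigma> p, xs) = H (p, act_list \<sigma> xs)"
      using a ac_act[of "idt (Op P (length xs)) p" "map \<alpha> xs" Y \<sigma>] cat_idt(1)[OF cat a(1)]
      by (simp add: H_def map_act_list)
  qed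
  finally show ?thesis by (simp add: H_def)
qed

lemma gam_arr:
  assumes "category A" "category B" "z \<in> Obj (T A \<otimes> T B)"
  shows "gam A B z \<in> Arr (T (A \<otimes> B))"
  using gam_nat_iso[OF assms(1,2)] assms(3) by (simp add: nat_iso_def nat_trans_def)

lemma T_objsE:
  assumes "set ts \<subseteq> Obj (T X)"
  obtains zs where "ts = map (oc X) zs" "set zs \<subseteq> Obj (C X)"
proof -
  have "\<forall>t\<in>set ts. \<exists>z. t = oc X z \<and> z \<in> Obj (C X)" using assms unfolding Tcat_def cat.simps by blast
  then obtain g where "\<And>t. t \<in> set ts \<Longrightarrow> t = oc X (g t) \<and> g t \<in> Obj (C X)" by metis
  then show thesis using that[of "map g ts"] by (auto simp: map_idI)
qed

lemma terms_list_mem: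
  assumes "set zs \<subseteq> Obj (C X)" "z \<in> set zs"
  shows "fst z \<in> obj (length (snd z))" "set (snd z) \<subseteq> Obj X"
  using assms by (cases z; force)+

text \<open>Axiom (6) on classes. It splits \<lambda> at a composite operation into
  \<open>L1\<close> after \<open>L2\<close> acted on by \<delta>; with \<delta> carried over to the
  entries, the two factors are the two cells of the pasting.\<close>

lemma gam_mu_left:
  assumes A: "category A" and B: "category B" and "z \<in> Obj (T (T A) \<otimes> T B)"
  shows "(gam A B \<lhd> (T_mu P A \<otimes>\<^sub>f id_fnct)) z =
           vcomp (T (A \<otimes> B))
             ((T_mu P (A \<otimes> B) \<odot> T_fun P (T (A \<otimes> B)) (rstr P A B)) \<rhd> gam (T A) B)
             (T_mu P (A \<otimes> B) \<rhd> (T_nt P (T (A \<otimes> B)) (gam A B) \<lhd> rstr P (T A) (T B))) z"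
proof -
  let ?AB = "A \<otimes> B"
  note AB = uprod_category[OF A B]
  obtain p ts r bs where z: "z = UPair (oc (T A) (p, ts)) (oc B (r, bs))"
    and p': "p \<in> obj (length ts)" "set ts \<subseteq> Obj (T A)" and r: "r \<in> obj (length bs)" "set bs \<subseteq> Obj B"
    using assms(3) by (metis uprod_objE T_objE)
  obtain zs where ts: "ts = map (oc A) zs" and zs: "set zs \<subseteq> Obj (C A)" using T_objsE[OF p'(2)] by blast
  note zm = terms_list_mem[OF zs]
  let ?ms = "map (length \<circ> snd) zs" and ?qs = "map fst zs" and ?n = "length bs" and ?as = "concat (map snd zs)"
  let ?G = "grid (\<lambda>b a. UPair a b) bs ?as" and ?H = "concat (map (\<lambda>as. grid (\<lambda>b a. UPair a b) bs as) (map snd zs))"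
  let ?\<delta> = "block_perm (concat (replicate ?n ?ms)) (transpose_perm ?n (length ?ms))"
  have p: "p \<in> obj (length zs)" "p \<in> obj (length ?ms)" using p' ts by simp_all
  have M: "length ?as = sum_list ?ms" by (simp add: length_concat)
  note qs = objs_terms[OF zs] and h = hom_lam_left[OF p(2) objs_terms[OF zs] r(1)]
  have lG: "length ?G = ?n * sum_list ?ms" unfolding length_grid M ..
  note mu = muO_mem[OF p(1) zs]
  have G: "set ?G \<subseteq> Obj ?AB" by (rule grid_pair_mem(1)[OF mu(2) r(2)])
  define L1 where "L1 = ma (concat (replicate ?n ?ms)) (lam (length ?ms) ?n p r) (concat (replicate ?n (map2 (\<lambda>k. idt (Op P k)) ?ms ?qs)))"
  define L2 where "L2 = ma (map (\<lambda>k. ?n * k) ?ms) (idt (Op P (length ?ms)) p) (map2 (\<lambda>k q. lam k ?n q r) ?ms ?qs)"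
  have "(gam A B \<lhd> (T_mu P A \<otimes>\<^sub>f id_fnct)) z = gam A B (UPair (oc A (mo ?ms p ?qs, ?as)) (oc B (r, bs)))"
    using T_mu_oc[OF A p(1) zs] by (simp add: whisker_right_def fprod_def id_fnct_def z ts muO_def)
  also have "\<dots> = sarr ?AB (lam (sum_list ?ms) ?n (mo ?ms p ?qs) r) ?G"
    unfolding gam_oc[OF A B mu r] M ..
  also have "\<dots> = sarr ?AB (cmp (Op P (?n * sum_list ?ms)) L1 (aa (?n * sum_list ?ms) ?\<delta> L2)) ?G"
    unfolding lam_mu_left_eq[OF p(2) qs r(1)] L1_def L2_def ..
  also have "\<dots> = cmp (T ?AB) (sarr ?AB L1 ?G) (sarr ?AB (aa (?n * sum_list ?ms) ?\<delta> L2) ?G)"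
    using sarr_cmp[OF AB h(2,1) lG[symmetric] G] by (simp only: L1_def L2_def)
  \<comment> \<open>The permutation leaves the operation for the entries, which it regroups from one
    row for each \<open>b\<close> into one grid for each inner term of the first argument.\<close>
  also have "sarr ?AB (aa (?n * sum_list ?ms) ?\<delta> L2) ?G = sarr ?AB L2 (act_list ?\<delta> ?G)"
    using sarr_act[OF AB _ G, of L2 ?\<delta>] hom_arr[OF hom_mu_lam_left[OF p(2) qs r(1)]] permutes_block_perm_transpose(1)[of ?n ?ms]
    unfolding lG L2_def by simp
  also have "act_list ?\<delta> ?G = ?H"
    by (rule act_list_block_perm_transpose) simp_all
  \<comment> \<open>The cell in which \<gamma> is applied to the outer term: \<lambda> at the outer
    operation \<open>p\<close>, while the multiplication inserts identities of the inner
    operations.\<close>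
  also have "sarr ?AB L1 ?G = FA (T_mu P ?AB) (FA (T_fun P (T ?AB) (rstr P A B)) (gam (T A) B z))"
  proof -
    have "grid (\<lambda>b t. FO (rstr P A B) (UPair t b)) bs (map (oc A) zs) =
      map (\<lambda>(b, z). oc ?AB (fst z, map (\<lambda>a. UPair a b) (snd z))) (grid Pair bs zs)"
      unfolding map_grid
      using r(2) zm by (intro arg_cong[where f = concat] map_cong HOL.refl) (auto simp: rstr_oc subset_iff)
    then have g: "FA (T_fun P (T ?AB) (rstr P A B)) (gam (T A) B z) = sarr (T ?AB) (lam (length ?ms) ?n p r)
       (map (\<lambda>i. oc ?AB (fst (snd i), map (\<lambda>a. UPair a (fst i)) (snd (snd i)))) (grid Pair bs zs))"
      using gam_sarr_T_fun[OF T_category[OF A] B T_category[OF AB] rstr_functor[OF A B] p' r] unfolding z ts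
      by (simp add: case_prod_unfold)
    have "FA (T_mu P ?AB) (sarr (T ?AB) (lam (length ?ms) ?n p r)
       (map (\<lambda>i. oc ?AB (fst (snd i), map (\<lambda>a. UPair a (fst i)) (snd (snd i)))) (grid Pair bs zs))) =
     sarr ?AB (ma (map (\<lambda>i. length (map (\<lambda>a. UPair a (fst i)) (snd (snd i)))) (grid Pair bs zs)) (lam (length ?ms) ?n p r)
       (map (\<lambda>i. idt (Op P (length (map (\<lambda>a. UPair a (fst i)) (snd (snd i))))) (fst (snd i))) (grid Pair bs zs)))
       (concat (map (\<lambda>i. map (\<lambda>a. UPair a (fst i)) (snd (snd i))) (grid Pair bs zs)))"
    proof (rule T_mu_sarr_oc[OF AB])
      show "lam (length ?ms) ?n p r \<in> arr (length (grid Pair bs zs))"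
        unfolding length_grid using hom_arr[OF lam_hom[OF p(2) r(1)]] by simp
    qed (use r(2) zm in \<open>auto simp: subset_iff\<close>)
    also have "\<dots> = sarr ?AB L1 ?G"
      unfolding map_grid concat_grid L1_def map2_map_map
      by (simp add: map_replicate_const map_concat o_def)
    finally show ?thesis unfolding g by simp
  qed
  \<comment> \<open>The cell in which \<gamma> is applied at each inner term: the outer operation
    contributes its identity, and the multiplication combines the \<lambda> of the inner
    operations.\<close>
  also have "sarr ?AB L2 ?H = FA (T_mu P ?AB) (T_nt P (T ?AB) (gam A B) (FO (rstr P (T A) (T B)) z))"
  proof -
    let ?xs = "map (\<lambda>t. UPair t (oc B (r, bs))) (map (oc A) zs)"
    have xs: "set ?xs \<subseteq> Obj (T A \<otimes> T B)" "p \<in> obj (length ?xs)" using p zm r by force+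
    have m: "map (gam A B) ?xs = map (\<lambda>z. sarr ?AB (lam (length (snd z)) ?n (fst z) r) (grid (\<lambda>b a. UPair a b) bs (snd z))) zs"
      unfolding map_map using gam_oc[OF A B zm r] by (intro map_cong HOL.refl) simp
    have "T_nt P (T ?AB) (gam A B) (FO (rstr P (T A) (T B)) z) =
      ac (T ?AB) (idt (Op P (length zs)) p, map (gam A B) ?xs)"
      using rstr_oc[OF T_mem(1)[of "(r, bs)" B] p'] r T_nt_oc[OF xs(2,1) gam_arr[OF A B]]
      by (simp add: z ts del: map_map)
    moreover have "FA (T_mu P ?AB) (ac (T ?AB) (idt (Op P (length zs)) p, map (gam A B) ?xs)) =
      sarr ?AB (ma (map (\<lambda>z. length (grid (\<lambda>b a. UPair a b) bs (snd z))) zs) (idt (Op P (length zs)) p)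
        (map (\<lambda>z. lam (length (snd z)) ?n (fst z) r) zs)) (concat (map (\<lambda>z. grid (\<lambda>b a. UPair a b) bs (snd z)) zs))"
      unfolding m
    proof (rule T_mu_sarr_map[OF AB cat_idt(1)[OF cat p(1)]], intro conjI)
      fix z assume "z \<in> set zs"
      note zz = zm[OF this]
      show "lam (length (snd z)) ?n (fst z) r \<in> arr (length (grid (\<lambda>b a. UPair a b) bs (snd z)))"
        by (rule hom_arr[OF gam_pair_lam[OF zz(1) r(1)]])
      show "set (grid (\<lambda>b a. UPair a b) bs (snd z)) \<subseteq> Obj ?AB" by (rule grid_pair_mem(1)[OF zz(2) r(2)])
    qed
    ultimately show ?thesis unfolding L2_def map2_map_map length_grid by (simp add: o_def)
  qed
  finally show ?thesis by (simp add: vcomp_def whisker_left_def whisker_right_def fcomp_def)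
qed

text \<open>Axiom (7) on classes. Here the inner terms group the rows of the grid, and the
  permutation carried over to the entries is a block sum that transposes the group of each inner
  term. The cell for the outer operation now comes first.\<close>

lemma gam_mu_right:
  assumes A: "category A" and B: "category B" and "z \<in> Obj (T A \<otimes> T (T B))"
  shows "(gam A B \<lhd> (id_fnct \<otimes>\<^sub>f T_mu P B)) z =
           vcomp (T (A \<otimes> B))
             (T_mu P (A \<otimes> B) \<rhd> (T_nt P (T (A \<otimes> B)) (gam A B) \<lhd> lstr P (T A) (T B)))
             ((T_mu P (A \<otimes> B) \<odot> T_fun P (T (A \<otimes> B)) (lstr P A B)) \<rhd> gam A (T B)) z"
proof -
  let ?AB = "A \<otimes> B"
  note AB = uprod_category[OF A B]
  obtain p as q ts where z: "z = UPair (oc A (p, as)) (oc (T B) (q, ts))"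
    and p: "p \<in> obj (length as)" "set as \<subseteq> Obj A" and q': "q \<in> obj (length ts)" "set ts \<subseteq> Obj (T B)"
    using assms(3) by (metis uprod_objE T_objE)
  obtain ws where ts: "ts = map (oc B) ws" and ws: "set ws \<subseteq> Obj (C B)" using T_objsE[OF q'(2)] by blast
  note wm = terms_list_mem[OF ws]
  let ?ns = "map (length \<circ> snd) ws" and ?rs = "map fst ws" and ?l = "length as" and ?bs = "concat (map snd ws)"
  let ?G = "grid (\<lambda>b a. UPair a b) ?bs as" and ?H = "concat (map (\<lambda>bs. grid UPair as bs) (map snd ws))"
  let ?\<beta> = "block_sum (map (\<lambda>k. k * ?l) ?ns) (map (\<lambda>k. transpose_perm k ?l) ?ns)"
  have q: "q \<in> obj (length ws)" "q \<in> obj (length ?ns)" using q' ts by simp_all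
  have N: "length ?bs = sum_list ?ns" by (simp add: length_concat)
  note rs = objs_terms[OF ws] and h = hom_lam_right[OF p(1) q(2) objs_terms[OF ws]]
  have lG: "length ?G = sum_list ?ns * ?l" unfolding length_grid N ..
  note mu = muO_mem[OF q(1) ws]
  have G: "set ?G \<subseteq> Obj ?AB" by (rule grid_pair_mem(1)[OF p(2) mu(2)])
  define L1 where "L1 = ma (map (\<lambda>k. k * ?l) ?ns) (idt (Op P (length ?ns)) q) (map2 (\<lambda>k r. lam ?l k p r) ?ns ?rs)"
  define L2 where "L2 = ma (concat (map (\<lambda>k. replicate ?l k) ?ns)) (lam ?l (length ?ns) p q)
    (concat (map2 (\<lambda>k r. replicate ?l (idt (Op P k) r)) ?ns ?rs))"
  \<comment> \<open>\<open>hom_lam_right\<close> types this factor only after the block sum has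
    acted; carrying the block sum over to the entries needs the factor itself to be an
    arrow.\<close>
  have L2: "L2 \<in> arr (sum_list ?ns * ?l)"
    using mu_arr(1)[of "lam ?l (length ?ns) p q" "concat (map (\<lambda>k. replicate ?l k) ?ns)"
        "map2 (\<lambda>k. idt (Op P k)) (concat (map (\<lambda>k. replicate ?l k) ?ns)) (concat (map (\<lambda>r. replicate ?l r) ?rs))"]
      hom_mu_idt[OF _ objs_concat(2)[OF rs], of "lam ?l (length ?ns) p q" ?l] lam_hom[OF p(1) q(2)]
      map2_concat(2)[of ?ns ?rs ?l "\<lambda>k. idt (Op P k)"]
    by (simp only: L2_def sum_list_concat_replicate length_map) (auto dest: hom_arr)
  have "(gam A B \<lhd> (id_fnct \<otimes>\<^sub>f T_mu P B)) z = gam A B (UPair (oc A (p, as)) (oc B (mo ?ns q ?rs, ?bs)))"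
    using T_mu_oc[OF B q(1) ws] by (simp add: whisker_right_def fprod_def id_fnct_def z ts muO_def)
  also have "\<dots> = sarr ?AB (lam ?l (sum_list ?ns) p (mo ?ns q ?rs)) ?G"
    unfolding gam_oc[OF A B p mu] N ..
  also have "\<dots> = sarr ?AB (cmp (Op P (sum_list ?ns * ?l)) L1 (aa (sum_list ?ns * ?l) ?\<beta> L2)) ?G"
    unfolding lam_mu_right_eq[OF p(1) q(2) rs] L1_def L2_def ..
  also have "\<dots> = cmp (T ?AB) (sarr ?AB L1 ?G) (sarr ?AB (aa (sum_list ?ns * ?l) ?\<beta> L2) ?G)"
    using sarr_cmp[OF AB h(1,2) lG[symmetric] G] by (simp only: L1_def L2_def)
  also have "sarr ?AB (aa (sum_list ?ns * ?l) ?\<beta> L2) ?G = sarr ?AB L2 (act_list ?\<beta> ?G)"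
    using sarr_act[OF AB _ G, of L2 ?\<beta>] L2 permutes_block_sum_transpose(2)[of ?l ?ns]
    unfolding lG by simp
  also have "act_list ?\<beta> ?G = ?H"
    by (rule act_list_block_sum_transpose(2)) simp_all
  \<comment> \<open>\<gamma> on the outer term again: the grid is now indexed by an inner term and
    an entry \<open>a\<close>, in this order, so each pair contributes one row of the grid of its
    inner term.\<close>
  also have "sarr ?AB L2 ?H = FA (T_mu P ?AB) (FA (T_fun P (T ?AB) (lstr P A B)) (gam A (T B) z))"
  proof -
    have "grid (\<lambda>t a. FO (lstr P A B) (UPair a t)) (map (oc B) ws) as =
      map (\<lambda>(w, a). oc ?AB (fst w, map (UPair a) (snd w))) (grid Pair ws as)"
      unfolding map_grid map_map
      using p(2) wm by (intro arg_cong[where f = concat] map_cong HOL.refl) (auto simp: lstr_oc subset_iff)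
    then have g: "FA (T_fun P (T ?AB) (lstr P A B)) (gam A (T B) z) = sarr (T ?AB) (lam ?l (length ?ns) p q)
       (map (\<lambda>i. oc ?AB (fst (fst i), map (UPair (snd i)) (snd (fst i)))) (grid Pair ws as))"
      using gam_sarr_T_fun[OF A T_category[OF B] T_category[OF AB] lstr_functor[OF A B] p q'] unfolding z ts
      by (simp add: case_prod_unfold)
    have "FA (T_mu P ?AB) (sarr (T ?AB) (lam ?l (length ?ns) p q)
       (map (\<lambda>i. oc ?AB (fst (fst i), map (UPair (snd i)) (snd (fst i)))) (grid Pair ws as))) =
     sarr ?AB (ma (map (\<lambda>i. length (map (UPair (snd i)) (snd (fst i)))) (grid Pair ws as)) (lam ?l (length ?ns) p q)
       (map (\<lambda>i. idt (Op P (length (map (UPair (snd i)) (snd (fst i))))) (fst (fst i))) (grid Pair ws as)))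
       (concat (map (\<lambda>i. map (UPair (snd i)) (snd (fst i))) (grid Pair ws as)))"
    proof (rule T_mu_sarr_oc[OF AB])
      show "lam ?l (length ?ns) p q \<in> arr (length (grid Pair ws as))"
        unfolding length_grid using hom_arr[OF lam_hom[OF p(1) q(2)]] by simp
    qed (use p(2) wm in \<open>auto simp: subset_iff\<close>)
    also have "\<dots> = sarr ?AB L2 ?H"
      unfolding map_grid concat_grid L2_def map2_map_map
      by (simp add: map_replicate_const map_concat o_def)
    finally show ?thesis unfolding g by simp
  qed
  also have "sarr ?AB L1 ?G = FA (T_mu P ?AB) (T_nt P (T ?AB) (gam A B) (FO (lstr P (T A) (T B)) z))"
  proof -
    let ?xs = "map (UPair (oc A (p, as))) (map (oc B) ws)"
    have xs: "set ?xs \<subseteq> Obj (T A \<otimes> T B)" "q \<in> obj (length ?xs)" using q wm p by force+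
    have m: "map (gam A B) ?xs = map (\<lambda>w. sarr ?AB (lam ?l (length (snd w)) p (fst w)) (grid (\<lambda>b a. UPair a b) (snd w) as)) ws"
      unfolding map_map using gam_oc[OF A B p wm] by (intro map_cong HOL.refl) simp
    have "T_nt P (T ?AB) (gam A B) (FO (lstr P (T A) (T B)) z) =
      ac (T ?AB) (idt (Op P (length ws)) q, map (gam A B) ?xs)"
      using lstr_oc[OF T_mem(1)[of "(p, as)" A] q'] p T_nt_oc[OF xs(2,1) gam_arr[OF A B]]
      by (simp add: z ts del: map_map)
    moreover have "FA (T_mu P ?AB) (ac (T ?AB) (idt (Op P (length ws)) q, map (gam A B) ?xs)) =
      sarr ?AB (ma (map (\<lambda>w. length (grid (\<lambda>b a. UPair a b) (snd w) as)) ws) (idt (Op P (length ws)) q)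
        (map (\<lambda>w. lam ?l (length (snd w)) p (fst w)) ws)) (concat (map (\<lambda>w. grid (\<lambda>b a. UPair a b) (snd w) as) ws))"
      unfolding m
    proof (rule T_mu_sarr_map[OF AB cat_idt(1)[OF cat q(1)]], intro conjI)
      fix w assume "w \<in> set ws"
      note ww = wm[OF this]
      show "lam ?l (length (snd w)) p (fst w) \<in> arr (length (grid (\<lambda>b a. UPair a b) (snd w) as))"
        by (rule hom_arr[OF gam_pair_lam[OF p(1) ww(1)]])
      show "set (grid (\<lambda>b a. UPair a b) (snd w) as) \<subseteq> Obj ?AB" by (rule grid_pair_mem(1)[OF p(2) ww(2)])
    qed
    ultimately show ?thesis unfolding L1_def map2_map_map length_grid concat_map_concat[symmetric] by (simp add: o_def)
  qed
  finally show ?thesis by (simp add: vcomp_def whisker_left_def whisker_right_def fcomp_def)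
qed

theorem gam_symmetric_monad_pseudo_comm: "symmetric_monad_pseudo_comm P gam"
  unfolding symmetric_monad_pseudo_comm_def monad_pseudo_comm_def invertible_modification_def
  by (intro conjI allI impI ballI gam_nat_iso gam_modification gam_lstr_left gam_lstr_rstr gam_rstr_right
      gam_eta_left gam_eta_right gam_mu_left gam_mu_right gam_swap)

end

text \<open>\<open>t\<close> and \<open>lam\<close> are total functions, and the axioms speak of
  them only at positive arities and at objects of the operad; uniqueness is agreement there.\<close>

theorem corollary17p20:
  fixes P :: "('o, 'a) operad"
  assumes "symmetric_operad P" and "contractible_operad P"
  shows "(\<exists>t lam. operad_pseudo_comm P t lam \<and>
            (\<forall>t' lam'. operad_pseudo_comm P t' lam' \<longrightarrow>
               (\<forall>m>0. \<forall>n>0. t' m n = t m n \<and>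
                  (\<forall>p\<in>Obj (Op P n). \<forall>q\<in>Obj (Op P m). lam' n m p q = lam n m p q))))
       \<and> (\<exists>\<gamma> :: ('o, 'a, 'x, 'y) ucat \<Rightarrow> ('o, 'a, 'x, 'y) ucat \<Rightarrow> ('o, 'a, 'x, 'y) utrans.
            symmetric_monad_pseudo_comm P \<gamma>)"
proof -
  interpret contractible_operad_in_Cat P
    by (unfold_locales) (rule assms)+
  show ?thesis
    using operad_pseudo_comm_lam operad_pseudo_comm_unique gam_symmetric_monad_pseudo_comm by blast
qed

end
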